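(* Let $p,q$ be positive integers. (1) The zeta polynomial of $NC^{(B)}(p,q)$ is given by the formula $$Z_{NC^{(B)}(p,q)}(m) = \binom{mp}{p}\binom{mq}{q}+\sum_{c=1}^p 2c\binom{mp}{p-c}\binom{mq}{q+c}.$$ (2) The number of maximal chains in $NC^{(B)}(p,q)$ is equal to $$\binom{p+q}{p}p^pq^q+\sum_{c\ge1}2c\binom{p+q}{p-c}p^{p-c}q^{q+c}.$$
   Context: The zeta polynomial $Z_P$ of a finite poset $P$ is the polynomial such that for every integer $m\ge2$, $Z_P(m)$ is the number of multichains $\pi_1\le\cdots\le\pi_{m-1}$ in $P$. For an integer $b\ge 0$, $\binom{X}{b}=X(X-1)\cdots(X-b+1)/b!$ is regarded as a polynomial in $X$; $\binom{X}{b}=0$ for $b<0$ (so terms with $c>p$ in (2) vanish). Let $p,q$ be positive integers and $N = p+q$. The hyperoctahedral group $B_N$ is the group of permutations $\tau$ of $\{\pm 1,\ldots,\pm N\}$ with $\tau(-i) = -\tau(i)$ for $1\le i\le N$. It is generated by the set consisting of the elements $(i,j)(-i,-j)$ and $(i,-j)(-i,j)$ for $1\le i,j\le N$, $i\neq j$, and the elements $(i,-i)$ for $1\le i\le N$. For $\tau\in B_N$, let $\ell_B(\tau)$ be the smallest $k\ge 0$ such that $\tau$ is a product of $k$ of these generators (the empty product being the identity). The partial order on $B_N$ is: $\tau\le\sigma$ if and only if $\ell_B(\sigma)=\ell_B(\tau)+\ell_B(\tau^{-1}\sigma)$. Let $\gamma_{p,q}\in B_N$ be the permutation with two cycles $$\gamma_{p,q}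 = (1,\ldots,p,-1,\ldots,-p)\,(p+1,\ldots,p+q,-(p+1),\ldots,-(p+q)),$$ and let $\mathcal{S}^{(B)}_{nc}(p,q) = \{\tau\in B_N \mid \tau\le\gamma_{p,q}\}$. For $\tau\in B_N$, let $\Omega(\tau)$ be the partition of $\{\pm1,\ldots,\pm N\}$ into orbits of $\tau$, and let $\widetilde{\Omega}(\tau)$ be the partition obtained from $\Omega(\tau)$ by merging all inversion-invariant blocks (blocks $A$ with $A=-A$), if any exist, into one single block. Define $NC^{(B)}(p,q) = \{\widetilde{\Omega}(\tau)\mid \tau\in \mathcal{S}^{(B)}_{nc}(p,q)\}$, partially ordered by $\pi\le\rho$ if and only if every block of $\pi$ is contained in a block of $\rho$. *)

theory Defs
  imports
    "HOL-Computational_Algebra.Polynomial"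
    "HOL-Combinatorics.Combinatorics"
    "HOL-Library.Disjoint_Sets"
begin

section \<open>Zeta polynomials of finite posets\<close>

definition multichains :: "'a set \<Rightarrow> ('a \<Rightarrow> 'a \<Rightarrow> bool) \<Rightarrow> nat \<Rightarrow> 'a list set" where
  "multichains P le k = {xs. set xs \<subseteq> P \<and> length xs = k \<and> sorted_wrt le xs}"

definition is_zeta_polynomial :: "'a set \<Rightarrow> ('a \<Rightarrow> 'a \<Rightarrow> bool) \<Rightarrow> rat poly \<Rightarrow> bool" where
  "is_zeta_polynomial P le Z \<longleftrightarrow>
     (\<forall>m::nat\<ge>2. poly Z (of_nat m) = of_nat (card (multichains P le (m - 1))))"

definition zeta_polynomial :: "'a set \<Rightarrow> ('a \<Rightarrow> 'a \<Rightarrow> bool) \<Rightarrow> rat poly" where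
  "zeta_polynomial P le = (THE Z. is_zeta_polynomial P le Z)"

lemma is_zeta_polynomial_unique:
  assumes "is_zeta_polynomial P le Y" and "is_zeta_polynomial P le Z"
  shows "Y = Z"
proof (rule ccontr)
  assume "Y \<noteq> Z"
  then have "finite {x. poly (Y - Z) x = 0}"
    by (intro poly_roots_finite) simp
  moreover have "(of_nat :: nat \<Rightarrow> rat) ` {2..} \<subseteq> {x. poly (Y - Z) x = 0}"
    using assms by (auto simp: is_zeta_polynomial_def)
  ultimately have "finite ((of_nat :: nat \<Rightarrow> rat) ` {2..})"
    by (rule rev_finite_subset)
  then have "finite {2::nat..}"
    by (rule finite_imageD) (simp add: inj_on_def)
  then show False
    by (simp add: infinite_Ici)
qed

lemma zeta_polynomial_eqI:
  "is_zeta_polynomial P le Z \<Longrightarrow> zeta_polynomial P le = Z"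
  unfolding zeta_polynomial_def
  by (rule the_equality) (auto intro: is_zeta_polynomial_unique)


section \<open>The hyperoctahedral group\<close>

definition signed_set :: "nat \<Rightarrow> int set" where
  "signed_set N = {- int N..int N} - {0}"

text \<open>Elements of the group are functions on all integers that fix everything outside
  \<^term>\<open>signed_set N\<close>; the group operation is composition.\<close>

definition hyperoctahedral :: "nat \<Rightarrow> (int \<Rightarrow> int) set" where
  "hyperoctahedral N = {\<tau>. \<tau> permutes signed_set N \<and> (\<forall>i\<in>{1..int N}. \<tau> (- i) = - \<tau> i)}"

definition generators_B :: "nat \<Rightarrow> (int \<Rightarrow> int) set" where
  "generators_B N =
     {transpose i j \<circ> transpose (- i) (- j) | i j. i \<in> {1..int N} \<and> j \<in> {1..int N} \<and> i \<noteq> j} \<union>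
     {transpose i (- j) \<circ> transpose (- i) j | i j. i \<in> {1..int N} \<and> j \<in> {1..int N} \<and> i \<noteq> j} \<union>
     {transpose i (- i) | i. i \<in> {1..int N}}"

definition length_B :: "nat \<Rightarrow> (int \<Rightarrow> int) \<Rightarrow> nat" where
  "length_B N \<tau> =
     (LEAST k. \<exists>ts. length ts = k \<and> set ts \<subseteq> generators_B N \<and> \<tau> = foldr (\<circ>) ts id)"

definition le_B :: "nat \<Rightarrow> (int \<Rightarrow> int) \<Rightarrow> (int \<Rightarrow> int) \<Rightarrow> bool" where
  "le_B N \<tau> \<sigma> \<longleftrightarrow> length_B N \<sigma> = length_B N \<tau> + length_B N (inv \<tau> \<circ> \<sigma>)"


section \<open>Annular noncrossing permutations and partitions of type B\<close>

definition gamma_B :: "nat \<Rightarrow> nat \<Rightarrow> int \<Rightarrow> int" where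
  "gamma_B p q =
     cycle_of_list ([1..int p] @ map uminus [1..int p]) \<circ>
     cycle_of_list ([int p + 1..int (p + q)] @ map uminus [int p + 1..int (p + q)])"

definition S_nc_B :: "nat \<Rightarrow> nat \<Rightarrow> (int \<Rightarrow> int) set" where
  "S_nc_B p q = {\<tau> \<in> hyperoctahedral (p + q). le_B (p + q) \<tau> (gamma_B p q)}"

definition Omega :: "nat \<Rightarrow> (int \<Rightarrow> int) \<Rightarrow> int set set" where
  "Omega N \<tau> = orbit \<tau> ` signed_set N"

definition merge_invariant :: "int set set \<Rightarrow> int set set" where
  "merge_invariant \<pi> =
     (let I = {A \<in> \<pi>. uminus ` A = A} in if I = {} then \<pi> else (\<pi> - I) \<union> {\<Union>I})"

definition Omega_tilde :: "nat \<Rightarrow> (int \<Rightarrow> int) \<Rightarrow> int set set" where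
  "Omega_tilde N \<tau> = merge_invariant (Omega N \<tau>)"

definition NC_B :: "nat \<Rightarrow> nat \<Rightarrow> int set set set" where
  "NC_B p q = Omega_tilde (p + q) ` S_nc_B p q"

text \<open>The order on \<^term>\<open>NC_B p q\<close>: \<^const>\<open>refines\<close> also requires both arguments to
  be partitions of the carrier, which holds for all elements of \<^term>\<open>NC_B p q\<close>.\<close>

definition le_NC_B :: "nat \<Rightarrow> nat \<Rightarrow> int set set \<Rightarrow> int set set \<Rightarrow> bool" where
  "le_NC_B p q = refines (signed_set (p + q))"

end

theory Submission
  imports Defs
    "HOL-Computational_Algebra.Formal_Power_Series"
    "HOL-Library.Numeral_Type"
    "HOL-Library.Function_Algebras"
begin

text \<open>
The proof has a geometric half, which replaces partitions by group elements, and an enumerative half,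
which counts factorizations.

The hyperoctahedral group acts on odd vectors, that is, on functions \<open>x\<close> with
\<open>x (- i) = - x i\<close>. As in Carter's lemma, the length of \<open>w\<close> is the codimension of its fixed
space (\<open>card_Fix\<close>); scalars are taken modulo 3, so that dimensions become cardinalities. The
fixed space and the partition \<open>Omega_tilde N w\<close> determine each other, because fixed vectors are
constant on orbits and vanish exactly on the inversion-invariant ones. The two-cycle element
\<open>\<gamma>\<close> has no fixed vectors. By an argument of Brady and Watt, the order on elements below such a
\<open>\<gamma>\<close> is inclusion of moved spaces, and this is refinement of partitions
(\<open>refines_Omega_tilde_iff_le\<close>). So the poset is the interval from the identity to \<open>\<gamma>\<close>, and its
multichains with \<open>m - 1\<close> members are the factorizations of \<open>\<gamma>\<close> into \<open>m\<close> factors with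
additive lengths.

To count these, choose a label \<open>n\<close>. Each factor is uniquely an element fixing \<open>n\<close> times at most one
reflection moving \<open>n\<close>, and the reflections can all be shifted to the right end
(\<open>factor_count_eq_strip\<close>). Undoing them one at a time only affects the cycles through the labels
involved: a positive cycle loses a positive cycle; a negative cycle splits into a positive and a negative one or changes
its sign; two negative cycles join to a positive one. In generating functions in the cycle length
of \<open>n\<close>, with \<open>\<phi>(u) = (1 + u)^m\<close>, this says that the counts
\<open>A\<close> for positive cycles, \<open>B\<close> for one negative cycle and \<open>G\<close> for two
negative cycles, the second of length \<open>q\<close>, satisfy
\<open>A = x \<phi>(A)\<close>, \<open>B = x \<phi>'(A) (1 + B)\<close> and
\<open>G = x \<phi>'(A) (G + B_q) + 2 q D\<close>, where \<open>D\<close> comes from joining the two cycles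
(\<open>factor_count_cycles\<close>).

Lagrange inversion turns the division by \<open>1 - x \<phi>'(A)\<close> into coefficient extraction. The
disconnected part yields the product of two binomial coefficients. The connected part yields the sum, as
\<open>q D\<close>, written in \<open>u = A\<close>, is the part with positive powers of \<open>u\<close> of
\<open>u d/du (\<phi>(u) / u)^q\<close> (\<open>merge_fps_compose_nth\<close>); the coefficient of \<open>u^c\<close> in it is
\<open>c\<close> times a binomial coefficient.

Maximal chains are the factorizations of \<open>\<gamma>\<close> into reflections. Their number is
\<open>(p + q)!\<close> times the leading coefficient of the zeta polynomial, since a factorization into
\<open>m\<close> factors is one into \<open>k\<close> non-trivial factors together with their \<open>m choose k\<close> possible positions.
\<close>

section \<open>Power series for trees, discs and annuli\<close>

unbundle fps_syntax

text \<open>Composition with a series without constant term is locally finite, so a coefficient of a product with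
\<open>K oo f\<close> may be computed term by term in \<open>K\<close>.\<close>
lemma fps_compose_mult_nth:
  fixes K f g :: "rat fps"
  assumes f0: "f $ 0 = 0"
  shows "((K oo f) * g) $ n = (\<Sum>i\<le>n. K $ i * (f ^ i * g) $ n)"
proof -
  have "((K oo f) * g) $ n = (\<Sum>j\<le>n. (\<Sum>i\<le>j. K $ i * (f ^ i) $ j) * g $ (n - j))"
    by (simp add: fps_mult_nth fps_compose_nth atLeast0AtMost)
  also have "\<dots> = (\<Sum>j\<le>n. (\<Sum>i\<le>n. K $ i * (f ^ i) $ j) * g $ (n - j))"
    by (intro sum.cong refl arg_cong2[where f="(*)"] sum.mono_neutral_left)
      (auto simp: startsby_zero_power_prefix[OF f0])
  also have "\<dots> = (\<Sum>j\<le>n. \<Sum>i\<le>n. K $ i * ((f ^ i) $ j * g $ (n - j)))"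
    by (simp add: sum_distrib_right mult.assoc)
  also have "\<dots> = (\<Sum>i\<le>n. \<Sum>j\<le>n. K $ i * ((f ^ i) $ j * g $ (n - j)))"
    by (rule sum.swap)
  also have "\<dots> = (\<Sum>i\<le>n. K $ i * (f ^ i * g) $ n)"
    by (simp add: fps_mult_nth sum_distrib_left atLeast0AtMost)
  finally show ?thesis .
qed

text \<open>Lagrange inversion in the form in which the recursions below produce their solutions. Substituting
\<open>f = u / \<phi>(u)\<close>, the inverse of \<open>fps_inv f\<close>, turns the hypothesis into
\<open>h = (K oo f) * (1 - f \<phi>')\<close>, and
\<open>1 - f \<phi>' = \<phi> f'\<close>. So \<open>h \<phi>^n\<close> is the sum of the
\<open>K_i f^i f' \<phi>^(n+1)\<close>, and for \<open>i < n\<close> such a term is, up to a constant and the factor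
\<open>u^(n+1)\<close>, the derivative of the Laurent series \<open>f^(i-n)\<close>, hence has no residue.\<close>
lemma fps_Lagrange:
  fixes \<phi> h K :: "rat fps"
  defines "f \<equiv> fps_X * inverse \<phi>"
  assumes \<phi>0: "\<phi> $ 0 \<noteq> 0"
    and K: "K * (1 - fps_X * (fps_deriv \<phi> oo fps_inv f)) = h oo fps_inv f"
  shows "K $ n = (h * \<phi> ^ n) $ n"
proof -
  have inv\<phi>: "\<phi> * inverse \<phi> = 1" using \<phi>0 by (rule inverse_mult_eq_1')
  have f0: "f $ 0 = 0" and f1: "f $ 1 \<noteq> 0" using \<phi>0 by (auto simp: f_def)
  have Af: "fps_inv f oo f = fps_X" by (rule fps_inv[OF f0 f1])
  have A0: "fps_inv f $ 0 = 0" by (simp add: fps_inv_def)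
  have "(K * (1 - fps_X * (fps_deriv \<phi> oo fps_inv f))) oo f = (h oo fps_inv f) oo f"
    by (simp add: K)
  then have hK: "(K oo f) * (1 - f * fps_deriv \<phi>) = h"
    by (simp add: fps_compose_mult_distrib[OF f0] fps_compose_sub_distrib f0 Af
        flip: fps_compose_assoc[OF f0 A0])
  have coeff: "(f ^ i * ((1 - f * fps_deriv \<phi>) * \<phi> ^ n)) $ n = (if i = n then 1 else 0)" if "i \<le> n" for i
  proof -
    define k where "k = n - i"
    have n: "n = i + k" using that by (simp add: k_def)
    have "f ^ i * \<phi> ^ n = fps_X ^ i * (\<phi> * inverse \<phi>) ^ i * \<phi> ^ k"
      by (simp add: f_def n power_add power_mult_distrib)
    then have eq: "f ^ i * \<phi> ^ n = fps_X ^ i * \<phi> ^ k" by (simp add: inv\<phi>)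
    have "f ^ i * ((1 - f * fps_deriv \<phi>) * \<phi> ^ n) = (f ^ i * \<phi> ^ n) * (1 - f * fps_deriv \<phi>)"
      by (simp add: algebra_simps)
    also have "\<dots> = fps_X ^ i * (\<phi> ^ k * (1 - f * fps_deriv \<phi>))" by (simp only: eq mult.assoc)
    finally have "(f ^ i * ((1 - f * fps_deriv \<phi>) * \<phi> ^ n)) $ n
        = (fps_X ^ i * (\<phi> ^ k * (1 - f * fps_deriv \<phi>))) $ n" by (simp only:)
    also have "\<dots> = (\<phi> ^ k * (1 - f * fps_deriv \<phi>)) $ k"
      by (simp add: n fps_X_power_mult_nth)
    also have "\<dots> = (if k = 0 then 1 else 0)"
    proof (cases k)
      case 0 then show ?thesis by (simp add: f_def)
    next
      case (Suc l)
      have "\<phi> ^ k * (f * fps_deriv \<phi>) = fps_X * (\<phi> * inverse \<phi>) * (\<phi> ^ l * fps_deriv \<phi>)"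
        by (simp add: Suc f_def mult_ac)
      then have "\<phi> ^ k * (f * fps_deriv \<phi>) = fps_X * (\<phi> ^ l * fps_deriv \<phi>)" by (simp add: inv\<phi>)
      moreover have "fps_deriv (\<phi> ^ k) = of_nat k * \<phi> ^ l * fps_deriv \<phi>"
        by (simp add: fps_deriv_power fps_of_nat Suc mult_ac del: power_Suc of_nat_Suc)
      ultimately have "of_nat k * (\<phi> ^ k * (f * fps_deriv \<phi>)) = fps_X * fps_deriv (\<phi> ^ k)"
        by (simp only: mult_ac)
      then have "(fps_const (of_nat k) * (\<phi> ^ k * (f * fps_deriv \<phi>))) $ k = (fps_X * fps_deriv (\<phi> ^ k)) $ k"
        by (simp flip: fps_of_nat)
      then have "of_nat k * (\<phi> ^ k * (f * fps_deriv \<phi>)) $ k = of_nat k * (\<phi> ^ k) $ k"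
        by (simp add: Suc del: power_Suc)
      then have "(\<phi> ^ k * (f * fps_deriv \<phi>)) $ k = (\<phi> ^ k) $ k" by (simp add: Suc del: power_Suc of_nat_Suc)
      then show ?thesis by (simp add: Suc right_diff_distrib del: power_Suc)
    qed
    finally show ?thesis by (simp add: n)
  qed
  have "(h * \<phi> ^ n) $ n = ((K oo f) * ((1 - f * fps_deriv \<phi>) * \<phi> ^ n)) $ n"
    by (simp add: mult.assoc flip: hK)
  also have "\<dots> = (\<Sum>i\<le>n. K $ i * (if i = n then 1 else 0))"
    unfolding fps_compose_mult_nth[OF f0] by (intro sum.cong refl) (simp add: coeff)
  also have "\<dots> = K $ n" by (simp add: if_distrib cong: if_cong)
  finally show ?thesis by simp
qed

text \<open>The substitution of \<open>u * z\<close> for the variable, as a series in \<open>z\<close> whose coefficients are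
series in \<open>u\<close>. It allows the bivariate identity behind \<open>polar_fps_nth\<close> to be stated
without negative powers of \<open>u\<close>.\<close>
definition fps_dilate :: "rat fps \<Rightarrow> rat fps fps" where
  "fps_dilate a = Abs_fps (\<lambda>j. fps_const (a $ j) * fps_X ^ j)"

lemma fps_dilate_nth [simp]: "fps_dilate a $ j = fps_const (a $ j) * fps_X ^ j"
  by (simp add: fps_dilate_def)

lemma fps_const_sum: "fps_const (sum g S) = (\<Sum>i\<in>S. fps_const (g i))"
  by (induction S rule: infinite_finite_induct) (simp_all flip: fps_const_add)

lemma fps_dilate_mult: "fps_dilate (a * b) = fps_dilate a * fps_dilate b"
proof (rule fps_ext)
  fix n
  have "(fps_dilate a * fps_dilate b) $ n
      = (\<Sum>i=0..n. fps_const (a $ i * b $ (n - i)) * (fps_X ^ i * fps_X ^ (n - i)))"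
    unfolding fps_mult_nth by (intro sum.cong refl) (simp add: mult_ac flip: fps_const_mult)
  also have "\<dots> = (\<Sum>i=0..n. fps_const (a $ i * b $ (n - i)) * fps_X ^ n)"
    by (intro sum.cong refl) (simp flip: power_add)
  also have "\<dots> = fps_dilate (a * b) $ n"
    by (simp add: fps_mult_nth sum_distrib_right fps_const_sum)
  finally show "fps_dilate (a * b) $ n = (fps_dilate a * fps_dilate b) $ n" by simp
qed

lemma fps_dilate_add: "fps_dilate (a + b) = fps_dilate a + fps_dilate b"
  by (rule fps_ext) (simp add: distrib_right flip: fps_const_add)

lemma fps_dilate_1 [simp]: "fps_dilate 1 = 1"
  by (rule fps_ext) simp

lemma fps_dilate_power: "fps_dilate (a ^ k) = fps_dilate a ^ k"
  by (induction k) (simp_all add: fps_dilate_mult)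

lemma fps_dilate_X: "fps_dilate fps_X = fps_const fps_X * fps_X"
proof (rule fps_ext)
  fix j show "fps_dilate fps_X $ j = (fps_const fps_X * fps_X) $ j"
    by (cases "j = 1") auto
qed

context
  fixes m :: nat
begin

text \<open>The three families of minimal factorizations into \<open>m\<close> factors that matter here are those of a positive
cycle, of one negative cycle, and of two negative cycles. Their counts are the coefficients of
\<open>tree_fps\<close>, \<open>disc_fps\<close> and \<open>annular_fps q\<close>. With
\<open>\<phi> = step_fps\<close>, the first is the solution \<open>A\<close> of \<open>A = x * \<phi>(A)\<close>, and
the other two solve linear equations in which the unknown is multiplied by \<open>x * \<phi>'(A)\<close>,
the series \<open>fps_X * slope_fps\<close> below.\<close>
definition "step_fps = (1 + fps_X :: rat fps) ^ m"
definition "tree_fps = fps_inv (fps_X * inverse step_fps)"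

lemma step_fps_0 [simp]: "step_fps $ 0 = 1"
  by (simp add: step_fps_def startsby_one_power)

lemma step_fps_inverse: "step_fps * inverse step_fps = 1"
  by (rule inverse_mult_eq_1') simp

lemma tree_fps_0 [simp]: "tree_fps $ 0 = 0"
  by (simp add: tree_fps_def fps_inv_def)

lemma compose_tree_fps: "tree_fps oo (fps_X * inverse step_fps) = fps_X"
  unfolding tree_fps_def by (rule fps_inv) auto

lemma tree_fps_eq: "tree_fps = fps_X * (1 + tree_fps) ^ m"
proof -
  have "(fps_X * inverse step_fps) oo tree_fps = fps_X"
    unfolding tree_fps_def by (rule fps_inv_right) auto
  then have "tree_fps * (inverse step_fps oo tree_fps) = fps_X"
    by (simp add: fps_compose_mult_distrib)
  then have "tree_fps * ((step_fps * inverse step_fps) oo tree_fps) = fps_X * (step_fps oo tree_fps)"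
    by (simp add: fps_compose_mult_distrib mult_ac)
  then show ?thesis
    unfolding step_fps_inverse
    by (simp add: step_fps_def fps_compose_add_distrib flip: fps_compose_power)
qed

text \<open>This series collects the factorizations in which a reflection joins the second negative cycle, of
length \<open>q\<close>, to the first one. The shift by \<open>q\<close> expresses that the joined cycle is longer by
\<open>q\<close> than the one whose length is marked by the variable.\<close>
definition "merge_fps q =
  (\<Sum>k<m. (1 + tree_fps) ^ (m - 1 - k) * (fps_X * fps_shift q ((1 + tree_fps) ^ k)))"

text \<open>The next two series are auxiliary. When \<open>merge_fps\<close> is written in the variable
\<open>u = tree_fps\<close>, it satisfies a recursion in \<open>q\<close> with inhomogeneous term
\<open>remainder_fps\<close>. Its solution is a Laurent series whose negative powers of \<open>u\<close> are
cancelled by \<open>polar_fps q / u^q\<close>.\<close>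
definition "remainder_fps q =
  (\<Sum>k<m. (1 + fps_X) ^ (m - 1 - k) * fps_const (((1 + tree_fps) ^ k) $ q))"

fun polar_fps :: "nat \<Rightarrow> rat fps" where
  "polar_fps 0 = 1"
| "polar_fps (Suc q) = step_fps * polar_fps q - fps_X ^ Suc q * remainder_fps q"

lemma fps_X_shift_Suc: "fps_X * fps_shift (Suc q) g = fps_shift q g - fps_const (g $ q)"
  for g :: "rat fps"
proof (rule fps_ext)
  fix n show "(fps_X * fps_shift (Suc q) g) $ n = (fps_shift q g - fps_const (g $ q)) $ n"
    by (cases n) auto
qed

lemma merge_fps_compose_Suc:
  defines "f \<equiv> fps_X * inverse step_fps"
  shows "fps_X * (merge_fps (Suc q) oo f) = step_fps * (merge_fps q oo f) - fps_X * remainder_fps q"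
proof -
  have f0: "f $ 0 = 0" by (simp add: f_def)
  have Y: "(1 + tree_fps) oo f = 1 + fps_X"
    by (simp add: f_def fps_compose_add_distrib compose_tree_fps)
  have "fps_X * merge_fps (Suc q) = merge_fps q
     - fps_X * (\<Sum>k<m. (1 + tree_fps) ^ (m - 1 - k) * fps_const (((1 + tree_fps) ^ k) $ q))"
    unfolding merge_fps_def sum_distrib_left sum_subtractf[symmetric]
  proof (rule sum.cong[OF refl], goal_cases)
    case (1 k)
    have "fps_X * ((1 + tree_fps) ^ (m - 1 - k) * (fps_X * fps_shift (Suc q) ((1 + tree_fps) ^ k)))
       = (1 + tree_fps) ^ (m - 1 - k) * (fps_X * (fps_X * fps_shift (Suc q) ((1 + tree_fps) ^ k)))"
      by (simp add: mult_ac)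
    then show ?case by (simp only: fps_X_shift_Suc) (simp add: algebra_simps)
  qed
  then have "(fps_X * merge_fps (Suc q)) oo f = (merge_fps q
     - fps_X * (\<Sum>k<m. (1 + tree_fps) ^ (m - 1 - k) * fps_const (((1 + tree_fps) ^ k) $ q))) oo f"
    by simp
  then have "f * (merge_fps (Suc q) oo f) = (merge_fps q oo f) - f * remainder_fps q"
    by (simp add: f0 fps_compose_mult_distrib fps_compose_sub_distrib fps_compose_sum_distrib
        remainder_fps_def Y flip: fps_compose_power)
  then have "(step_fps * inverse step_fps) * fps_X * (merge_fps (Suc q) oo f)
     = step_fps * (merge_fps q oo f) - (step_fps * inverse step_fps) * fps_X * remainder_fps q"
    by (simp add: f_def algebra_simps flip: distrib_left right_diff_distrib) 
  then show ?thesis by (simp add: step_fps_inverse)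
qed

lemma fps_deriv_step_fps: "fps_deriv step_fps = of_nat m * (1 + fps_X) ^ (m - 1)"
  by (simp add: step_fps_def fps_deriv_power fps_of_nat)

text \<open>Dividing by \<open>u^q\<close>, the first summand becomes \<open>u/q\<close> times the derivative of
\<open>(\<phi>(u)/u)^q\<close>, so the coefficients of \<open>merge_fps q oo f\<close> are read off once
\<open>polar_fps q\<close> is known to have degree below \<open>q\<close>.\<close>
lemma merge_fps_compose:
  defines "f \<equiv> fps_X * inverse step_fps"
  assumes "q > 0"
  shows "fps_X ^ q * (merge_fps q oo f)
    = step_fps ^ (q - 1) * (fps_X * fps_deriv step_fps - step_fps) + polar_fps q"
  using assms(2)
proof (induction q rule: nat_induct_non_zero)
  case 1
  have f0: "f $ 0 = 0" by (simp add: f_def)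
  have "merge_fps 0 = fps_X * (of_nat m * (1 + tree_fps) ^ (m - 1))"
  proof -
    have "merge_fps 0 = (\<Sum>k<m. fps_X * (1 + tree_fps) ^ (m - 1))"
      unfolding merge_fps_def by (intro sum.cong refl) (simp add: algebra_simps flip: power_add)
    then show ?thesis by (simp add: mult_ac)
  qed
  then have "merge_fps 0 oo f = f * fps_deriv step_fps"
    by (simp add: fps_compose_mult_distrib f0 fps_deriv_step_fps fps_compose_add_distrib
        f_def compose_tree_fps flip: fps_compose_power fps_of_nat)
  then have "step_fps * (merge_fps 0 oo f) = step_fps * inverse step_fps * fps_X * fps_deriv step_fps"
    by (simp add: f_def mult_ac)
  then show ?case
    using merge_fps_compose_Suc[of 0] by (simp add: step_fps_inverse f_def)
next
  case (Suc n)
  have "fps_X ^ Suc n * (merge_fps (Suc n) oo f) = fps_X ^ n * (fps_X * (merge_fps (Suc n) oo f))"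
    by (simp add: mult_ac)
  also have "\<dots> = step_fps * (fps_X ^ n * (merge_fps n oo f)) - fps_X ^ Suc n * remainder_fps n"
    unfolding f_def merge_fps_compose_Suc by (simp add: algebra_simps)
  also have "step_fps * (fps_X ^ n * (merge_fps n oo f)) =
     (step_fps * step_fps ^ (n - 1)) * (fps_X * fps_deriv step_fps - step_fps) + step_fps * polar_fps n"
    unfolding Suc.IH by (simp only: distrib_left mult.assoc)
  also have "step_fps * step_fps ^ (n - 1) = step_fps ^ n"
    using Suc.hyps by (cases n) auto
  finally show ?case by simp
qed

text \<open>The generating function of the \<open>polar_fps q\<close> is the geometric series \<open>1 / (1 - W)\<close> with
\<open>W = tree_fps(u z) / u\<close>. The coefficient of \<open>z^j\<close> in \<open>W\<close> is a multiple of
\<open>u^(j-1)\<close>, so the coefficient of \<open>z^q\<close> in \<open>W^k\<close>, \<open>k \<ge> 1\<close>, has degree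
at most \<open>q - 1\<close>.\<close>
lemma polar_fps_nth:
  assumes "q > 0" "c \<ge> q"
  shows "polar_fps q $ c = 0"
proof -
  define Z :: "rat fps fps" where "Z = fps_X"
  define x :: "rat fps fps" where "x = fps_const fps_X"
  define U where "U = Abs_fps polar_fps"
  define W where "W = Abs_fps (\<lambda>j. if j = 0 then 0 else fps_const (tree_fps $ j) * fps_X ^ (j - 1))"
  define y where "y = fps_dilate (1 + tree_fps)"
  define P where "P = fps_const step_fps"
  define E where "E = (\<Sum>k<m. fps_const ((1 + fps_X) ^ (m - Suc k)) * y ^ k)"
  have U_rec: "U = 1 + Z * (P * U - x * E)"
  proof (rule fps_ext)
    fix n show "U $ n = (1 + Z * (P * U - x * E)) $ n"
      by (cases n) (simp_all add: U_def Z_def P_def x_def E_def y_def remainder_fps_def fps_sum_nth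
          sum_distrib_left mult_ac flip: fps_dilate_power)
  qed
  have xW: "x * W = fps_dilate tree_fps"
  proof (rule fps_ext)
    fix n show "(x * W) $ n = fps_dilate tree_fps $ n"
      by (cases n) (simp_all add: x_def W_def mult_ac)
  qed
  have y: "y = 1 + x * W" by (simp add: y_def fps_dilate_add xW)
  have "x * W = fps_dilate (fps_X * (1 + tree_fps) ^ m)"
    unfolding xW using tree_fps_eq by simp
  then have "x * W = x * (Z * y ^ m)"
    by (simp add: fps_dilate_mult fps_dilate_X fps_dilate_power x_def Z_def y_def mult_ac)
  moreover have "x \<noteq> 0" by (simp add: x_def)
  ultimately have W: "W = Z * y ^ m" by simp
  \<comment> \<open>A geometric sum, since \<open>u - tree_fps(u z) = u * (1 - W)\<close>.\<close>
  have E: "x * (1 - W) * E = P - y ^ m"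
  proof -
    have "y ^ m - fps_const (1 + fps_X) ^ m = (y - fps_const (1 + fps_X)) * E"
      unfolding E_def by (subst power_diff_sumr2) (simp add: fps_const_power)
    moreover have "y - fps_const (1 + fps_X) = - (x * (1 - W))"
      by (simp add: y x_def algebra_simps flip: fps_const_add)
    moreover have "fps_const (1 + fps_X) ^ m = P" by (simp add: P_def step_fps_def fps_const_power)
    ultimately have "y ^ m - P = - (x * (1 - W) * E)" by simp
    then show ?thesis by (metis minus_diff_eq minus_minus)
  qed
  have "(1 - W) * U * (1 - Z * P) = (1 - W) * (U - Z * (P * U))" by (simp add: algebra_simps)
  also have "U - Z * (P * U) = 1 - Z * (x * E)"
    by (subst (1) U_rec) (simp add: algebra_simps)
  also have "(1 - W) * (1 - Z * (x * E)) = 1 - W - Z * (x * (1 - W) * E)" by (simp add: algebra_simps)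
  also have "\<dots> = 1 * (1 - Z * P)" by (simp only: E) (simp add: W algebra_simps)
  finally have "((1 - W) * U) * (1 - Z * P) = 1 * (1 - Z * P)" .
  moreover have "1 - Z * P \<noteq> 0"
  proof
    assume "1 - Z * P = 0"
    then have "(1 - Z * P) $ 0 = 0" by simp
    then show False by (simp add: Z_def)
  qed
  ultimately have "(1 - W) * U = 1" by (metis mult_right_cancel)
  then have U: "U = 1 + W * U" by (simp add: algebra_simps)
  show ?thesis using assms
  proof (induction q arbitrary: c rule: less_induct)
    case (less q)
    have "polar_fps q = U $ q" by (simp add: U_def)
    also have "\<dots> = (1 + W * U) $ q" using U by simp
    also have "\<dots> = (\<Sum>i=0..q. W $ i * polar_fps (q - i))"
      using less.prems by (simp add: fps_mult_nth U_def)
    finally have "polar_fps q $ c = (\<Sum>i=0..q. (W $ i * polar_fps (q - i)) $ c)"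
      by (simp add: fps_sum_nth)
    also have "\<dots> = (\<Sum>i=0..q. 0)"
    proof (rule sum.cong[OF refl])
      fix i assume i: "i \<in> {0..q}"
      consider "i = 0" | "i = q" "i > 0" | "i > 0" "i < q" using i by fastforce
      then show "(W $ i * polar_fps (q - i)) $ c = 0"
      proof cases
        case 1 then show ?thesis by (simp add: W_def)
      next
        case 2 then show ?thesis using less.prems by (simp add: W_def mult.assoc)
      next
        case 3
        then have "polar_fps (q - i) $ (c - (i - 1)) = 0"
          using less.prems by (intro less.IH) auto
        then show ?thesis using 3 by (simp add: W_def mult.assoc fps_X_power_mult_nth)
      qed
    qed
    finally show ?case by simp
  qed
qed

lemma step_fps_power_nth: "(step_fps ^ n) $ k = of_nat ((m * n) choose k)"
proof -
  have "step_fps ^ n = (1 + fps_X) ^ (m * n)" by (simp add: step_fps_def power_mult)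
  then show ?thesis by (simp add: fps_binomial_of_nat[symmetric] binomial_gbinomial)
qed

text \<open>This is where the weight \<open>c\<close> of the theorem comes from: \<open>u d/du\<close> multiplies the coefficient
of \<open>u^c\<close> in \<open>(\<phi>(u)/u)^q\<close> by \<open>c\<close>.\<close>
lemma merge_fps_compose_nth:
  assumes "q > 0"
  shows "of_nat q * (merge_fps q oo (fps_X * inverse step_fps)) $ c
    = of_nat c * of_nat ((m * q) choose (q + c))"
proof -
  define h where "h = merge_fps q oo (fps_X * inverse step_fps)"
  have "of_nat q * h $ c = (of_nat q * (fps_X ^ q * h)) $ (q + c)"
    by (simp add: fps_X_power_mult_nth flip: fps_of_nat)
  also have "of_nat q * (fps_X ^ q * h) =
     of_nat q * (step_fps ^ (q - 1) * (fps_X * fps_deriv step_fps - step_fps)) + of_nat q * polar_fps q"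
    unfolding h_def merge_fps_compose[OF assms] by (simp add: algebra_simps)
  also have "of_nat q * (step_fps ^ (q - 1) * (fps_X * fps_deriv step_fps - step_fps))
     = fps_X * fps_deriv (step_fps ^ q) - of_nat q * step_fps ^ q"
  proof -
    have "fps_deriv (step_fps ^ q) = of_nat q * step_fps ^ (q - 1) * fps_deriv step_fps"
      by (simp add: fps_deriv_power fps_of_nat mult_ac)
    moreover have "step_fps ^ q = step_fps ^ (q - 1) * step_fps"
      using assms by (cases q) auto
    ultimately show ?thesis by (simp add: algebra_simps)
  qed
  also have "(fps_X * fps_deriv (step_fps ^ q) - of_nat q * step_fps ^ q + of_nat q * polar_fps q) $ (q + c)
     = of_nat c * (step_fps ^ q) $ (q + c)"
    using assms polar_fps_nth[of q "q + c"]
    by (simp add: algebra_simps flip: fps_of_nat)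
  finally show ?thesis by (simp add: h_def step_fps_power_nth)
qed

definition "slope_fps = of_nat m * (1 + tree_fps) ^ (m - 1)"

lemma slope_fps_eq: "slope_fps = fps_deriv step_fps oo tree_fps"
  by (simp add: slope_fps_def fps_deriv_step_fps fps_compose_mult_distrib
      fps_compose_add_distrib fps_compose_power[symmetric] flip: fps_of_nat)

definition "disc_fps = inverse (1 - fps_X * slope_fps) - 1"

lemma disc_fps_eq: "disc_fps = fps_X * slope_fps * (1 + disc_fps)"
proof -
  have "inverse (1 - fps_X * slope_fps) * (1 - fps_X * slope_fps) = 1"
    by (rule inverse_mult_eq_1) simp
  then show ?thesis by (simp add: disc_fps_def algebra_simps)
qed

definition "annular_fps q = (fps_X * slope_fps * fps_const (disc_fps $ q)
   + of_nat (2 * q) * merge_fps q) * inverse (1 - fps_X * slope_fps)"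

lemma annular_fps_mult: "annular_fps q * (1 - fps_X * slope_fps)
   = fps_X * slope_fps * fps_const (disc_fps $ q) + of_nat (2 * q) * merge_fps q"
proof -
  have "inverse (1 - fps_X * slope_fps) * (1 - fps_X * slope_fps) = 1"
    by (rule inverse_mult_eq_1) simp
  then show ?thesis unfolding annular_fps_def mult.assoc by simp
qed

lemma annular_fps_eq: "annular_fps q
   = fps_X * slope_fps * (annular_fps q + fps_const (disc_fps $ q)) + of_nat (2 * q) * merge_fps q"
  using annular_fps_mult[of q] by (simp add: algebra_simps)

lemma disc_fps_nth: "n > 0 \<Longrightarrow> disc_fps $ n = of_nat ((m * n) choose n)"
proof -
  assume n: "n > 0"
  have "inverse (1 - fps_X * slope_fps) * (1 - fps_X * slope_fps) = 1"
    by (rule inverse_mult_eq_1) simp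
  then have "(1 + disc_fps) * (1 - fps_X * (fps_deriv step_fps oo tree_fps)) = 1 oo tree_fps"
    by (simp add: disc_fps_def slope_fps_eq)
  then have "(1 + disc_fps) $ n = (1 * step_fps ^ n) $ n"
    unfolding tree_fps_def by (intro fps_Lagrange) auto
  then show ?thesis using n by (simp add: step_fps_power_nth)
qed

lemma annular_fps_nth:
  assumes "p > 0" "q > 0"
  shows "annular_fps q $ p = of_nat ((m * p) choose p) * of_nat ((m * q) choose q)
    + (\<Sum>c=1..p. 2 * of_nat c * of_nat ((m * p) choose (p - c)) * of_nat ((m * q) choose (q + c)))"
proof -
  define f where "f = fps_X * inverse step_fps"
  define D where "D = merge_fps q oo f"
  have f0: "f $ 0 = 0" and f1: "f $ 1 \<noteq> 0" by (auto simp: f_def)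
  have inv: "f oo tree_fps = fps_X"
    unfolding tree_fps_def f_def by (rule fps_inv_right) auto
  have D: "D oo tree_fps = merge_fps q"
    unfolding D_def by (subst fps_compose_assoc[symmetric]) (auto simp: f0 inv)
  define h where "h = f * fps_deriv step_fps * fps_const (disc_fps $ q) + of_nat (2 * q) * D"
  have "h oo tree_fps = fps_X * slope_fps * fps_const (disc_fps $ q) + of_nat (2 * q) * merge_fps q"
    by (simp add: h_def fps_compose_add_distrib fps_compose_mult_distrib inv D slope_fps_eq
        flip: fps_of_nat)
  then have "annular_fps q * (1 - fps_X * (fps_deriv step_fps oo tree_fps)) = h oo tree_fps"
    using annular_fps_mult[of q] by (simp add: slope_fps_eq)
  then have "annular_fps q $ p = (h * step_fps ^ p) $ p"
    unfolding tree_fps_def by (intro fps_Lagrange) auto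
  also have "\<dots> = disc_fps $ q * (f * fps_deriv step_fps * step_fps ^ p) $ p
      + 2 * (of_nat q * (D * step_fps ^ p) $ p)"
  proof -
    have "h * step_fps ^ p = fps_const (disc_fps $ q) * (f * fps_deriv step_fps * step_fps ^ p)
        + fps_const (2 * of_nat q) * (D * step_fps ^ p)"
      by (simp add: h_def fps_of_nat[symmetric] algebra_simps)
    then show ?thesis by (simp add: mult.assoc)
  qed
  also have "(f * fps_deriv step_fps * step_fps ^ p) $ p = of_nat ((m * p) choose p)"
  proof -
    have p: "step_fps ^ p = step_fps ^ (p - 1) * step_fps" using assms by (cases p) auto
    have "of_nat p * (f * fps_deriv step_fps * step_fps ^ p)
       = (step_fps * inverse step_fps) * (fps_X * (of_nat p * step_fps ^ (p - 1) * fps_deriv step_fps))"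
      unfolding p f_def by (simp add: mult_ac)
    also have "of_nat p * step_fps ^ (p - 1) * fps_deriv step_fps = fps_deriv (step_fps ^ p)"
      by (simp add: fps_deriv_power fps_of_nat mult_ac)
    finally have "(fps_const (of_nat p) * (f * fps_deriv step_fps * step_fps ^ p)) $ p
       = (fps_X * fps_deriv (step_fps ^ p)) $ p"
      by (simp add: step_fps_inverse fps_of_nat)
    then have "of_nat p * (f * fps_deriv step_fps * step_fps ^ p) $ p = of_nat p * (step_fps ^ p) $ p"
      using assms by simp
    then show ?thesis using assms by (simp add: step_fps_power_nth)
  qed
  also have "of_nat q * (D * step_fps ^ p) $ p
      = (\<Sum>c=0..p. (of_nat q * D $ c) * of_nat ((m * p) choose (p - c)))"
    by (simp add: fps_mult_nth sum_distrib_left mult.assoc step_fps_power_nth)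
  also have "\<dots> = (\<Sum>c=0..p. of_nat c * of_nat ((m * q) choose (q + c)) * of_nat ((m * p) choose (p - c)))"
    by (simp add: D_def f_def merge_fps_compose_nth[OF assms(2)])
  also have "\<dots> = (\<Sum>c=1..p. of_nat c * of_nat ((m * q) choose (q + c)) * of_nat ((m * p) choose (p - c)))"
    by (rule sum.mono_neutral_right) (auto simp: not_less_eq_eq)
  finally show ?thesis
    using assms by (simp add: disc_fps_nth sum_distrib_left mult_ac)
qed

end

section \<open>Signed permutations acting on odd vectors over three elements\<close>

text \<open>Subspaces are compared by counting elements, and this is the only counting principle that is used.\<close>
lemma card_le_fibres:
  assumes "finite A" "finite B" "h ` A \<subseteq> B" "\<And>b. b \<in> B \<Longrightarrow> card {a \<in> A. h a = b} \<le> k"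
  shows "card A \<le> k * card B"
proof -
  have "A = (\<Union>b\<in>B. {a \<in> A. h a = b})" using assms(3) by auto
  then have "card A \<le> (\<Sum>b\<in>B. card {a \<in> A. h a = b})"
    using card_UN_le[OF assms(2), of "\<lambda>b. {a \<in> A. h a = b}"] by simp
  also have "\<dots> \<le> k * card B" using sum_bounded_above[of B _ k] assms(4) by (simp add: mult.commute)
  finally show ?thesis .
qed

text \<open>The scalars are the type \<^typ>\<open>3\<close>, the integers modulo 3. Any field in which \<open>2 \<noteq> 0\<close> would
do for the geometry of signed permutations; a finite one makes the dimension of a subspace visible in
its cardinality.\<close>
lemma trit_triple: "x + x + x = (0::3)"
proof -
  have "x + x + x = (1 + 1 + 1) * x" by (simp only: distrib_right mult_1)
  also have "(1 + 1 + 1 :: 3) = 3" by (simp only: one_add_one numeral_plus_one add_num_simps)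
  also have "(3::3) = 0" by simp
  finally show ?thesis by (simp only: mult_zero_left)
qed

lemma trit_double_eq_0: "x + x = 0 \<longleftrightarrow> x = (0::3)"
proof
  assume "x + x = 0"
  with trit_triple[of x] have "0 + x = 0" by (simp only:)
  then show "x = 0" by (simp only: add_0)
qed (simp only: add_0)

lemma trit_one: "(1::3) \<noteq> - 1" "(1::3) \<noteq> 0"
proof -
  show "(1::3) \<noteq> 0" by (rule one_neq_zero)
  show "(1::3) \<noteq> - 1"
  proof
    assume "(1::3) = - 1"
    then have "(1::3) + 1 = - 1 + 1" by (rule arg_cong)
    then have "(1::3) + 1 = 0" by (simp only: left_minus)
    then show False unfolding trit_double_eq_0 using one_neq_zero by (rule notE[rotated])
  qed
qed

text \<open>The reflection that exchanges \<open>i\<close> with \<open>j\<close> and \<open>- i\<close> with \<open>- j\<close>. The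
clauses are ordered so that \<open>j = - i\<close> gives the sign change \<open>(i, - i)\<close> and
\<open>j = i\<close> the identity; thus all generators have the same form.\<close>
definition refl_B :: "int \<Rightarrow> int \<Rightarrow> int \<Rightarrow> int" where
  "refl_B i j x = (if x = i then j else if x = j then i
     else if x = - i then - j else if x = - j then - i else x)"

locale hyperoctahedral_group =
  fixes N :: nat
begin

abbreviation (input) "S \<equiv> signed_set N"
abbreviation (input) "G \<equiv> hyperoctahedral N"
abbreviation (input) "len \<equiv> length_B N"

lemma signed_set_iff: "i \<in> S \<longleftrightarrow> i \<noteq> 0 \<and> \<bar>i\<bar> \<le> int N"
  by (auto simp: signed_set_def)

lemma finite_signed_set [simp]: "finite S"
  by (simp add: signed_set_def)

lemma uminus_signed_set [simp]: "- i \<in> S \<longleftrightarrow> i \<in> S"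
  by (simp add: signed_set_iff)

lemma hyperI: "w permutes S \<Longrightarrow> (\<And>i. w (- i) = - w i) \<Longrightarrow> w \<in> G"
  by (simp add: hyperoctahedral_def)

lemma hyper_permutes: "w \<in> G \<Longrightarrow> w permutes S"
  by (simp add: hyperoctahedral_def)

lemma hyper_bij: "w \<in> G \<Longrightarrow> bij w"
  by (rule permutes_bij[OF hyper_permutes])

lemma hyper_inj: "w \<in> G \<Longrightarrow> w i = w j \<longleftrightarrow> i = j"
  by (rule inj_eq[OF bij_is_inj[OF hyper_bij]])

lemma hyper_mem [simp]: "w \<in> G \<Longrightarrow> w i \<in> S \<longleftrightarrow> i \<in> S"
  by (rule permutes_in_image[OF hyper_permutes])

lemma hyper_outside: "w \<in> G \<Longrightarrow> i \<notin> S \<Longrightarrow> w i = i"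
  by (rule permutes_not_in[OF hyper_permutes])

lemma hyper_odd: assumes "w \<in> G" shows "w (- i) = - w i"
proof (cases "i \<in> S")
  case True
  then have "i \<in> {1..int N} \<or> - i \<in> {1..int N}" by (auto simp: signed_set_iff)
  then consider "i \<in> {1..int N}" | "- i \<in> {1..int N}" by blast
  then show ?thesis
  proof cases
    case 1 then show ?thesis using assms by (auto simp: hyperoctahedral_def)
  next
    case 2 
    moreover have "\<forall>k\<in>{1..int N}. w (- k) = - w k" using assms by (simp add: hyperoctahedral_def)
    ultimately have "w (- (- i)) = - w (- i)" by (rule bspec[rotated])
    then show ?thesis by simp
  qed
next
  case False
  then show ?thesis using hyper_outside[OF assms, of i] hyper_outside[OF assms, of "- i"] by simp
qed

lemma hyper_id [simp]: "id \<in> G"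
  by (rule hyperI) (auto simp: permutes_id)

lemma hyper_comp [simp]: "u \<in> G \<Longrightarrow> v \<in> G \<Longrightarrow> u \<circ> v \<in> G"
  by (rule hyperI) (auto simp: hyper_odd hyper_permutes permutes_compose)

lemma inv_apply [simp]: "w \<in> G \<Longrightarrow> inv w (w i) = i" "w \<in> G \<Longrightarrow> w (inv w i) = i"
  using hyper_bij by (simp_all add: bij_is_inj bij_is_surj surj_f_inv_f)

lemma inv_comp [simp]: "w \<in> G \<Longrightarrow> inv w \<circ> w = id" "w \<in> G \<Longrightarrow> w \<circ> inv w = id"
  by (simp_all add: fun_eq_iff)

lemma hyper_inv [simp]: assumes "w \<in> G" shows "inv w \<in> G"
proof (rule hyperI)
  show "inv w permutes S" using hyper_permutes[OF assms] by (rule permutes_inv)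
  show "inv w (- i) = - inv w i" for i
    using assms by (metis hyper_inj hyper_odd inv_apply(2))
qed

lemma inv_inv [simp]: "w \<in> G \<Longrightarrow> inv (inv w) = w"
  using hyper_bij by (simp add: inv_inv_eq)

lemma inv_comp_distrib: "u \<in> G \<Longrightarrow> v \<in> G \<Longrightarrow> inv (u \<circ> v) = inv v \<circ> inv u"
  using hyper_bij by (simp add: o_inv_distrib)

lemma swap_invol: "i \<noteq> 0 \<Longrightarrow> j \<noteq> 0 \<Longrightarrow> refl_B i j (refl_B i j x) = x"
  by (auto simp: refl_B_def)

lemma swap_odd: "i \<noteq> 0 \<Longrightarrow> j \<noteq> 0 \<Longrightarrow> refl_B i j (- x) = - refl_B i j x"
  by (auto simp: refl_B_def)

lemma swap_same [simp]: "refl_B i i = id"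
  by (auto simp: refl_B_def fun_eq_iff)

lemma swap_hyper [simp]: assumes "i \<in> S" "j \<in> S" shows "refl_B i j \<in> G"
proof (rule hyperI)
  have ij: "i \<noteq> 0" "j \<noteq> 0" using assms by (auto simp: signed_set_iff)
  show "refl_B i j (- x) = - refl_B i j x" for x using ij by (rule swap_odd)
  show "refl_B i j permutes S" unfolding permutes_def
  proof (intro conjI allI impI)
    fix x assume "x \<notin> S"
    then have "x \<noteq> i" "x \<noteq> j" "x \<noteq> - i" "x \<noteq> - j" using assms by (auto simp: signed_set_iff)
    then show "refl_B i j x = x" by (simp add: refl_B_def)
  next
    fix y show "\<exists>!x. refl_B i j x = y" using swap_invol[OF ij] by metis
  qed
qed

lemma swap_comp_self: "i \<in> S \<Longrightarrow> j \<in> S \<Longrightarrow> refl_B i j \<circ> refl_B i j = id"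
  by (auto simp: fun_eq_iff swap_invol signed_set_iff)

lemma swap_inv: "i \<in> S \<Longrightarrow> j \<in> S \<Longrightarrow> inv (refl_B i j) = refl_B i j"
  using swap_comp_self by (intro inv_unique_comp) auto

lemma swap_uminus: "i \<noteq> 0 \<Longrightarrow> j \<noteq> 0 \<Longrightarrow> refl_B (- i) (- j) = refl_B i j"
  by (auto simp: refl_B_def fun_eq_iff)

lemma swap_conj: assumes "w \<in> G" "i \<noteq> 0" "j \<noteq> 0"
  shows "w \<circ> refl_B i j = refl_B (w i) (w j) \<circ> w"
  by (auto simp: fun_eq_iff refl_B_def hyper_inj[OF assms(1)] simp flip: hyper_odd[OF assms(1)])

lemma swap_eq_transpose:
  "i > 0 \<Longrightarrow> j > 0 \<Longrightarrow> refl_B i j = transpose i j \<circ> transpose (- i) (- j)"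
  "i > 0 \<Longrightarrow> j > 0 \<Longrightarrow> i \<noteq> j \<Longrightarrow> refl_B i (- j) = transpose i (- j) \<circ> transpose (- i) j"
  "i > 0 \<Longrightarrow> refl_B i (- i) = transpose i (- i)"
  by (rule ext, auto simp: refl_B_def transpose_def)+

lemma generators_B_eq: "generators_B N = {refl_B i j | i j. i \<in> S \<and> j \<in> S \<and> i \<noteq> j}" (is "?L = ?R")
proof
  have swapI: "refl_B i j \<in> ?R" if "i \<in> S" "j \<in> S" "i \<noteq> j" for i j
    using that by blast
  show "?L \<subseteq> ?R" unfolding generators_B_def
  proof (intro Un_least subsetI, goal_cases)
    case (1 t)
    then obtain i j where ij: "i \<in> {1..int N}" "j \<in> {1..int N}" "i \<noteq> j"
      and t: "t = transpose i j \<circ> transpose (- i) (- j)" by blast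
    have "t = refl_B i j" using ij unfolding t by (subst swap_eq_transpose) auto
    then show ?case using ij by (simp only:) (rule swapI, auto simp: signed_set_iff)
  next
    case (2 t)
    then obtain i j where ij: "i \<in> {1..int N}" "j \<in> {1..int N}" "i \<noteq> j"
      and t: "t = transpose i (- j) \<circ> transpose (- i) j" by blast
    have "t = refl_B i (- j)" using ij unfolding t by (subst swap_eq_transpose) auto
    then show ?case using ij by (simp only:) (rule swapI, auto simp: signed_set_iff)
  next
    case (3 t)
    then obtain i where i: "i \<in> {1..int N}" and t: "t = transpose i (- i)" by blast
    have "t = refl_B i (- i)" using i unfolding t by (subst swap_eq_transpose) auto
    then show ?case using i by (simp only:) (rule swapI, auto simp: signed_set_iff)
  qed
  have pos: "refl_B i j \<in> ?L" if "i > 0" "i \<in> S" "j \<in> S" "i \<noteq> j" for i j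
  proof -
    have i: "i \<in> {1..int N}" using that by (auto simp: signed_set_iff)
    have "j > 0 \<or> j < 0 \<and> j \<noteq> - i \<or> j = - i" using that by (auto simp: signed_set_iff)
    then consider "j > 0" | "j < 0" "j \<noteq> - i" | "j = - i" by blast
    then show ?thesis
    proof cases
      case 1
      then have "j \<in> {1..int N}" using that by (auto simp: signed_set_iff)
      then show ?thesis using i 1 that(1,4) swap_eq_transpose(1) unfolding generators_B_def by blast
    next
      case 2
      then have j: "- j \<in> {1..int N}" using that by (auto simp: signed_set_iff)
      have "refl_B i (- (- j)) = transpose i (- (- j)) \<circ> transpose (- i) (- j)"
        using 2 that by (intro swap_eq_transpose(2)) auto
      then have "refl_B i j = transpose i (- (- j)) \<circ> transpose (- i) (- j)" by simp
      moreover have "i \<noteq> - j" using 2 by auto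
      ultimately show ?thesis using i j unfolding generators_B_def by blast
    next
      case 3
      then have "refl_B i j = transpose i (- i)" using swap_eq_transpose(3) that by simp
      then show ?thesis using i unfolding generators_B_def by blast
    qed
  qed
  show "?R \<subseteq> ?L"
  proof
    fix t assume "t \<in> ?R"
    then obtain i j where ij: "i \<in> S" "j \<in> S" "i \<noteq> j" "t = refl_B i j" by blast
    show "t \<in> ?L"
    proof (cases "i > 0")
      case True then show ?thesis using pos ij by simp
    next
      case False
      then have "refl_B (- i) (- j) \<in> ?L" using ij by (intro pos) (auto simp: signed_set_iff)
      then show ?thesis using ij by (simp add: swap_uminus signed_set_iff)
    qed
  qed
qed

text \<open>Odd functions on the signed set form a space of dimension \<open>N\<close> on which the hyperoctahedral group acts
by composition. A vector is fixed if it is constant on orbits; it then vanishes on orbits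
that are invariant under inversion, so the dimension of \<open>Fix w\<close> is the number of
pairs of orbits that are not.\<close>
definition Vec :: "(int \<Rightarrow> 3) set" where
  "Vec = {x. (\<forall>i. x (- i) = - x i) \<and> (\<forall>i. i \<notin> S \<longrightarrow> x i = 0)}"

definition Fix :: "(int \<Rightarrow> int) \<Rightarrow> (int \<Rightarrow> 3) set" where
  "Fix w = {x \<in> Vec. x \<circ> w = x}"

lemma finite_Vec [simp]: "finite Vec"
proof -
  have "finite {x :: int \<Rightarrow> 3. \<forall>i. (i \<in> S \<longrightarrow> x i \<in> UNIV) \<and> (i \<notin> S \<longrightarrow> x i = 0)}"
    by (rule finite_set_of_finite_funs) auto
  then show ?thesis by (rule rev_finite_subset) (auto simp: Vec_def)
qed

lemma Vec_diff: "x \<in> Vec \<Longrightarrow> y \<in> Vec \<Longrightarrow> x - y \<in> Vec"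
  by (auto simp: Vec_def)

lemma Vec_add: "x \<in> Vec \<Longrightarrow> y \<in> Vec \<Longrightarrow> x + y \<in> Vec"
  by (auto simp: Vec_def)

lemma Vec_0: "0 \<in> Vec"
  by (auto simp: Vec_def)

lemma Vec_comp: "x \<in> Vec \<Longrightarrow> w \<in> G \<Longrightarrow> x \<circ> w \<in> Vec"
  by (auto simp: Vec_def hyper_odd)

lemma diff_comp: "(x - y) \<circ> w = (x \<circ> w) - (y \<circ> w)" for x y :: "int \<Rightarrow> 3"
  by (auto simp: fun_eq_iff)

lemma add_comp: "(x + y) \<circ> w = (x \<circ> w) + (y \<circ> w)" for x y :: "int \<Rightarrow> 3"
  by (auto simp: fun_eq_iff)

lemma Fix_subset: "Fix w \<subseteq> Vec" by (auto simp: Fix_def)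

lemma finite_Fix [simp]: "finite (Fix w)"
  using Fix_subset finite_Vec by (rule finite_subset)

lemma Fix_diff: "x \<in> Fix w \<Longrightarrow> y \<in> Fix w \<Longrightarrow> x - y \<in> Fix w"
  by (auto simp: Fix_def Vec_diff diff_comp)

lemma Fix_add: "x \<in> Fix w \<Longrightarrow> y \<in> Fix w \<Longrightarrow> x + y \<in> Fix w"
  by (auto simp: Fix_def Vec_add add_comp)

lemma Fix_0: "0 \<in> Fix w"
  by (auto simp: Fix_def Vec_0)

lemma Fix_id [simp]: "Fix id = Vec"
  by (auto simp: Fix_def)

lemma Fix_inv: assumes "w \<in> G" shows "Fix (inv w) = Fix w"
proof -
  have "x \<circ> inv w = x \<longleftrightarrow> x \<circ> w = x" for x :: "int \<Rightarrow> 3"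
    using assms by (metis comp_assoc comp_id inv_comp)
  then show ?thesis by (simp add: Fix_def)
qed

lemma card_Fix_pos: "card (Fix w) > 0"
  using Fix_0 by (metis card_gt_0_iff empty_iff finite_Fix)

lemma Fix_swap: "i \<in> S \<Longrightarrow> j \<in> S \<Longrightarrow> Fix (refl_B i j) = {x \<in> Vec. x i = x j}"
proof -
  assume ij: "i \<in> S" "j \<in> S"
  have "x \<circ> refl_B i j = x \<longleftrightarrow> x i = x j" if x: "x \<in> Vec" for x
  proof
    assume "x \<circ> refl_B i j = x"
    then have "x (refl_B i j i) = x i" by (metis comp_apply)
    then show "x i = x j" by (simp add: refl_B_def)
  next
    assume "x i = x j"
    moreover from this have "x (- i) = x (- j)" using x by (simp add: Vec_def)
    ultimately show "x \<circ> refl_B i j = x" by (simp add: fun_eq_iff refl_B_def)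
  qed
  then show ?thesis by (auto simp: Fix_def)
qed

text \<open>The indicator of \<open>B\<close> minus the indicator of \<open>- B\<close>, meant for \<open>B\<close> disjoint from \<open>- B\<close>.\<close>
definition evec :: "int set \<Rightarrow> int \<Rightarrow> 3" where
  "evec B k = (if k \<in> B then 1 else if - k \<in> B then - 1 else 0)"

lemma evec_Vec: "B \<subseteq> S \<Longrightarrow> B \<inter> uminus ` B = {} \<Longrightarrow> evec B \<in> Vec"
  unfolding Vec_def evec_def
proof (safe, goal_cases)
  case (1 i)
  have "\<not> (i \<in> B \<and> - i \<in> B)" using 1(2) by (force simp: image_iff)
  then show ?case by auto
next
  case (2 i)
  then have "i \<notin> B" "- i \<notin> B" by (auto simp: signed_set_iff)
  then show ?case by simp
qed

lemma evec_Fix: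
  assumes "w \<in> G" "B \<subseteq> S" "B \<inter> uminus ` B = {}" "w ` B \<subseteq> B"
  shows "evec B \<in> Fix w"
proof -
  have "finite B" using assms(2) finite_signed_set by (rule finite_subset)
  moreover have inj: "inj_on w B" using hyper_bij[OF assms(1)] by (meson bij_is_inj inj_on_subset subset_UNIV)
  ultimately have "w ` B = B" using assms(4) by (simp add: endo_inj_surj)
  then have "w k \<in> B \<longleftrightarrow> k \<in> B" for k
    using hyper_inj[OF assms(1)] by (metis image_iff)
  then have "evec B \<circ> w = evec B"
    by (auto simp: fun_eq_iff evec_def simp flip: hyper_odd[OF assms(1)])
  then show ?thesis using evec_Vec[OF assms(2,3)] by (simp add: Fix_def)
qed

lemma card_kernel_le:
  fixes U :: "(int \<Rightarrow> 3) set" and h :: "(int \<Rightarrow> 3) \<Rightarrow> 3"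
  assumes "finite U" "\<And>x y. x \<in> U \<Longrightarrow> y \<in> U \<Longrightarrow> x - y \<in> U" "\<And>x y. h (x - y) = h x - h y"
  shows "card U \<le> 3 * card {x \<in> U. h x = 0}"
proof -
  have "card U \<le> card {x \<in> U. h x = 0} * card (UNIV :: 3 set)"
  proof (rule card_le_fibres[of _ _ h])
    fix c :: 3
    show "card {x \<in> U. h x = c} \<le> card {x \<in> U. h x = 0}"
    proof (cases "{x \<in> U. h x = c} = {}")
      case True then show ?thesis by (metis card.empty le0)
    next
      case False
      then obtain x0 where x0: "x0 \<in> U" "h x0 = c" by blast
      show ?thesis
        by (rule card_inj_on_le[of "\<lambda>x. x - x0"]) (use assms x0 in \<open>auto simp: inj_on_def\<close>)
    qed
  qed (use assms in auto)
  then show ?thesis by simp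
qed

text \<open>The cardinality form of \<open>dim (U \<inter> W) \<ge> dim U + dim W - dim V\<close>.\<close>
lemma card_inter_ge:
  assumes "U \<subseteq> Vec" "W \<subseteq> Vec" "\<And>x y. x \<in> U \<Longrightarrow> y \<in> U \<Longrightarrow> x - y \<in> U" "\<And>x y. x \<in> W \<Longrightarrow> y \<in> W \<Longrightarrow> x - y \<in> W"
  shows "card U * card W \<le> card (U \<inter> W) * card Vec"
proof -
  have fin: "finite U" "finite W" using assms(1,2) finite_subset by (auto intro: finite_subset)
  have "card (U \<times> W) \<le> card (U \<inter> W) * card Vec"
  proof (rule card_le_fibres[of _ _ "\<lambda>(u, w). u - w"])
    fix v
    let ?F = "{a \<in> U \<times> W. (\<lambda>(u, w). u - w) a = v}"
    show "card ?F \<le> card (U \<inter> W)"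
    proof (cases "?F = {}")
      case True then show ?thesis by (metis card.empty le0)
    next
      case False
      then obtain u0 w0 where 0: "u0 \<in> U" "w0 \<in> W" "u0 - w0 = v" by auto
      show ?thesis
      proof (rule card_inj_on_le[of "\<lambda>(u, w). u - u0"])
        show "inj_on (\<lambda>(u, w). u - u0) ?F" by (auto simp: inj_on_def)
        show "(\<lambda>(u, w). u - u0) ` ?F \<subseteq> U \<inter> W"
        proof safe
          fix u w assume a: "u \<in> U" "w \<in> W" "v = u - w"
          show "u - u0 \<in> U" using a 0 assms by blast
          have "u - u0 = w - w0" using a(3) 0(3) by (simp add: algebra_simps)
          then show "u - u0 \<in> W" using a 0 assms by auto
        qed
        show "finite (U \<inter> W)" using fin by blast
      qed
    qed
  qed (use assms fin in \<open>auto intro!: Vec_diff\<close>)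
  then show ?thesis by (simp add: card_cartesian_product)
qed

text \<open>A reflection fixes a hyperplane, so multiplication by it loses at most one dimension of fixed vectors.\<close>
lemma card_Fix_swap_le:
  assumes "w \<in> G" "i \<in> S" "j \<in> S"
  shows "card (Fix w) \<le> 3 * card (Fix (refl_B i j \<circ> w))"
proof -
  have "card (Fix w) \<le> 3 * card {x \<in> Fix w. x i - x j = 0}"
    by (rule card_kernel_le) (auto simp: Fix_diff)
  also have "{x \<in> Fix w. x i - x j = 0} \<subseteq> Fix (refl_B i j \<circ> w)"
  proof
    fix x assume "x \<in> {x \<in> Fix w. x i - x j = 0}"
    then have "x \<in> Fix w" "x \<in> Fix (refl_B i j)"
      using assms Fix_subset[of w] by (auto simp: Fix_swap)
    then show "x \<in> Fix (refl_B i j \<circ> w)" by (auto simp: Fix_def simp flip: comp_assoc)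
  qed
  then have "card {x \<in> Fix w. x i - x j = 0} \<le> card (Fix (refl_B i j \<circ> w))"
    by (intro card_mono) auto
  finally show ?thesis by simp
qed

lemma card_Fix_step:
  assumes "Fix w \<subseteq> Fix v" "x \<in> Fix v" "x \<notin> Fix w"
  shows "3 * card (Fix w) \<le> card (Fix v)"
proof -
  have two: "x + x \<notin> Fix w"
  proof
    assume "x + x \<in> Fix w"
    then have "0 - (x + x) \<in> Fix w" using Fix_0 Fix_diff by blast
    moreover have "0 - (x + x) = x"
    proof
      fix i
      have "x i + x i + x i = 0" by (rule trit_triple)
      then show "(0 - (x + x)) i = x i" by (simp add: algebra_simps)
    qed
    ultimately have "x \<in> Fix w" by (simp only:)
    then show False using assms by simp
  qed
  define T where "T c = (\<lambda>y. y + c) ` Fix w" for c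
  have c: "card (T c) = card (Fix w)" for c unfolding T_def by (rule card_image) (auto simp: inj_on_def)
  have d: "T c \<inter> T c' = {}" if "c - c' \<notin> Fix w" for c c'
  proof (rule ccontr)
    assume "T c \<inter> T c' \<noteq> {}"
    then obtain y z where yz: "y \<in> Fix w" "z \<in> Fix w" "y + c = z + c'" by (auto simp: T_def)
    then have "c - c' = z - y" by (simp add: algebra_simps)
    then show False using yz that Fix_diff by metis
  qed
  have neg: "- x \<notin> Fix w" using Fix_diff[OF Fix_0, of "- x"] assms(3) by auto
  have neg2: "- (x + x) \<notin> Fix w" using Fix_diff[OF Fix_0, of "- (x + x)"] two by auto
  have "card (T 0 \<union> T x \<union> T (x + x)) = card (T 0 \<union> T x) + card (T (x + x))"
    using d[of 0 "x + x"] d[of x "x + x"] neg neg2 by (intro card_Un_disjoint) (auto simp: T_def)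
  also have "card (T 0 \<union> T x) = card (T 0) + card (T x)"
    using d[of 0 x] neg by (intro card_Un_disjoint) (auto simp: T_def)
  finally have "3 * card (Fix w) = card (T 0 \<union> T x \<union> T (x + x))" unfolding c by linarith
  also have "\<dots> \<le> card (Fix v)"
  proof (rule card_mono)
    have "T c \<subseteq> Fix v" if "c \<in> Fix v" for c
      using that assms(1) Fix_add by (auto simp: T_def)
    then show "T 0 \<union> T x \<union> T (x + x) \<subseteq> Fix v"
      using assms(2) Fix_0 Fix_add by (meson Un_least)
  qed simp
  finally show ?thesis .
qed

text \<open>The step of Carter's lemma: the reflection that sends \<open>w i\<close> back to \<open>i\<close> keeps every fixed vector
of \<open>w\<close>, because such a vector takes the same value at \<open>i\<close> and at \<open>w i\<close>, and it
creates the new fixed vector \<open>evec {i}\<close>.\<close>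
lemma Fix_carter:
  assumes w: "w \<in> G" and i: "i \<in> S" "w i \<noteq> i"
  shows "Fix w \<subseteq> Fix (refl_B i (w i) \<circ> w)"
    and "3 * card (Fix w) \<le> card (Fix (refl_B i (w i) \<circ> w))"
proof -
  let ?t = "refl_B i (w i)"
  show sub: "Fix w \<subseteq> Fix (?t \<circ> w)"
  proof
    fix x assume x: "x \<in> Fix w"
    then have "x i = x (w i)" by (simp add: Fix_def fun_eq_iff)
    then have "x \<in> Fix ?t" using w i x Fix_subset[of w] by (auto simp: Fix_swap)
    then show "x \<in> Fix (?t \<circ> w)" using x by (auto simp: Fix_def simp flip: comp_assoc)
  qed
  have "evec {i} \<in> Fix (?t \<circ> w)"
  proof (rule evec_Fix)
    show "?t \<circ> w \<in> G" using w i by simp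
    show "{i} \<subseteq> S" using i by simp
    show "{i} \<inter> uminus ` {i} = {}" using i by (auto simp: signed_set_iff)
    show "(?t \<circ> w) ` {i} \<subseteq> {i}" using i by (simp add: refl_B_def)
  qed
  moreover have "evec {i} \<notin> Fix w"
  proof
    assume "evec {i} \<in> Fix w"
    then have "evec {i} (w i) = evec {i} i" by (simp add: Fix_def fun_eq_iff)
    then show False using i trit_one by (cases "- w i = i") (simp_all add: evec_def)
  qed
  ultimately show "3 * card (Fix w) \<le> card (Fix (?t \<circ> w))"
    using sub card_Fix_step by blast
qed

end

section \<open>Length, absolute order and fixed spaces\<close>

context hyperoctahedral_group
begin

lemma pow3_cancel_le: "a > 0 \<Longrightarrow> a * 3 ^ m \<le> a * 3 ^ k \<Longrightarrow> m \<le> k" for a :: nat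
  by simp

lemma pow3_cancel_eq: "a > 0 \<Longrightarrow> a * 3 ^ m = a * 3 ^ k \<Longrightarrow> m = k" for a :: nat
  by simp

lemma mult_cancel_le: "a > 0 \<Longrightarrow> a * b \<le> a * c \<Longrightarrow> b \<le> c" for a b c :: nat
  by simp

lemma swap_generator: "i \<in> S \<Longrightarrow> j \<in> S \<Longrightarrow> i \<noteq> j \<Longrightarrow> refl_B i j \<in> generators_B N"
  unfolding generators_B_eq by blast

lemma generator_hyper: "t \<in> generators_B N \<Longrightarrow> t \<in> G"
  by (auto simp: generators_B_eq)

lemma word_hyper: "set ts \<subseteq> generators_B N \<Longrightarrow> foldr (\<circ>) ts id \<in> G"
  by (induction ts) (simp_all add: generator_hyper)

lemma card_Fix_word: "set ts \<subseteq> generators_B N \<Longrightarrow> card Vec \<le> card (Fix (foldr (\<circ>) ts id)) * 3 ^ length ts"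
proof (induction ts)
  case (Cons t ts)
  let ?w = "foldr (\<circ>) ts id"
  have w: "?w \<in> G" using Cons.prems by (intro word_hyper) simp
  obtain i j where t: "t = refl_B i j" "i \<in> S" "j \<in> S" using Cons.prems by (auto simp: generators_B_eq)
  have "card Vec \<le> card (Fix ?w) * 3 ^ length ts" by (rule Cons.IH) (use Cons.prems in simp)
  also have "\<dots> \<le> 3 * card (Fix (t \<circ> ?w)) * 3 ^ length ts"
    using card_Fix_swap_le[OF w t(2,3)] t(1) by (intro mult_right_mono) auto
  finally have "card Vec \<le> 3 * card (Fix (t \<circ> ?w)) * 3 ^ length ts" .
  moreover have eq: "foldr (\<circ>) (t # ts) id = t \<circ> ?w" by simp
  ultimately show ?case unfolding eq length_Cons power_Suc by (simp only: mult_ac)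
qed simp

lemma card_Fix_le: "card (Fix w) \<le> card Vec"
  by (rule card_mono[OF finite_Vec Fix_subset])

lemma hyper_neq_id: assumes "w \<in> G" "w \<noteq> id" obtains i where "i \<in> S" "w i \<noteq> i"
proof -
  obtain i where i: "w i \<noteq> i" using assms(2) by (auto simp: fun_eq_iff)
  moreover have "i \<in> S" using i hyper_outside[OF assms(1)] by auto
  ultimately show thesis using that by simp
qed

text \<open>Repeating the step of Carter's lemma until the identity is reached writes \<open>w\<close> as a product of as many
reflections as the codimension of its fixed space.\<close>
lemma word_exists:
  "w \<in> G \<Longrightarrow> \<exists>ts. set ts \<subseteq> generators_B N \<and> w = foldr (\<circ>) ts id \<and> card (Fix w) * 3 ^ length ts \<le> card Vec"
proof (induction "card Vec - card (Fix w)" arbitrary: w rule: less_induct)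
  case less
  show ?case
  proof (cases "w = id")
    case True
    then show ?thesis by (intro exI[of _ "[]"]) simp
  next
    case False
    obtain i where i: "i \<in> S" "w i \<noteq> i" using hyper_neq_id[OF less.prems False] .
    let ?t = "refl_B i (w i)"
    have t: "?t \<in> G" "?t \<in> generators_B N"
      using i less.prems by (auto intro!: swap_generator)
    have tw: "?t \<circ> w \<in> G" using t less.prems by simp
    have c: "3 * card (Fix w) \<le> card (Fix (?t \<circ> w))" by (rule Fix_carter(2)[OF less.prems i])
    have "card Vec - card (Fix (?t \<circ> w)) < card Vec - card (Fix w)"
      using c card_Fix_pos[of w] card_Fix_le[of "?t \<circ> w"] by linarith
    from less.hyps[OF this tw] obtain ts where ts: "set ts \<subseteq> generators_B N" "?t \<circ> w = foldr (\<circ>) ts id"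
      "card (Fix (?t \<circ> w)) * 3 ^ length ts \<le> card Vec" by auto
    have "?t \<circ> (?t \<circ> w) = w"
      using swap_comp_self[of i "w i"] i less.prems by (simp flip: comp_assoc)
    then have "w = foldr (\<circ>) (?t # ts) id" by (simp add: ts(2)[symmetric])
    moreover have "card (Fix w) * 3 ^ length (?t # ts) \<le> card Vec"
    proof -
      have "card (Fix w) * 3 ^ length (?t # ts) = 3 * card (Fix w) * 3 ^ length ts" by simp
      also have "\<dots> \<le> card (Fix (?t \<circ> w)) * 3 ^ length ts" using c by (rule mult_right_mono) simp
      finally show ?thesis using ts(3) by (rule order_trans)
    qed
    ultimately show ?thesis using ts(1) t(2) by (intro exI[of _ "?t # ts"]) auto
  qed
qed

text \<open>The length is the codimension of the fixed space: a word cannot be shorter, since each letter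
loses at most one dimension.\<close>
lemma card_Fix: assumes "w \<in> G" shows "card (Fix w) * 3 ^ len w = card Vec"
proof -
  let ?P = "\<lambda>k. \<exists>ts. length ts = k \<and> set ts \<subseteq> generators_B N \<and> w = foldr (\<circ>) ts id"
  obtain ts where ts: "set ts \<subseteq> generators_B N" "w = foldr (\<circ>) ts id" "card (Fix w) * 3 ^ length ts \<le> card Vec"
    using word_exists[OF assms] by auto
  then have P: "?P (length ts)" by auto
  then have "len w \<le> length ts" unfolding length_B_def by (rule Least_le)
  then have "card (Fix w) * 3 ^ len w \<le> card (Fix w) * 3 ^ length ts"
    by (intro mult_left_mono power_increasing) auto
  then have 1: "card (Fix w) * 3 ^ len w \<le> card Vec" using ts(3) by (rule order_trans)
  have "?P (len w)" unfolding length_B_def by (rule LeastI[of ?P, OF P])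
  then obtain us where us: "length us = len w" "set us \<subseteq> generators_B N" "w = foldr (\<circ>) us id" by auto
  then have "card Vec \<le> card (Fix w) * 3 ^ len w" using card_Fix_word[OF us(2)] by simp
  with 1 show ?thesis by (rule antisym)
qed

lemma card_Vec_pos: "card Vec > 0"
  using card_Fix_pos[of id] by simp

lemma len_comp_le: assumes "u \<in> G" "v \<in> G" shows "len (u \<circ> v) \<le> len u + len v"
proof -
  have sub: "Fix u \<inter> Fix v \<subseteq> Fix (u \<circ> v)" by (auto simp: Fix_def simp flip: comp_assoc)
  let ?c = "card (Fix (u \<circ> v))"
  have "card (Fix u) * card (Fix v) \<le> card (Fix u \<inter> Fix v) * card Vec"
    by (rule card_inter_ge) (auto simp: Fix_diff Fix_subset)
  also have "\<dots> \<le> ?c * card Vec" using card_mono[OF finite_Fix sub] by (rule mult_right_mono) simp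
  finally have "(card (Fix u) * card (Fix v)) * (3 ^ len u * 3 ^ len v) \<le> ?c * card Vec * (3 ^ len u * 3 ^ len v)"
    by (rule mult_right_mono) simp
  also have "(card (Fix u) * card (Fix v)) * (3 ^ len u * 3 ^ len v) = card Vec * card Vec"
    using card_Fix[OF assms(1)] card_Fix[OF assms(2)] by (metis mult.assoc mult.left_commute)
  finally have "card Vec * card Vec \<le> card Vec * (?c * (3 ^ len u * 3 ^ len v))" by (simp only: mult_ac)
  then have "card Vec \<le> ?c * (3 ^ len u * 3 ^ len v)" by (rule mult_cancel_le[OF card_Vec_pos])
  then have "?c * 3 ^ len (u \<circ> v) \<le> ?c * 3 ^ (len u + len v)"
    unfolding card_Fix[OF hyper_comp[OF assms]] power_add .
  then show ?thesis by (rule pow3_cancel_le[OF card_Fix_pos])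
qed

lemma len_eq_iff: assumes "u \<in> G" "v \<in> G" shows "len u = len v + k \<longleftrightarrow> card (Fix v) = card (Fix u) * 3 ^ k"
proof
  assume "len u = len v + k"
  then have "card (Fix v) * 3 ^ len v = (card (Fix u) * 3 ^ k) * 3 ^ len v"
    using card_Fix[OF assms(1)] card_Fix[OF assms(2)] by (simp add: power_add mult_ac)
  then show "card (Fix v) = card (Fix u) * 3 ^ k" by simp
next
  assume "card (Fix v) = card (Fix u) * 3 ^ k"
  then have "card (Fix u) * 3 ^ len u = card (Fix u) * 3 ^ (len v + k)"
    using card_Fix[OF assms(1)] card_Fix[OF assms(2)] by (simp add: power_add mult_ac)
  then show "len u = len v + k" by (rule pow3_cancel_eq[OF card_Fix_pos])
qed

lemma len_inv [simp]: "w \<in> G \<Longrightarrow> len (inv w) = len w"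
  using len_eq_iff[of "inv w" w 0] by (simp add: Fix_inv)

lemma len_id [simp]: "len id = 0"
proof -
  have "card Vec * 3 ^ len id = card Vec" using card_Fix[of id] by simp
  then show ?thesis using card_Vec_pos by (cases "len id") auto
qed

lemma len_0_iff: assumes "w \<in> G" shows "len w = 0 \<longleftrightarrow> w = id"
proof
  assume l: "len w = 0"
  show "w = id"
  proof (rule ccontr)
    assume "w \<noteq> id"
    then obtain i where i: "i \<in> S" "w i \<noteq> i" using hyper_neq_id[OF assms] by auto
    have "card (Fix w) = card Vec" using card_Fix[OF assms] l by simp
    then show False
      using Fix_carter(2)[OF assms i] card_Fix_le[of "refl_B i (w i) \<circ> w"] card_Vec_pos by linarith
  qed
qed simp

lemma swap_neq_id: assumes "i \<noteq> j" shows "refl_B i j \<noteq> id"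
proof
  assume "refl_B i j = id"
  then have "refl_B i j i = i" by simp
  then show False using assms by (simp add: refl_B_def)
qed

lemma len_swap: assumes "i \<in> S" "j \<in> S" "i \<noteq> j" shows "len (refl_B i j) = 1"
proof -
  have g: "refl_B i j \<in> G" using assms by simp
  have "card Vec \<le> 3 * card (Fix (refl_B i j))"
    using card_Fix_swap_le[of id i j] assms by simp
  then have "card (Fix (refl_B i j)) * 3 ^ len (refl_B i j) \<le> card (Fix (refl_B i j)) * 3"
    using card_Fix[OF g] by simp
  then have "card (Fix (refl_B i j)) * 3 ^ len (refl_B i j) \<le> card (Fix (refl_B i j)) * 3 ^ 1"
    by simp
  then have "len (refl_B i j) \<le> 1" by (rule pow3_cancel_le[OF card_Fix_pos])
  moreover have "len (refl_B i j) \<noteq> 0" using len_0_iff[OF g] swap_neq_id[OF assms(3)] by simp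
  ultimately show ?thesis by simp
qed

lemma len_Suc_I:
  assumes "w \<in> G" "v \<in> G" "w = refl_B i j \<circ> v" "i \<in> S" "j \<in> S"
    and "3 * card (Fix w) \<le> card (Fix v)"
  shows "len w = len v + 1"
proof -
  have "card (Fix v) \<le> 3 * card (Fix w)" using card_Fix_swap_le[OF assms(2,4,5)] assms(3) by simp
  then show ?thesis unfolding len_eq_iff[OF assms(1,2)] using assms(6) by simp
qed

lemma len_carter:
  assumes w: "w \<in> G" and i: "i \<in> S" "w i \<noteq> i"
  shows "len w = len (refl_B i (w i) \<circ> w) + 1"
proof (rule len_Suc_I)
  show "w = refl_B i (w i) \<circ> (refl_B i (w i) \<circ> w)"
    using swap_comp_self[of i "w i"] w i by (simp flip: comp_assoc)
  show "3 * card (Fix w) \<le> card (Fix (refl_B i (w i) \<circ> w))" by (rule Fix_carter(2)[OF w i])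
qed (use w i in simp_all)

abbreviation (input) "le \<equiv> le_B N"

lemma le_refl [simp]: "u \<in> G \<Longrightarrow> le u u"
  by (simp add: le_B_def)

lemma inv_comp_cancel [simp]: "u \<in> G \<Longrightarrow> u \<circ> (inv u \<circ> w) = w" "u \<in> G \<Longrightarrow> inv u \<circ> (u \<circ> w) = w"
  by (simp_all flip: comp_assoc)

lemma le_I: assumes "u \<in> G" "w \<in> G" "len u + len (inv u \<circ> w) \<le> len w" shows "le u w"
proof -
  have "len (u \<circ> (inv u \<circ> w)) \<le> len u + len (inv u \<circ> w)" using assms by (intro len_comp_le) auto
  then show ?thesis using assms by (simp add: le_B_def)
qed

lemma le_trans: assumes "u \<in> G" "v \<in> G" "w \<in> G" "le u v" "le v w" shows "le u w"
proof (rule le_I)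
  have "inv u \<circ> w = (inv u \<circ> v) \<circ> (inv v \<circ> w)" using assms by (simp add: comp_assoc)
  then have "len (inv u \<circ> w) \<le> len (inv u \<circ> v) + len (inv v \<circ> w)"
    using len_comp_le[of "inv u \<circ> v" "inv v \<circ> w"] assms by simp
  then show "len u + len (inv u \<circ> w) \<le> len w" using assms(4,5) by (simp add: le_B_def)
qed (use assms in auto)

lemma le_antisym: assumes "u \<in> G" "v \<in> G" "le u v" "len v \<le> len u" shows "u = v"
proof -
  have "len (inv u \<circ> v) = 0" using assms by (simp add: le_B_def)
  then have "inv u \<circ> v = id" using len_0_iff assms by simp
  then have "u \<circ> (inv u \<circ> v) = u" by simp
  then show ?thesis using assms by simp
qed

lemma le_id [simp]: "w \<in> G \<Longrightarrow> le id w"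
  by (simp add: le_B_def)

lemma le_len: "le u w \<Longrightarrow> len u \<le> len w"
  by (simp add: le_B_def)

text \<open>The intersection of the fixed spaces of \<open>u\<close> and \<open>inv u \<circ> w\<close> lies in that of
\<open>w\<close>, and additivity of lengths says that its codimension is no larger.\<close>
lemma le_Fix: assumes "u \<in> G" "w \<in> G" "le u w" shows "Fix w \<subseteq> Fix u"
proof -
  let ?v = "inv u \<circ> w"
  let ?I = "Fix u \<inter> Fix ?v"
  have v: "?v \<in> G" using assms by simp
  have sub: "?I \<subseteq> Fix w"
  proof
    fix x assume x: "x \<in> ?I"
    then have "x \<in> Fix (inv u)" by (simp add: Fix_inv[OF assms(1)])
    with x show "x \<in> Fix w" by (simp add: Fix_def flip: comp_assoc)
  qed
  have "card (Fix u) * card (Fix ?v) \<le> card ?I * card Vec"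
    by (rule card_inter_ge) (auto simp: Fix_diff Fix_subset)
  then have "(card (Fix u) * card (Fix ?v)) * (3 ^ len u * 3 ^ len ?v) \<le> card ?I * card Vec * (3 ^ len u * 3 ^ len ?v)"
    by (rule mult_right_mono) simp
  also have "(card (Fix u) * card (Fix ?v)) * (3 ^ len u * 3 ^ len ?v) = card Vec * card Vec"
    using card_Fix[OF assms(1)] card_Fix[OF v] by (metis mult.assoc mult.left_commute)
  finally have "card Vec * card Vec \<le> card Vec * (card ?I * (3 ^ len u * 3 ^ len ?v))" by (simp only: mult_ac)
  then have "card Vec \<le> card ?I * (3 ^ len u * 3 ^ len ?v)" by (rule mult_cancel_le[OF card_Vec_pos])
  moreover have "(3::nat) ^ len u * 3 ^ len ?v = 3 ^ len w" using assms(3) by (simp add: le_B_def power_add)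
  ultimately have "card (Fix w) * 3 ^ len w \<le> card ?I * 3 ^ len w"
    unfolding card_Fix[OF assms(2)] by (simp only:)
  then have "card (Fix w) \<le> card ?I" by simp
  then have "?I = Fix w" using sub by (intro card_seteq) auto
  then show ?thesis by blast
qed

text \<open>Over the reals this would be the orthogonal complement of \<open>Fix w\<close>. Over three elements there are
isotropic vectors, so moved spaces are compared directly, in \<open>Mov_mono\<close>.\<close>
definition Mov :: "(int \<Rightarrow> int) \<Rightarrow> (int \<Rightarrow> 3) set" where
  "Mov w = (\<lambda>x::int\<Rightarrow>3. (x \<circ> w) - x) ` Vec"

lemma finite_Mov [simp]: "finite (Mov w)" by (simp add: Mov_def)

lemma Mov_diff: "x \<in> Mov w \<Longrightarrow> y \<in> Mov w \<Longrightarrow> x - y \<in> Mov w"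
proof -
  assume "x \<in> Mov w" "y \<in> Mov w"
  then obtain a b where "a \<in> Vec" "b \<in> Vec" "x = (a \<circ> w) - a" "y = (b \<circ> w) - b" by (auto simp: Mov_def)
  then have "x - y = ((a - b) \<circ> w) - (a - b)" "a - b \<in> Vec" by (auto simp: Vec_diff diff_comp)
  then show ?thesis unfolding Mov_def by (rule image_eqI)
qed

lemma Mov_0: "0 \<in> Mov w"
proof -
  have "(0 :: int \<Rightarrow> 3) = (0 \<circ> w) - 0" by (auto simp: fun_eq_iff)
  then show ?thesis unfolding Mov_def using Vec_0 by (rule image_eqI)
qed

lemma Mov_add: assumes "x \<in> Mov w" "y \<in> Mov w" shows "x + y \<in> Mov w"
proof -
  have "x - (0 - y) \<in> Mov w" by (intro Mov_diff Mov_0 assms)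
  then show ?thesis by simp
qed

lemma Mov_scale: assumes "x \<in> Mov w" shows "(\<lambda>k. c * x k) \<in> Mov w"
proof -
  obtain a where a: "a \<in> Vec" "x = (a \<circ> w) - a" using assms by (auto simp: Mov_def)
  have "(\<lambda>k. c * a k) \<in> Vec" using a(1) by (simp add: Vec_def)
  moreover have "(\<lambda>k. c * x k) = ((\<lambda>k. c * a k) \<circ> w) - (\<lambda>k. c * a k)"
    by (simp add: fun_eq_iff a(2) right_diff_distrib)
  ultimately show ?thesis unfolding Mov_def by blast
qed

lemma Mov_sum: "(\<And>i. i \<in> I \<Longrightarrow> f i \<in> Mov w) \<Longrightarrow> (\<Sum>i\<in>I. f i) \<in> Mov w"
  by (induction I rule: infinite_finite_induct) (simp_all add: Mov_0 Mov_add)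

text \<open>Adding a fixed vector to a preimage does not change its image, so a choice of preimages gives an
injection from \<open>Mov w \<times> Fix w\<close> into the whole space.\<close>
lemma card_Mov: assumes "w \<in> G" shows "card (Mov w) \<le> 3 ^ len w"
proof -
  define s where "s = inv_into Vec (\<lambda>x::int\<Rightarrow>3. (x \<circ> w) - x)"
  have s: "s y \<in> Vec" "(s y \<circ> w) - s y = y" if "y \<in> Mov w" for y
    using that inv_into_into[of y "\<lambda>x::int\<Rightarrow>3. (x \<circ> w) - x" Vec] f_inv_into_f[of y "\<lambda>x::int\<Rightarrow>3. (x \<circ> w) - x" Vec]
    by (auto simp: s_def Mov_def)
  have eq: "((s y + f) \<circ> w) - (s y + f) = y" if "y \<in> Mov w" "f \<in> Fix w" for y f
  proof -
    have "f \<circ> w = f" using that(2) by (simp add: Fix_def)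
    then have "((s y + f) \<circ> w) - (s y + f) = (s y \<circ> w) - s y" by (simp add: add_comp)
    then show ?thesis using s(2)[OF that(1)] by simp
  qed
  have "card (Mov w \<times> Fix w) \<le> card Vec"
  proof (rule card_inj_on_le[of "\<lambda>(y, f). s y + f"])
    show "inj_on (\<lambda>(y, f). s y + f) (Mov w \<times> Fix w)"
    proof (rule inj_onI, clarify)
      fix y f y' f' assume a: "y \<in> Mov w" "f \<in> Fix w" "y' \<in> Mov w" "f' \<in> Fix w" "s y + f = s y' + f'"
      have "y = y'" using eq[OF a(1,2)] eq[OF a(3,4)] a(5) by simp
      then show "y = y' \<and> f = f'" using a(5) by simp
    qed
    show "(\<lambda>(y, f). s y + f) ` (Mov w \<times> Fix w) \<subseteq> Vec"
    proof (rule image_subsetI, clarify)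
      fix y f assume "y \<in> Mov w" "f \<in> Fix w"
      then show "s y + f \<in> Vec" using s(1) Fix_subset by (intro Vec_add) auto
    qed
  qed simp
  then have "card (Mov w) * card (Fix w) \<le> 3 ^ len w * card (Fix w)"
    using card_Fix[OF assms] by (simp add: card_cartesian_product mult.commute)
  then show ?thesis using card_Fix_pos[of w] by simp
qed

text \<open>The vectors on which \<open>u\<close> and \<open>w\<close> act alike. They correspond to the fixed vectors of
\<open>inv u \<circ> w\<close>, but, unlike those, can be compared for different \<open>u\<close>.\<close>
definition Agree :: "(int \<Rightarrow> int) \<Rightarrow> (int \<Rightarrow> int) \<Rightarrow> (int \<Rightarrow> 3) set" where
  "Agree u w = {x \<in> Vec. x \<circ> u = x \<circ> w}"

lemma finite_Agree [simp]: "finite (Agree u w)"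
  by (rule finite_subset[OF _ finite_Vec]) (auto simp: Agree_def)

lemma card_Agree: assumes "u \<in> G" "w \<in> G" shows "card (Agree u w) = card (Fix (inv u \<circ> w))"
proof (rule antisym)
  show "card (Agree u w) \<le> card (Fix (inv u \<circ> w))"
  proof (rule card_inj_on_le[of "\<lambda>x. x \<circ> u"])
    show "inj_on (\<lambda>x. x \<circ> u) (Agree u w)"
    proof (rule inj_onI)
      fix x y :: "int \<Rightarrow> 3" assume "x \<circ> u = y \<circ> u"
      then have "x \<circ> (u \<circ> inv u) = y \<circ> (u \<circ> inv u)" unfolding comp_assoc[symmetric] by simp
      then show "x = y" using assms by simp
    qed
    show "(\<lambda>x. x \<circ> u) ` Agree u w \<subseteq> Fix (inv u \<circ> w)"
    proof (rule image_subsetI)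
      fix x assume x: "x \<in> Agree u w"
      have "x \<circ> u \<circ> (inv u \<circ> w) = x \<circ> w" using assms by (simp add: comp_assoc)
      then show "x \<circ> u \<in> Fix (inv u \<circ> w)" using x assms by (simp add: Fix_def Agree_def Vec_comp)
    qed
  qed simp
  show "card (Fix (inv u \<circ> w)) \<le> card (Agree u w)"
  proof (rule card_inj_on_le[of "\<lambda>x. x \<circ> inv u"])
    show "inj_on (\<lambda>x. x \<circ> inv u) (Fix (inv u \<circ> w))"
    proof (rule inj_onI)
      fix x y :: "int \<Rightarrow> 3" assume "x \<circ> inv u = y \<circ> inv u"
      then have "x \<circ> (inv u \<circ> u) = y \<circ> (inv u \<circ> u)" unfolding comp_assoc[symmetric] by simp
      then show "x = y" using assms by simp
    qed
    show "(\<lambda>x. x \<circ> inv u) ` Fix (inv u \<circ> w) \<subseteq> Agree u w"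
    proof (rule image_subsetI)
      fix x assume x: "x \<in> Fix (inv u \<circ> w)"
      have "x \<circ> inv u \<circ> u = x" using assms by (simp add: comp_assoc)
      then show "x \<circ> inv u \<in> Agree u w" using x assms by (simp add: Fix_def Agree_def Vec_comp comp_assoc)
    qed
  qed simp
qed

lemma Agree_diff: "x \<in> Agree u w \<Longrightarrow> y \<in> Agree u w \<Longrightarrow> x - y \<in> Agree u w"
  by (simp add: Agree_def Vec_diff diff_comp)

lemma inj_on_id_minus: assumes "Fix c = {0}" shows "inj_on (\<lambda>x::int\<Rightarrow>3. (x \<circ> c) - x) Vec"
proof (rule inj_onI)
  fix x y :: "int \<Rightarrow> 3" assume xy: "x \<in> Vec" "y \<in> Vec" "(x \<circ> c) - x = (y \<circ> c) - y"
  have "((x - y) \<circ> c) - (x - y) = ((x \<circ> c) - x) - ((y \<circ> c) - y)" by (simp add: diff_comp)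
  then have "(x - y) \<circ> c = x - y" using xy(3) by simp
  then have "x - y \<in> Fix c" using xy by (simp add: Fix_def Vec_diff)
  then show "x = y" using assms by simp
qed

text \<open>If \<open>c\<close> has no fixed vector, then \<open>x \<mapsto> x \<circ> c - x\<close> is injective. On
\<open>Agree u c\<close> it agrees with \<open>x \<mapsto> x \<circ> u - x\<close>, and for \<open>u \<le> c\<close> the dimensions force the image to
be all of \<open>Mov u\<close>. Hence \<open>Mov u\<close> determines \<open>Agree u c\<close>.\<close>
lemma Agree_image:
  assumes "u \<in> G" "c \<in> G" "Fix c = {0}" "le u c"
  shows "card (Agree u c) = 3 ^ len u" and "(\<lambda>x::int\<Rightarrow>3. (x \<circ> c) - x) ` Agree u c = Mov u"
proof -
  have "card (Agree u c) * 3 ^ len (inv u \<circ> c) = card Vec"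
    using card_Fix[of "inv u \<circ> c"] assms(1,2) by (simp add: card_Agree)
  also have "\<dots> = 3 ^ len c" using card_Fix[OF assms(2)] assms(3) by simp
  also have "\<dots> = 3 ^ len u * 3 ^ len (inv u \<circ> c)" using assms(4) by (simp add: le_B_def power_add)
  finally show c: "card (Agree u c) = 3 ^ len u" by simp
  have inj: "inj_on (\<lambda>x::int\<Rightarrow>3. (x \<circ> c) - x) (Agree u c)"
    using inj_on_id_minus[OF assms(3)] by (rule inj_on_subset) (auto simp: Agree_def)
  show "(\<lambda>x::int\<Rightarrow>3. (x \<circ> c) - x) ` Agree u c = Mov u"
  proof (rule card_seteq)
    show "(\<lambda>x::int\<Rightarrow>3. (x \<circ> c) - x) ` Agree u c \<subseteq> Mov u"
    proof (rule image_subsetI)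
      fix x assume "x \<in> Agree u c"
      then have "x \<in> Vec" "(x \<circ> c) - x = (x \<circ> u) - x" by (auto simp: Agree_def)
      then show "(x \<circ> c) - x \<in> Mov u" by (simp add: Mov_def)
    qed
    show "card (Mov u) \<le> card ((\<lambda>x::int\<Rightarrow>3. (x \<circ> c) - x) ` Agree u c)"
      using card_Mov[OF assms(1)] by (simp add: card_image[OF inj] c)
  qed simp
qed

text \<open>The argument of Brady and Watt for the orthogonal group. By the previous lemma
\<open>Agree u c \<subseteq> Agree v c\<close>, so on this space \<open>u\<close>, \<open>v\<close> and \<open>c\<close> act alike.
On \<open>Fix v\<close> both \<open>u\<close> and \<open>v\<close> act trivially. The two spaces meet only in fixed
vectors of \<open>c\<close>, that is, in 0; so \<open>u\<close> and \<open>v\<close> agree on a space large enough to bound the length of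
\<open>inv u \<circ> v\<close> by \<open>len v - len u\<close>.\<close>
theorem le_of_Mov:
  assumes G: "u \<in> G" "v \<in> G" "c \<in> G" and c: "Fix c = {0}" and le: "le u c" "le v c"
    and MovE: "Mov u \<subseteq> Mov v" and FixE: "Fix v \<subseteq> Fix u"
  shows "le u v"
proof (rule le_I)
  have sub: "Agree u c \<subseteq> Agree v c"
  proof
    fix x assume x: "x \<in> Agree u c"
    then have "(x \<circ> c) - x \<in> Mov u" using Agree_image(2)[OF G(1,3) c le(1)] by blast
    then have "(x \<circ> c) - x \<in> (\<lambda>x::int\<Rightarrow>3. (x \<circ> c) - x) ` Agree v c" using Agree_image(2)[OF G(2,3) c le(2)] MovE by blast
    then obtain y where y: "y \<in> Agree v c" "(x \<circ> c) - x = (y \<circ> c) - y" by blast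
    have "x \<in> Vec" "y \<in> Vec" using x y by (auto simp: Agree_def)
    then have "x = y" using inj_on_id_minus[OF c] y(2) unfolding inj_on_def by (simp only: Ball_def)
    then show "x \<in> Agree v c" using y by simp
  qed
  have "card (Agree u c \<times> Fix v) \<le> card (Agree u v)"
  proof (rule card_inj_on_le[of "\<lambda>(x, y). x + y"])
    show "inj_on (\<lambda>(x, y). x + y) (Agree u c \<times> Fix v)"
    proof (rule inj_onI, clarify)
      fix x y x' y' assume a: "x \<in> Agree u c" "y \<in> Fix v" "x' \<in> Agree u c" "y' \<in> Fix v" "x + y = x' + y'"
      define z where "z = x - x'"
      have z: "z = y' - y" using a(5) by (simp add: z_def algebra_simps)
      have z1: "z \<in> Agree u c" unfolding z_def using a by (intro Agree_diff)
      have z2: "z \<in> Fix v" unfolding z using a by (intro Fix_diff)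
      have "z \<in> Fix u" using z2 FixE by blast
      then have "z \<in> Fix c" using z1 by (simp add: Fix_def Agree_def)
      then have "z = 0" using c by simp
      then show "x = x' \<and> y = y'" using z z_def by simp
    qed
    show "(\<lambda>(x, y). x + y) ` (Agree u c \<times> Fix v) \<subseteq> Agree u v"
    proof (rule image_subsetI, clarify)
      fix x y assume a: "x \<in> Agree u c" "y \<in> Fix v"
      then have "x \<in> Agree v c" "y \<in> Fix u" using sub FixE by auto
      with a show "x + y \<in> Agree u v" by (simp add: Agree_def Fix_def add_comp Vec_add)
    qed
  qed simp
  then have "3 ^ len u * card (Fix v) \<le> card (Fix (inv u \<circ> v))"
    using Agree_image(1)[OF G(1,3) c le(1)] card_Agree[OF G(1,2)] by (simp add: card_cartesian_product)
  then have "3 ^ len u * card (Fix v) * 3 ^ len (inv u \<circ> v) \<le> card (Fix (inv u \<circ> v)) * 3 ^ len (inv u \<circ> v)"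
    by (rule mult_right_mono) simp
  also have "\<dots> = card (Fix v) * 3 ^ len v"
    using card_Fix[of "inv u \<circ> v"] card_Fix[of v] G by simp
  finally have "card (Fix v) * 3 ^ (len u + len (inv u \<circ> v)) \<le> card (Fix v) * 3 ^ len v"
    by (simp only: power_add mult_ac)
  then show "len u + len (inv u \<circ> v) \<le> len v" by (rule pow3_cancel_le[OF card_Fix_pos])
qed (use G in auto)

end

section \<open>Blocks of a signed permutation and its fixed space\<close>

context hyperoctahedral_group
begin

text \<open>The orbit of \<open>i\<close> is invariant under inversion; see \<open>selfneg_iff\<close>.\<close>
definition selfneg :: "(int \<Rightarrow> int) \<Rightarrow> int \<Rightarrow> bool" where
  "selfneg w i \<longleftrightarrow> - i \<in> orbit w i"

definition same_block :: "(int \<Rightarrow> int) \<Rightarrow> int \<Rightarrow> int \<Rightarrow> bool" where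
  "same_block w i j \<longleftrightarrow> j \<in> orbit w i \<or> (selfneg w i \<and> selfneg w j)"

lemma hyper_permutation: "w \<in> G \<Longrightarrow> permutation w"
  unfolding permutation_permutes using hyper_permutes finite_signed_set by blast

lemma self_in_orbit: "w \<in> G \<Longrightarrow> i \<in> orbit w i"
  by (rule permutation_self_in_orbit[OF hyper_permutation])

lemma orbit_eq: "w \<in> G \<Longrightarrow> j \<in> orbit w i \<Longrightarrow> orbit w j = orbit w i"
  by (rule orbit_cyclic_eq3[OF cyclic_on_orbit'[OF hyper_permutation]])

lemma orbit_mem_S: "w \<in> G \<Longrightarrow> i \<in> S \<Longrightarrow> j \<in> orbit w i \<Longrightarrow> j \<in> S"
  by (rule subsetD[OF permutes_orbit_subset[OF hyper_permutes]])

lemma orbit_uminus_mem: assumes "w \<in> G" "j \<in> orbit w i" shows "- j \<in> orbit w (- i)"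
  using assms(2)
proof induction
  case base
  then show ?case using orbit.base[of w "- i"] by (simp add: hyper_odd[OF assms(1)])
next
  case (step j)
  then show ?case using orbit.step[of "- j" w "- i"] by (simp add: hyper_odd[OF assms(1)])
qed

lemma orbit_uminus: assumes "w \<in> G" shows "orbit w (- i) = uminus ` orbit w i"
proof
  show "uminus ` orbit w i \<subseteq> orbit w (- i)" using orbit_uminus_mem[OF assms] by auto
  show "orbit w (- i) \<subseteq> uminus ` orbit w i"
  proof
    fix j assume "j \<in> orbit w (- i)"
    then have "- j \<in> orbit w i" using orbit_uminus_mem[OF assms, of j "- i"] by simp
    then show "j \<in> uminus ` orbit w i" by (metis image_eqI minus_minus)
  qed
qed

lemma selfneg_iff: assumes "w \<in> G" shows "selfneg w i \<longleftrightarrow> uminus ` orbit w i = orbit w i"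
proof
  assume "selfneg w i"
  then have "orbit w (- i) = orbit w i" unfolding selfneg_def by (rule orbit_eq[OF assms])
  then show "uminus ` orbit w i = orbit w i" by (simp add: orbit_uminus[OF assms])
next
  assume "uminus ` orbit w i = orbit w i"
  moreover have "- i \<in> uminus ` orbit w i" by (rule imageI[OF self_in_orbit[OF assms]])
  ultimately show "selfneg w i" by (simp add: selfneg_def)
qed

lemma selfneg_orbit: assumes "w \<in> G" "j \<in> orbit w i" shows "selfneg w j \<longleftrightarrow> selfneg w i"
  using orbit_eq[OF assms] by (simp add: selfneg_iff[OF assms(1)])

lemma evec_orbit: assumes "w \<in> G" "i \<in> S" "\<not> selfneg w i" shows "evec (orbit w i) \<in> Fix w"
proof (rule evec_Fix[OF assms(1)])
  show "orbit w i \<subseteq> S" using orbit_mem_S[OF assms(1,2)] by blast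
  show "w ` orbit w i \<subseteq> orbit w i" by (auto intro: orbit.step)
  show "orbit w i \<inter> uminus ` orbit w i = {}"
  proof (rule ccontr)
    assume "orbit w i \<inter> uminus ` orbit w i \<noteq> {}"
    then obtain k where k: "k \<in> orbit w i" "- k \<in> orbit w i" by auto
    then have "selfneg w k" using orbit_eq[OF assms(1) k(1)] by (simp add: selfneg_def)
    then show False using selfneg_orbit[OF assms(1) k(1)] assms(3) by simp
  qed
qed

text \<open>The partition is recovered from the fixed space: an orbit disjoint from its negative is seen by its
signed indicator, and the invariant orbits are precisely where all fixed vectors vanish. This is why
those orbits have to be merged into one block.\<close>
lemma same_block_iff_Fix:
  assumes "w \<in> G" "i \<in> S" "j \<in> S"
  shows "same_block w i j \<longleftrightarrow> (\<forall>x\<in>Fix w. x i = x j)"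
proof
  have orb: "x k = x l" if "x \<in> Fix w" "l \<in> orbit w k" for x k l
    using that(2)
  proof induction
    case base then show ?case using that(1) by (simp add: Fix_def fun_eq_iff)
  next
    case (step l) then show ?case using that(1) by (simp add: Fix_def fun_eq_iff)
  qed
  have zero: "x k = 0" if x: "x \<in> Fix w" "selfneg w k" for x k
  proof -
    have "x k = x (- k)" using x orb by (simp add: selfneg_def)
    then have "x k = - x k" using x by (simp add: Fix_def Vec_def)
    then have "x k + x k = - x k + x k" by (rule arg_cong)
    then show ?thesis using trit_double_eq_0 by (simp only: left_minus)
  qed
  show "\<forall>x\<in>Fix w. x i = x j" if s: "same_block w i j"
  proof
    fix x assume x: "x \<in> Fix w"
    show "x i = x j" using s unfolding same_block_def
    proof
      assume "j \<in> orbit w i" then show ?thesis by (rule orb[OF x])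
    next
      assume "selfneg w i \<and> selfneg w j"
      then have "x i = 0" "x j = 0" using zero[OF x] by auto
      then show ?thesis by (simp only:)
    qed
  qed
next
  have ev: "j \<in> orbit w i" if "\<forall>x\<in>Fix w. x i = x j" "i \<in> S" "\<not> selfneg w i" for i j
  proof -
    have "evec (orbit w i) i = evec (orbit w i) j" using that evec_orbit[OF assms(1)] by blast
    then show ?thesis using self_in_orbit[OF assms(1), of i] trit_one by (auto simp: evec_def split: if_splits)
  qed
  assume x: "\<forall>x\<in>Fix w. x i = x j"
  consider "selfneg w i" "selfneg w j" | "\<not> selfneg w i" | "selfneg w i" "\<not> selfneg w j" by blast
  then show "same_block w i j"
  proof cases
    case 1 then show ?thesis by (simp add: same_block_def)
  next
    case 2 then show ?thesis using ev[OF x assms(2)] by (simp add: same_block_def)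
  next
    case 3
    have "i \<in> orbit w j" by (rule ev) (use x assms 3 in auto)
    then show ?thesis using selfneg_orbit[OF assms(1)] 3 by blast
  qed
qed

definition block :: "(int \<Rightarrow> int) \<Rightarrow> int \<Rightarrow> int set" where
  "block w i = {j \<in> S. same_block w i j}"

lemma block_selfneg: assumes "w \<in> G" "selfneg w i" shows "block w i = {j \<in> S. selfneg w j}"
  using selfneg_orbit[OF assms(1)] assms(2) by (auto simp: block_def same_block_def)

lemma block_not_selfneg: assumes "w \<in> G" "i \<in> S" "\<not> selfneg w i" shows "block w i = orbit w i"
  using orbit_mem_S[OF assms(1,2)] assms(3) by (auto simp: block_def same_block_def)

lemma Omega_tilde_eq: assumes w: "w \<in> G" shows "Omega_tilde N w = block w ` S"
proof -
  define I where "I = {A \<in> Omega N w. uminus ` A = A}"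
  have I: "I = orbit w ` {i \<in> S. selfneg w i}"
    by (auto simp: I_def Omega_def selfneg_iff[OF w])
  have nI: "Omega N w - I = block w ` {i \<in> S. \<not> selfneg w i}"
  proof -
    have "Omega N w - I = orbit w ` {i \<in> S. \<not> selfneg w i}"
      by (auto simp: I_def Omega_def selfneg_iff[OF w])
    also have "\<dots> = block w ` {i \<in> S. \<not> selfneg w i}"
      using block_not_selfneg[OF w] by (intro image_cong refl) auto
    finally show ?thesis .
  qed
  show ?thesis
  proof (cases "I = {}")
    case True
    then have "{i \<in> S. \<not> selfneg w i} = S" using I by blast
    moreover have "Omega_tilde N w = Omega N w - I"
      using True by (simp add: Omega_tilde_def merge_invariant_def I_def[symmetric] Let_def)
    ultimately show ?thesis using nI by simp
  next
    case False
    have U: "\<Union>I = {j \<in> S. selfneg w j}"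
    proof
      show "\<Union>I \<subseteq> {j \<in> S. selfneg w j}"
        using orbit_mem_S[OF w] selfneg_orbit[OF w] by (auto simp: I)
      show "{j \<in> S. selfneg w j} \<subseteq> \<Union>I" using self_in_orbit[OF w] by (auto simp: I)
    qed
    have "block w ` {i \<in> S. selfneg w i} = (\<lambda>_. \<Union>I) ` {i \<in> S. selfneg w i}"
      unfolding U using block_selfneg[OF w] by (intro image_cong refl) simp
    also have "\<dots> = {\<Union>I}" using False unfolding I by (simp add: image_constant_conv)
    finally have "block w ` {i \<in> S. selfneg w i} = {\<Union>I}" .
    moreover have "Omega_tilde N w = (Omega N w - I) \<union> {\<Union>I}"
      using False by (simp add: Omega_tilde_def merge_invariant_def I_def[symmetric] Let_def)
    ultimately have "Omega_tilde N w = block w ` ({i \<in> S. \<not> selfneg w i} \<union> {i \<in> S. selfneg w i})"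
      using nI by (simp only: image_Un)
    also have "{i \<in> S. \<not> selfneg w i} \<union> {i \<in> S. selfneg w i} = S" by blast
    finally show ?thesis .
  qed
qed

lemma same_block_equiv:
  assumes "w \<in> G"
  shows "same_block w i i" and "same_block w i j \<Longrightarrow> i \<in> S \<Longrightarrow> j \<in> S \<Longrightarrow> same_block w j i"
    and "same_block w i j \<Longrightarrow> same_block w j k \<Longrightarrow> i \<in> S \<Longrightarrow> j \<in> S \<Longrightarrow> k \<in> S \<Longrightarrow> same_block w i k"
proof -
  show "same_block w i i" using self_in_orbit[OF assms] by (simp add: same_block_def)
  assume ij: "same_block w i j" "i \<in> S" "j \<in> S"
  have x: "\<forall>x\<in>Fix w. x i = x j" using same_block_iff_Fix[OF assms ij(2,3)] ij(1) by (rule iffD1)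
  then have "\<forall>x\<in>Fix w. x j = x i" by (auto intro: sym)
  then show "same_block w j i" by (rule iffD2[OF same_block_iff_Fix[OF assms ij(3,2)]])
  assume jk: "same_block w j k" "k \<in> S"
  have "\<forall>x\<in>Fix w. x j = x k" using same_block_iff_Fix[OF assms ij(3) jk(2)] jk(1) by (rule iffD1)
  have "\<forall>y\<in>Fix w. y i = y k"
  proof
    fix y assume y: "y \<in> Fix w"
    show "y i = y k" using bspec[OF x y] bspec[OF \<open>\<forall>x\<in>Fix w. x j = x k\<close> y] by (rule trans)
  qed
  then show "same_block w i k" by (rule iffD2[OF same_block_iff_Fix[OF assms ij(2) jk(2)]])
qed

lemma block_cong: assumes "w \<in> G" "i \<in> S" "j \<in> block w i" shows "block w j = block w i"
proof -
  have j: "j \<in> S" "same_block w i j" using assms by (auto simp: block_def)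
  have ji: "same_block w j i" by (rule same_block_equiv(2)[OF assms(1) j(2) assms(2) j(1)])
  have "same_block w j k \<longleftrightarrow> same_block w i k" if k: "k \<in> S" for k
    using same_block_equiv(3)[OF assms(1) ji _ j(1) assms(2) k]
      same_block_equiv(3)[OF assms(1) j(2) _ assms(2) j(1) k] by (rule iffI[rotated])
  then show ?thesis unfolding block_def by (intro Collect_cong) auto
qed

lemma partition_on_Omega_tilde: assumes "w \<in> G" shows "partition_on S (Omega_tilde N w)"
  unfolding Omega_tilde_eq[OF assms]
proof (rule partition_onI)
  show "\<Union>(block w ` S) = S" using same_block_equiv(1)[OF assms] by (auto simp: block_def)
next
  fix A B assume "A \<in> block w ` S" "B \<in> block w ` S" "A \<noteq> B"
  then obtain i j where ij: "i \<in> S" "j \<in> S" "A = block w i" "B = block w j" "A \<noteq> B" by blast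
  show "disjnt A B"
  proof (rule ccontr)
    assume "\<not> disjnt A B"
    then obtain k where "k \<in> A" "k \<in> B" by (auto simp: disjnt_iff)
    then show False using block_cong[OF assms ij(1), of k] block_cong[OF assms ij(2), of k] ij by simp
  qed
next
  show "{} \<notin> block w ` S"
    using same_block_equiv(1)[OF assms] by (auto simp: block_def)
qed

lemma refines_Omega_tilde_iff:
  assumes "u \<in> G" "v \<in> G"
  shows "refines S (Omega_tilde N u) (Omega_tilde N v) \<longleftrightarrow>
    (\<forall>i\<in>S. \<forall>j\<in>S. same_block u i j \<longrightarrow> same_block v i j)"
proof
  assume r: "refines S (Omega_tilde N u) (Omega_tilde N v)"
  show "\<forall>i\<in>S. \<forall>j\<in>S. same_block u i j \<longrightarrow> same_block v i j"
  proof (intro ballI impI)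
    fix i j assume ij: "i \<in> S" "j \<in> S" "same_block u i j"
    have "block u i \<in> Omega_tilde N u" using ij by (simp add: Omega_tilde_eq[OF assms(1)])
    then obtain Y where "Y \<in> Omega_tilde N v" "block u i \<subseteq> Y" using r unfolding refines_def by blast
    then obtain k where k: "k \<in> S" "block u i \<subseteq> block v k" by (auto simp: Omega_tilde_eq[OF assms(2)])
    have "i \<in> block u i" "j \<in> block u i" using ij same_block_equiv(1)[OF assms(1)] by (auto simp: block_def)
    then have "same_block v k i" "same_block v k j" using k by (auto simp: block_def)
    have "same_block v i k" by (rule same_block_equiv(2)[OF assms(2) \<open>same_block v k i\<close> k(1) ij(1)])
    then show "same_block v i j"
      using \<open>same_block v k j\<close> by (rule same_block_equiv(3)[OF assms(2) _ _ ij(1) k(1) ij(2)])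
  qed
next
  assume a: "\<forall>i\<in>S. \<forall>j\<in>S. same_block u i j \<longrightarrow> same_block v i j"
  have "\<forall>X\<in>block u ` S. \<exists>Y\<in>block v ` S. X \<subseteq> Y" using a by (auto simp: block_def)
  then show "refines S (Omega_tilde N u) (Omega_tilde N v)"
    using partition_on_Omega_tilde[OF assms(1)] partition_on_Omega_tilde[OF assms(2)]
    unfolding refines_def by (simp add: Omega_tilde_eq[OF assms(1)] Omega_tilde_eq[OF assms(2)])
qed

lemma evec_comp: assumes "w \<in> G" "w i = j" shows "evec {j} \<circ> w = evec {i}"
proof
  fix k
  have "w k = j \<longleftrightarrow> k = i" "- w k = j \<longleftrightarrow> - k = i"
    using hyper_inj[OF assms(1), of k i] hyper_inj[OF assms(1), of "- k" i] assms(2)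
    by (simp_all add: hyper_odd[OF assms(1)])
  then show "(evec {j} \<circ> w) k = evec {i} k" by (simp add: evec_def)
qed

lemma evec_single_Vec: "i \<in> S \<Longrightarrow> evec {i} \<in> Vec"
  by (rule evec_Vec) (auto simp: signed_set_iff)

lemma evec_uminus: assumes "i \<noteq> 0" shows "evec {- i} = - evec {i}"
  using assms by (auto simp: evec_def fun_eq_iff)

lemma MovI: "x \<in> Vec \<Longrightarrow> (x \<circ> w) - x \<in> Mov w"
  by (simp add: Mov_def)

lemma evec_diff_Mov_orbit:
  assumes "w \<in> G" "i \<in> S" "j \<in> orbit w i" shows "evec {i} - evec {j} \<in> Mov w"
  using assms(3)
proof induction
  case base
  have "evec {w i} \<in> Vec" using assms by (simp add: evec_single_Vec)
  from MovI[OF this, of w] show ?case by (simp only: evec_comp[OF assms(1) refl])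
next
  case (step j)
  have j: "w j \<in> S" using orbit_mem_S[OF assms(1,2) step.hyps] assms(1) by simp
  from MovI[OF evec_single_Vec[OF j], of w] have "evec {j} - evec {w j} \<in> Mov w"
    by (simp only: evec_comp[OF assms(1) refl])
  then have "(evec {i} - evec {j}) + (evec {j} - evec {w j}) \<in> Mov w" using step.IH by (rule Mov_add[rotated])
  moreover have "(evec {i} - evec {j}) + (evec {j} - evec {w j}) = evec {i} - evec {w j}"
    by (rule ext) simp
  ultimately show ?case by (simp only:)
qed

text \<open>Here \<open>- i\<close> is in the orbit of \<open>i\<close>, so \<open>evec {i} - evec {- i} = 2 * evec {i}\<close>
is moved, and 2 is invertible.\<close>
lemma evec_Mov_selfneg: assumes "w \<in> G" "i \<in> S" "selfneg w i" shows "evec {i} \<in> Mov w"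
proof -
  have "evec {i} - evec {- i} \<in> Mov w"
    using assms(3) unfolding selfneg_def by (rule evec_diff_Mov_orbit[OF assms(1,2)])
  then have "0 - (evec {i} - evec {- i}) \<in> Mov w" by (rule Mov_diff[OF Mov_0])
  moreover have "0 - (evec {i} - evec {- i}) = evec {i}"
  proof
    fix k
    have "i \<noteq> 0" using assms(2) by (simp add: signed_set_iff)
    then have "(0 - (evec {i} - evec {- i})) k = - (evec {i} k + evec {i} k)"
      by (simp add: evec_uminus)
    also have "\<dots> = evec {i} k" by (rule minus_unique[OF trit_triple])
    finally show "(0 - (evec {i} - evec {- i})) k = evec {i} k" .
  qed
  ultimately show ?thesis by (simp only:)
qed

lemma evec_diff_Mov:
  assumes "w \<in> G" "i \<in> S" "j \<in> S" "same_block w i j" shows "evec {i} - evec {j} \<in> Mov w"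
  using assms(4) unfolding same_block_def
proof
  assume "j \<in> orbit w i" then show ?thesis by (rule evec_diff_Mov_orbit[OF assms(1,2)])
next
  assume "selfneg w i \<and> selfneg w j"
  then show ?thesis using assms by (intro Mov_diff evec_Mov_selfneg) auto
qed

lemma Vec_decomp: assumes "x \<in> Vec" shows "x k = (\<Sum>i\<in>{1..int N}. x i * evec {i} k)"
proof -
  have "k \<in> {1..int N} \<or> - k \<in> {1..int N} \<or> k \<notin> S" by (auto simp: signed_set_iff)
  then consider "k \<in> {1..int N}" | "- k \<in> {1..int N}" | "k \<notin> S" by blast
  then show ?thesis
  proof cases
    case 1
    have "(\<Sum>i\<in>{1..int N}. x i * evec {i} k) = (\<Sum>i\<in>{1..int N}. if i = k then x k else 0)"
      by (rule sum.cong) (use 1 in \<open>auto simp: evec_def\<close>)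
    then show ?thesis using 1 by simp
  next
    case 2
    have "(\<Sum>i\<in>{1..int N}. x i * evec {i} k) = (\<Sum>i\<in>{1..int N}. if i = - k then - x (- k) else 0)"
      by (rule sum.cong) (use 2 in \<open>auto simp: evec_def\<close>)
    also have "\<dots> = - x (- k)" using 2 by simp
    also have "\<dots> = x k" using assms by (simp add: Vec_def)
    finally show ?thesis by simp
  next
    case 3
    then have "(\<Sum>i\<in>{1..int N}. x i * evec {i} k) = (\<Sum>i\<in>{1..int N}. 0)"
      by (intro sum.cong) (auto simp: evec_def signed_set_iff)
    then show ?thesis using 3 assms by (simp add: Vec_def)
  qed
qed

lemma sum_apply: "(\<Sum>i\<in>I. f i) k = (\<Sum>i\<in>I. f i k)" for f :: "'a \<Rightarrow> int \<Rightarrow> 3"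
  by (induction I rule: infinite_finite_induct) simp_all

text \<open>The moved space of \<open>u\<close> is spanned by the differences \<open>evec {inv u i} - evec {i}\<close>, whose two
indices lie in one block of \<open>u\<close>, hence in one block of \<open>v\<close>.\<close>
lemma Mov_mono:
  assumes "u \<in> G" "v \<in> G" "\<And>i j. i \<in> S \<Longrightarrow> j \<in> S \<Longrightarrow> same_block u i j \<Longrightarrow> same_block v i j"
  shows "Mov u \<subseteq> Mov v"
proof
  fix y assume "y \<in> Mov u"
  then obtain x where x: "x \<in> Vec" "y = (x \<circ> u) - x" by (auto simp: Mov_def)
  have "y = (\<Sum>i\<in>{1..int N}. (\<lambda>k. x i * (evec {inv u i} - evec {i}) k))"
  proof
    fix k
    have e: "evec {i} (u k) = evec {inv u i} k" for i
      using evec_comp[of u "inv u i" i] assms(1) by (simp add: fun_eq_iff)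
    have "y k = (\<Sum>i\<in>{1..int N}. x i * evec {i} (u k)) - (\<Sum>i\<in>{1..int N}. x i * evec {i} k)"
      unfolding x(2) minus_apply comp_apply
      by (rule arg_cong2[where f = "(-)", OF Vec_decomp[OF x(1)] Vec_decomp[OF x(1)]])
    also have "\<dots> = (\<Sum>i\<in>{1..int N}. x i * (evec {inv u i} k - evec {i} k))"
      by (simp add: e right_diff_distrib sum_subtractf)
    also have "\<dots> = (\<Sum>i\<in>{1..int N}. (\<lambda>k. x i * (evec {inv u i} - evec {i}) k)) k"
      by (simp add: sum_apply)
    finally show "y k = (\<Sum>i\<in>{1..int N}. (\<lambda>k. x i * (evec {inv u i} - evec {i}) k)) k" .
  qed
  moreover have "(\<lambda>k. x i * (evec {inv u i} - evec {i}) k) \<in> Mov v" if i: "i \<in> {1..int N}" for i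
  proof -
    have S: "i \<in> S" using i by (auto simp: signed_set_iff)
    then have S': "inv u i \<in> S" using assms(1) by simp
    have "u (inv u i) \<in> orbit u (inv u i)" by (rule orbit.base)
    then have "same_block u (inv u i) i" using assms(1) by (simp add: same_block_def)
    then show ?thesis by (intro Mov_scale evec_diff_Mov[OF assms(2) S' S] assms(3)[OF S' S])
  qed
  ultimately show "y \<in> Mov v" by (simp only: Mov_sum)
qed

text \<open>Below an element without fixed vectors, refinement of partitions is the absolute order. In particular
\<open>Omega_tilde\<close> is injective there, by antisymmetry, so that the poset of partitions
can be replaced by an interval of the group.\<close>
theorem refines_Omega_tilde_iff_le:
  assumes G: "u \<in> G" "v \<in> G" "c \<in> G" and c: "Fix c = {0}" "le u c" "le v c"
  shows "refines S (Omega_tilde N u) (Omega_tilde N v) \<longleftrightarrow> le u v"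
  unfolding refines_Omega_tilde_iff[OF G(1,2)]
proof
  assume a: "\<forall>i\<in>S. \<forall>j\<in>S. same_block u i j \<longrightarrow> same_block v i j"
  show "le u v"
  proof (rule le_of_Mov[OF G c])
    show "Mov u \<subseteq> Mov v" using a by (intro Mov_mono[OF G(1,2)]) blast
    show "Fix v \<subseteq> Fix u"
    proof
      fix x assume x: "x \<in> Fix v"
      have "x (u i) = x i" for i
      proof (cases "i \<in> S")
        case True
        have "same_block u i (u i)" by (simp add: same_block_def orbit.base)
        then have "same_block v i (u i)" using a True G by simp
        then have "\<forall>x\<in>Fix v. x i = x (u i)"
          using same_block_iff_Fix[OF G(2) True, of "u i"] True G by simp
        then have "x i = x (u i)" using x by (rule bspec)
        then show ?thesis by (rule sym)
      next
        case False then show ?thesis using hyper_outside[OF G(1)] by simp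
      qed
      then show "x \<in> Fix u" using x by (simp add: Fix_def fun_eq_iff)
    qed
  qed
next
  assume "le u v"
  then have "Fix v \<subseteq> Fix u" by (rule le_Fix[OF G(1,2)])
  then show "\<forall>i\<in>S. \<forall>j\<in>S. same_block u i j \<longrightarrow> same_block v i j"
    by (simp add: same_block_iff_Fix[OF G(1)] same_block_iff_Fix[OF G(2)] subset_iff)
qed

end

section \<open>Stripping one label from a minimal factorization\<close>

context hyperoctahedral_group
begin

lemma finite_G [simp]: "finite G"
  by (rule finite_subset[OF _ finite_permutations[OF finite_signed_set]]) (auto simp: hyper_permutes)

text \<open>The number of factorizations of \<open>w\<close> into \<open>m\<close> factors whose lengths add up to the length of
\<open>w\<close>: the product of the first \<open>m - 1\<close> of them can be any \<open>u \<le> w\<close>, and then the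
last factor is \<open>inv u \<circ> w\<close>.\<close>
primrec factor_count :: "nat \<Rightarrow> (int \<Rightarrow> int) \<Rightarrow> nat" where
  "factor_count 0 w = (if w = id then 1 else 0)"
| "factor_count (Suc m) w = (\<Sum>u\<in>{u \<in> G. le u w}. factor_count m u)"

text \<open>The reflections that move the label \<open>n\<close> and shorten \<open>w\<close>, each encoded by its value at \<open>n\<close>. The variant
\<open>lowering0\<close> contains the identity as well, encoded by \<open>n\<close>.\<close>
definition lowering :: "int \<Rightarrow> (int \<Rightarrow> int) \<Rightarrow> int set" where
  "lowering n w = {j \<in> S. j \<noteq> n \<and> len (w \<circ> refl_B n j) + 1 = len w}"

definition lowering0 :: "int \<Rightarrow> (int \<Rightarrow> int) \<Rightarrow> int set" where
  "lowering0 n w = {j \<in> S. len (w \<circ> refl_B n j) + len (refl_B n j) = len w}"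

text \<open>Let \<open>zeta\<close> be the operator that sums a function over the lower interval. The operator
\<open>sum_fixing n\<close> is the part of it where the right factor \<open>inv u \<circ> w\<close> fixes \<open>n\<close>, and
\<open>strip n\<close> the part where the right factor is the identity or a reflection moving \<open>n\<close>.\<close>
definition strip :: "int \<Rightarrow> ((int \<Rightarrow> int) \<Rightarrow> nat) \<Rightarrow> (int \<Rightarrow> int) \<Rightarrow> nat" where
  "strip n f w = f w + (\<Sum>j\<in>lowering n w. f (w \<circ> refl_B n j))"

definition sum_fixing :: "int \<Rightarrow> ((int \<Rightarrow> int) \<Rightarrow> nat) \<Rightarrow> (int \<Rightarrow> int) \<Rightarrow> nat" where
  "sum_fixing n f w = (\<Sum>u\<in>{u \<in> G. le u w \<and> u n = w n}. f u)"

lemma finite_lowering [simp]: "finite (lowering n w)" "finite (lowering0 n w)"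
  by (simp_all add: lowering_def lowering0_def)

lemma strip_eq: assumes "n \<in> S" shows "strip n f w = (\<Sum>j\<in>lowering0 n w. f (w \<circ> refl_B n j))"
proof -
  have "lowering0 n w = insert n (lowering n w)"
    using assms len_swap[OF assms] by (auto simp: lowering0_def lowering_def)
  moreover have "n \<notin> lowering n w" by (simp add: lowering_def)
  ultimately show ?thesis by (simp add: strip_def)
qed

lemma swap_comm: "i \<noteq> 0 \<Longrightarrow> j \<noteq> 0 \<Longrightarrow> refl_B i j = refl_B j i"
  by (auto simp: refl_B_def fun_eq_iff)

lemma S_nonzero: "i \<in> S \<Longrightarrow> i \<noteq> 0"
  by (simp add: signed_set_iff)

lemma swap_apply: "refl_B i j i = j" "i \<noteq> 0 \<Longrightarrow> refl_B i j j = i"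
  by (auto simp: refl_B_def)

lemma comp_swap_swap: "i \<in> S \<Longrightarrow> j \<in> S \<Longrightarrow> (w \<circ> refl_B i j) \<circ> refl_B i j = w"
  using swap_comp_self[of i j] by (simp add: comp_assoc)

lemma len_le_swap: assumes "w \<in> G" "i \<in> S" "j \<in> S"
  shows "len w \<le> len (w \<circ> refl_B i j) + len (refl_B i j)"
proof -
  have "len ((w \<circ> refl_B i j) \<circ> refl_B i j) \<le> len (w \<circ> refl_B i j) + len (refl_B i j)"
    using assms by (intro len_comp_le) auto
  then show ?thesis unfolding comp_swap_swap[OF assms(2,3)] .
qed

lemma len_swap_cases: "i \<in> S \<Longrightarrow> j \<in> S \<Longrightarrow> len (refl_B i j) = (if i = j then 0 else 1)"
  using len_swap by simp

lemma le_comp_swap: assumes "w \<in> G" "n \<in> S" "j \<in> lowering0 n w" shows "le (w \<circ> refl_B n j) w"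
proof -
  have j: "j \<in> S" "len (w \<circ> refl_B n j) + len (refl_B n j) = len w" using assms(3) by (auto simp: lowering0_def)
  have "inv (w \<circ> refl_B n j) \<circ> w = refl_B n j"
    using assms j by (simp add: inv_comp_distrib swap_inv comp_assoc)
  then show ?thesis using j(2) by (simp add: le_B_def)
qed

text \<open>Every element is uniquely a product of an element that fixes \<open>n\<close> and of the identity or a reflection
that moves \<open>n\<close>, with lengths adding up. For the right factor \<open>v = inv u \<circ> w\<close> the reflection exchanges
\<open>n\<close> and \<open>inv v n\<close>, and \<open>inv v n = inv w (u n)\<close>.\<close>
lemma zeta_eq_strip_sum_fixing:
  assumes w: "w \<in> G" and n: "n \<in> S"
  shows "(\<Sum>u\<in>{u \<in> G. le u w}. f u) = strip n (sum_fixing n f) w"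
proof -
  let ?s = "\<lambda>j. refl_B n j"
  have fwd: "inv w (u n) \<in> lowering0 n w \<and> le u (w \<circ> ?s (inv w (u n)))" if u: "u \<in> G" "le u w" for u
  proof -
    define j where "j = inv w (u n)"
    define v where "v = inv u \<circ> w"
    have j: "j \<in> S" using u w n by (simp add: j_def)
    have v: "v \<in> G" using u w by (simp add: v_def)
    have vj: "v j = n" using u w by (simp add: v_def j_def)
    have lv: "len v = len (v \<circ> ?s j) + len (?s j)"
    proof (cases "j = n")
      case False
      then have vn: "v n \<noteq> n" using hyper_inj[OF v, of n j] vj by auto
      have "v \<circ> ?s j = refl_B n (v n) \<circ> v"
        using swap_conj[OF v, of j n] swap_comm[of n j] vj n j by (simp add: S_nonzero)
      then show ?thesis using len_carter[OF v n vn] len_swap[OF n j] False by simp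
    qed simp
    have eq: "inv u \<circ> (w \<circ> ?s j) = v \<circ> ?s j" by (simp add: v_def comp_assoc)
    have wG: "w \<circ> ?s j \<in> G" using w n j by simp
    have "u \<circ> (v \<circ> ?s j) = w \<circ> ?s j" using u by (simp add: v_def comp_assoc)
    then have "len (w \<circ> ?s j) \<le> len u + len (v \<circ> ?s j)"
      using len_comp_le[of u "v \<circ> ?s j"] u v n j by simp
    moreover have "len w = len u + len v" using u by (simp add: v_def le_B_def)
    moreover have "len w \<le> len (w \<circ> ?s j) + len (?s j)" by (rule len_le_swap[OF w n j])
    ultimately have "len (w \<circ> ?s j) + len (?s j) = len w" "len (w \<circ> ?s j) = len u + len (v \<circ> ?s j)"
      using lv by linarith+
    then show ?thesis using j eq unfolding j_def[symmetric] by (simp add: lowering0_def le_B_def)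
  qed
  have "(\<Sum>u\<in>{u \<in> G. le u w}. f u) =
    (\<Sum>(j, u)\<in>(SIGMA j:lowering0 n w. {u \<in> G. le u (w \<circ> ?s j) \<and> u n = (w \<circ> ?s j) n}). f u)"
  proof (rule sum.reindex_bij_witness[of _ snd "\<lambda>u. (inv w (u n), u)"], goal_cases)
    case (1 u) then show ?case by simp
  next
    case (2 u)
    then show ?case using fwd[of u] w by (simp add: swap_apply)
  next
    case (3 a)
    then show ?case using w by (cases a) (auto simp: swap_apply)
  next
    case (4 a)
    then obtain j u where a: "a = (j, u)" "j \<in> lowering0 n w" "u \<in> G" "le u (w \<circ> ?s j)" by (cases a) auto
    have "j \<in> S" using a by (simp add: lowering0_def)
    then have "le u w" using le_trans[OF a(3) _ w a(4) le_comp_swap[OF w n a(2)]] w n by simp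
    then show ?case using a by simp
  qed simp
  also have "\<dots> = (\<Sum>j\<in>lowering0 n w. sum_fixing n f (w \<circ> ?s j))"
    unfolding sum_fixing_def by (subst sum.Sigma) auto
  finally show ?thesis by (simp add: strip_eq[OF n])
qed

text \<open>Conjugation by an element that fixes \<open>n\<close> permutes the reflections moving \<open>n\<close>, so the two kinds of
factors can exchange their places. In the bijection \<open>v\<close> is the factor that fixes \<open>n\<close>, and the
reflection given by \<open>i\<close> on its right corresponds to the one given by \<open>v i\<close> on its left.\<close>
lemma sum_fixing_strip_commute:
  assumes w: "w \<in> G" and n: "n \<in> S"
  shows "sum_fixing n (strip n f) w = strip n (sum_fixing n f) w"
proof -
  let ?s = "\<lambda>j. refl_B n j"
  let ?X = "SIGMA x:{x \<in> G. le x w \<and> x n = w n}. lowering0 n x"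
  let ?Y = "SIGMA j:lowering0 n w. {u \<in> G. le u (w \<circ> ?s j) \<and> u n = (w \<circ> ?s j) n}"
  have fwd: "inv w (x j) \<in> lowering0 n w \<and> x \<circ> ?s j \<in> G \<and> le (x \<circ> ?s j) (w \<circ> ?s (inv w (x j)))
      \<and> (x \<circ> ?s j) n = (w \<circ> ?s (inv w (x j))) n \<and> inv (x \<circ> ?s j) (w n) = j \<and> (x \<circ> ?s j) \<circ> ?s j = x"
    if x: "x \<in> G" "le x w" "x n = w n" and j: "j \<in> lowering0 n x" for x j
  proof -
    define v where "v = inv x \<circ> w"
    define i where "i = inv w (x j)"
    have jS: "j \<in> S" and lx: "len (x \<circ> ?s j) + len (?s j) = len x" using j by (auto simp: lowering0_def)
    have v: "v \<in> G" using x w by (simp add: v_def)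
    have vn: "v n = n" using x by (simp add: v_def flip: x(3))
    have vi: "v i = j" using x w by (simp add: v_def i_def)
    have iS: "i \<in> S" using w x jS by (simp add: i_def)
    have in_iff: "i = n \<longleftrightarrow> j = n" using hyper_inj[OF v, of i n] vn vi by simp
    have ls: "len (?s i) = len (?s j)" using in_iff len_swap_cases[OF n iS] len_swap_cases[OF n jS] by auto
    have "v \<circ> ?s i = ?s j \<circ> v" using swap_conj[OF v, of n i] n iS vn vi by (simp add: S_nonzero)
    then have "x \<circ> (v \<circ> ?s i) = x \<circ> (?s j \<circ> v)" by (rule arg_cong)
    then have ws: "w \<circ> ?s i = (x \<circ> ?s j) \<circ> v" using x by (simp add: v_def comp_assoc)
    have xs: "x \<circ> ?s j \<in> G" using x n jS by simp
    have inv: "inv (x \<circ> ?s j) \<circ> (w \<circ> ?s i) = v" unfolding ws using xs by simp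
    have "len w = len x + len v" using x(2) by (simp add: v_def le_B_def)
    moreover have "len (w \<circ> ?s i) \<le> len (x \<circ> ?s j) + len v" unfolding ws by (rule len_comp_le[OF xs v])
    moreover have "len w \<le> len (w \<circ> ?s i) + len (?s i)" by (rule len_le_swap[OF w n iS])
    ultimately have "len (w \<circ> ?s i) + len (?s i) = len w" "len (w \<circ> ?s i) = len (x \<circ> ?s j) + len v"
      using lx ls by linarith+
    then have A: "i \<in> lowering0 n w" "le (x \<circ> ?s j) (w \<circ> ?s i)" using iS inv by (simp_all add: lowering0_def le_B_def)
    have B: "(x \<circ> ?s j) n = (w \<circ> ?s i) n" using w by (simp add: swap_apply i_def)
    have C: "inv (x \<circ> ?s j) (w n) = j"
      using x(1) n jS by (simp add: inv_comp_distrib swap_inv swap_apply flip: x(3))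
    have D: "(x \<circ> ?s j) \<circ> ?s j = x" by (rule comp_swap_swap[OF n jS])
    show ?thesis using A B C D xs unfolding i_def by blast
  qed
  have bwd: "u \<circ> ?s (inv u (w n)) \<in> G \<and> le (u \<circ> ?s (inv u (w n))) w
      \<and> (u \<circ> ?s (inv u (w n))) n = w n \<and> inv u (w n) \<in> lowering0 n (u \<circ> ?s (inv u (w n)))
      \<and> inv w ((u \<circ> ?s (inv u (w n))) (inv u (w n))) = i \<and> (u \<circ> ?s (inv u (w n))) \<circ> ?s (inv u (w n)) = u"
    if i: "i \<in> lowering0 n w" and u: "u \<in> G" "le u (w \<circ> ?s i)" "u n = (w \<circ> ?s i) n" for i u
  proof -
    define j where "j = inv u (w n)"
    define v where "v = inv u \<circ> (w \<circ> ?s i)"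
    have iS: "i \<in> S" and lw: "len (w \<circ> ?s i) + len (?s i) = len w" using i by (auto simp: lowering0_def)
    have jS: "j \<in> S" using u w n by (simp add: j_def)
    have v: "v \<in> G" using u w n iS by (simp add: v_def)
    have un: "u n = w i" using u(3) by (simp add: swap_apply)
    have vn: "v n = n" using u(1) by (simp add: v_def swap_apply flip: un)
    have vi: "v i = j" using n by (simp add: v_def swap_apply j_def S_nonzero)
    have in_iff: "i = n \<longleftrightarrow> j = n" using hyper_inj[OF v, of i n] vn vi by simp
    have ls: "len (?s i) = len (?s j)" using in_iff len_swap_cases[OF n iS] len_swap_cases[OF n jS] by auto
    have us: "u \<circ> ?s j \<in> G" using u n jS by simp
    have "v \<circ> ?s i = ?s j \<circ> v" using swap_conj[OF v, of n i] n iS vn vi by (simp add: S_nonzero)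
    then have "u \<circ> (v \<circ> ?s i) = u \<circ> (?s j \<circ> v)" by (rule arg_cong)
    moreover have "u \<circ> (v \<circ> ?s i) = w"
      using u(1) comp_swap_swap[OF n iS, of w] by (simp add: v_def flip: comp_assoc)
    ultimately have weq: "w = (u \<circ> ?s j) \<circ> v" by (simp add: comp_assoc)
    have inv: "inv (u \<circ> ?s j) \<circ> w = v" using us by (subst weq) simp
    have "len (w \<circ> ?s i) = len u + len v" using u(2) by (simp add: v_def le_B_def)
    moreover have "len w \<le> len (u \<circ> ?s j) + len v" using len_comp_le[OF us v] weq by simp
    moreover have "len (u \<circ> ?s j) \<le> len u + len (?s j)" using u n jS by (intro len_comp_le) auto
    ultimately have l: "len w = len (u \<circ> ?s j) + len v" "len (u \<circ> ?s j) = len u + len (?s j)"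
      using lw ls by linarith+
    have A: "le (u \<circ> ?s j) w" using l inv by (simp add: le_B_def)
    have D: "(u \<circ> ?s j) \<circ> ?s j = u" by (rule comp_swap_swap[OF n jS])
    have B: "j \<in> lowering0 n (u \<circ> ?s j)" using l(2) jS D by (simp add: lowering0_def)
    have C: "(u \<circ> ?s j) n = w n" using u by (simp add: swap_apply j_def)
    have F: "inv w ((u \<circ> ?s j) j) = i" using n w by (simp add: swap_apply S_nonzero un)
    show ?thesis using A B C D F us unfolding j_def by blast
  qed
  have "sum_fixing n (strip n f) w = (\<Sum>(x, j)\<in>?X. f (x \<circ> ?s j))"
    unfolding sum_fixing_def strip_eq[OF n] by (subst sum.Sigma) auto
  also have "\<dots> = (\<Sum>(j, u)\<in>?Y. f u)"
  proof (rule sum.reindex_bij_witness[of _ "\<lambda>(i, u). (u \<circ> ?s (inv u (w n)), inv u (w n))"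
        "\<lambda>(x, j). (inv w (x j), x \<circ> ?s j)"], goal_cases)
    case (1 a)
    then obtain x j where a: "a = (x, j)" "x \<in> G" "le x w" "x n = w n" "j \<in> lowering0 n x" by (cases a) auto
    show ?case using fwd[OF a(2-5)] by (simp add: a(1))
  next
    case (2 a)
    then obtain x j where a: "a = (x, j)" "x \<in> G" "le x w" "x n = w n" "j \<in> lowering0 n x" by (cases a) auto
    show ?case using fwd[OF a(2-5)] by (simp add: a(1))
  next
    case (3 a)
    then obtain i u where a: "a = (i, u)" "i \<in> lowering0 n w" "u \<in> G" "le u (w \<circ> ?s i)" "u n = (w \<circ> ?s i) n" by (cases a) auto
    show ?case using bwd[OF a(2-5)] by (simp add: a(1))
  next
    case (4 a)
    then obtain i u where a: "a = (i, u)" "i \<in> lowering0 n w" "u \<in> G" "le u (w \<circ> ?s i)" "u n = (w \<circ> ?s i) n" by (cases a) auto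
    show ?case using bwd[OF a(2-5)] by (simp add: a(1))
  next
    case (5 a) then show ?case by (cases a) simp
  qed
  also have "\<dots> = strip n (sum_fixing n f) w"
    unfolding strip_eq[OF n] sum_fixing_def by (subst sum.Sigma) auto
  finally show ?thesis .
qed

definition fixing_count :: "int \<Rightarrow> nat \<Rightarrow> (int \<Rightarrow> int) \<Rightarrow> nat" where
  "fixing_count n m w = (if w n = n then factor_count m w else 0)"

lemma le_fixes: assumes "u \<in> G" "w \<in> G" "le u w" "n \<in> S" "w n = n" shows "u n = n"
proof -
  have "evec {n} \<in> Fix w"
    by (rule evec_Fix) (use assms in \<open>auto simp: signed_set_iff\<close>)
  then have "evec {n} \<in> Fix u" using le_Fix[OF assms(1-3)] by blast
  then have "evec {n} (u n) = evec {n} n" by (simp add: Fix_def fun_eq_iff)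
  then have "evec {n} (u n) = 1" by (simp add: evec_def)
  then show ?thesis using trit_one by (cases "u n = n") (auto simp: evec_def split: if_splits)
qed

lemma sum_fixing_fixing_count:
  assumes "w \<in> G" "n \<in> S" shows "sum_fixing n (fixing_count n m) w = fixing_count n (Suc m) w"
proof (cases "w n = n")
  case True
  have "{u \<in> G. le u w \<and> u n = w n} = {u \<in> G. le u w}" using le_fixes assms True by auto
  moreover have "(\<Sum>u\<in>{u \<in> G. le u w}. fixing_count n m u) = (\<Sum>u\<in>{u \<in> G. le u w}. factor_count m u)"
    using le_fixes assms True by (intro sum.cong refl) (simp add: fixing_count_def)
  ultimately show ?thesis using True by (simp add: sum_fixing_def fixing_count_def)
next
  case False
  then show ?thesis by (simp add: sum_fixing_def fixing_count_def)
qed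

lemma strip_cong: assumes "w \<in> G" "n \<in> S" "\<And>w. w \<in> G \<Longrightarrow> f w = g w" shows "strip n f w = strip n g w"
proof -
  have "f (w \<circ> refl_B n j) = g (w \<circ> refl_B n j)" if "j \<in> lowering n w" for j
    using that assms by (intro assms(3)) (simp add: lowering_def)
  then show ?thesis using assms by (simp add: strip_def)
qed

lemma sum_fixing_cong: "(\<And>w. w \<in> G \<Longrightarrow> f w = g w) \<Longrightarrow> sum_fixing n f w = sum_fixing n g w"
  unfolding sum_fixing_def by (intro sum.cong refl) auto

lemma sum_fixing_strip_power:
  "w \<in> G \<Longrightarrow> n \<in> S \<Longrightarrow> sum_fixing n ((strip n ^^ k) f) w = (strip n ^^ k) (sum_fixing n f) w"
proof (induction k arbitrary: w)
  case (Suc k)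
  have "sum_fixing n ((strip n ^^ Suc k) f) w = strip n (sum_fixing n ((strip n ^^ k) f)) w"
    using sum_fixing_strip_commute[OF Suc.prems] by simp
  also have "\<dots> = strip n ((strip n ^^ k) (sum_fixing n f)) w"
    by (rule strip_cong) (use Suc in auto)
  finally show ?case by simp
qed simp

lemma strip_power_cong:
  "w \<in> G \<Longrightarrow> n \<in> S \<Longrightarrow> (\<And>w. w \<in> G \<Longrightarrow> f w = g w) \<Longrightarrow> (strip n ^^ k) f w = (strip n ^^ k) g w"
proof (induction k arbitrary: w)
  case (Suc k)
  show ?case using strip_cong[of w n "(strip n ^^ k) f" "(strip n ^^ k) g"] Suc by simp
qed simp

text \<open>After all factors that fix \<open>n\<close> have been collected on the left, a minimal factorization into
\<open>m\<close> factors becomes one of an element fixing \<open>n\<close>, followed by \<open>m\<close> factors each of which is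
the identity or a reflection that moves \<open>n\<close>. Undoing the latter one after the other strips the
label \<open>n\<close> from \<open>w\<close>.\<close>
theorem factor_count_eq_strip:
  "w \<in> G \<Longrightarrow> n \<in> S \<Longrightarrow> factor_count m w = (strip n ^^ m) (fixing_count n m) w"
proof (induction m arbitrary: w)
  case 0 then show ?case by (simp add: fixing_count_def)
next
  case (Suc m)
  have "factor_count (Suc m) w = strip n (sum_fixing n (factor_count m)) w"
    using zeta_eq_strip_sum_fixing[OF Suc.prems] by simp
  also have "\<dots> = strip n ((strip n ^^ m) (fixing_count n (Suc m))) w"
  proof (rule strip_cong[OF Suc.prems])
    fix w assume w: "w \<in> G"
    have "sum_fixing n (factor_count m) w = sum_fixing n ((strip n ^^ m) (fixing_count n m)) w"
      by (rule sum_fixing_cong) (rule Suc.IH[OF _ Suc.prems(2)])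
    also have "\<dots> = (strip n ^^ m) (sum_fixing n (fixing_count n m)) w"
      by (rule sum_fixing_strip_power[OF w Suc.prems(2)])
    also have "\<dots> = (strip n ^^ m) (fixing_count n (Suc m)) w"
      by (rule strip_power_cong[OF w Suc.prems(2)]) (rule sum_fixing_fixing_count[OF _ Suc.prems(2)])
    finally show "sum_fixing n (factor_count m) w = (strip n ^^ m) (fixing_count n (Suc m)) w" .
  qed
  finally show ?case by simp
qed

end

section \<open>Cycle decompositions under reflections\<close>

text \<open>The map \<open>w\<close> sends each entry of the list to the next one, and the last entry to \<open>y\<close>.\<close>
fun cpath :: "(int \<Rightarrow> int) \<Rightarrow> int list \<Rightarrow> int \<Rightarrow> bool" where
  "cpath w [] y \<longleftrightarrow> True"
| "cpath w (a # xs) y \<longleftrightarrow> w a = hd (xs @ [y]) \<and> cpath w xs y"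

lemma cpath_append: "cpath w (xs @ ys) y \<longleftrightarrow> cpath w xs (hd (ys @ [y])) \<and> cpath w ys y"
proof (induction xs)
  case (Cons a xs)
  have "hd ((xs @ ys) @ [y]) = hd (xs @ [hd (ys @ [y])])" by (cases xs) auto
  then show ?case using Cons by auto
qed simp

lemma cpath_cong: "(\<And>a. a \<in> set xs \<Longrightarrow> w a = v a) \<Longrightarrow> cpath w xs y = cpath v xs y"
  by (induction xs) auto

lemma cpath_image: "cpath w xs y \<Longrightarrow> a \<in> set xs \<Longrightarrow> w a \<in> insert y (set xs)"
proof (induction xs)
  case (Cons b xs)
  have "hd (xs @ [y]) \<in> insert y (set xs)" by (cases xs) auto
  then show ?case using Cons by auto
qed simp

context hyperoctahedral_group
begin

lemma cpath_uminus: assumes "w \<in> G" shows "cpath w (map uminus xs) (- y) \<longleftrightarrow> cpath w xs y"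
proof (induction xs)
  case (Cons a xs)
  have "hd (map uminus xs @ [- y]) = - hd (xs @ [y])" by (cases xs) auto
  then show ?case using Cons by (simp add: hyper_odd[OF assms])
qed simp

lemma cpath_Fix: assumes "x \<in> Fix w" shows "cpath w xs y \<Longrightarrow> a \<in> set xs \<Longrightarrow> x a = x y"
proof (induction xs arbitrary: a)
  case (Cons b xs)
  have xb: "x b = x (w b)" using assms by (simp add: Fix_def fun_eq_iff)
  have "x (hd (xs @ [y])) = x y" using Cons.IH[of "hd xs"] Cons.prems(1) by (cases xs) auto
  then have "x b = x y" using xb Cons.prems(1) by simp
  then show ?case using Cons by auto
qed simp

text \<open>Lists of representatives for the cycles of \<open>w\<close>: those in \<open>P\<close> close up at their first element
(positive cycles, standing for a pair of orbits), those in \<open>Q\<close> at its negative (the first half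
of an invariant orbit). Labels outside the lists are fixed. Working with lists rather than orbits
makes the effect of a reflection a cut or a concatenation of lists.\<close>
definition cycles :: "(int \<Rightarrow> int) \<Rightarrow> int list list \<Rightarrow> int list list \<Rightarrow> bool" where
  "cycles w P Q \<longleftrightarrow> w \<in> G
    \<and> (\<forall>c\<in>set P. c \<noteq> [] \<and> cpath w c (hd c)) \<and> (\<forall>c\<in>set Q. c \<noteq> [] \<and> cpath w c (- hd c))
    \<and> distinct (map abs (concat P @ concat Q)) \<and> set (concat P @ concat Q) \<subseteq> S
    \<and> (\<forall>i\<in>S. \<bar>i\<bar> \<notin> abs ` set (concat P @ concat Q) \<longrightarrow> w i = i)"

lemma cycles_hyper: "cycles w P Q \<Longrightarrow> w \<in> G" by (simp add: cycles_def)

lemma cycles_posD: "cycles w P Q \<Longrightarrow> c \<in> set P \<Longrightarrow> cpath w c (hd c)"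
  unfolding cycles_def by blast

lemma cycles_negD: "cycles w P Q \<Longrightarrow> c \<in> set Q \<Longrightarrow> cpath w c (- hd c)"
  unfolding cycles_def by blast

lemma cycles_nonempty: "cycles w P Q \<Longrightarrow> c \<in> set P \<or> c \<in> set Q \<Longrightarrow> c \<noteq> []"
  unfolding cycles_def by blast

lemma cycles_pos_evec: assumes "cycles w P Q" "c \<in> set P" shows "evec (set c) \<in> Fix w"
proof (rule evec_Fix)
  have c: "c \<noteq> []" "cpath w c (hd c)" using assms by (auto simp: cycles_def)
  obtain P1 P2 where P: "P = P1 @ c # P2" using assms(2) by (auto simp: in_set_conv_decomp)
  have d: "distinct (map abs c)" and sub: "set c \<subseteq> S"
    using assms(1) by (auto simp: cycles_def P)
  show "w \<in> G" by (rule cycles_hyper[OF assms(1)])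
  show "set c \<subseteq> S" by (rule sub)
  have "insert (hd c) (set c) = set c" using hd_in_set[OF c(1)] by blast
  then show "w ` set c \<subseteq> set c" using cpath_image[OF c(2)] by (simp add: image_subset_iff)
  show "set c \<inter> uminus ` set c = {}"
  proof (rule ccontr)
    assume "set c \<inter> uminus ` set c \<noteq> {}"
    then obtain a where a: "a \<in> set c" "- a \<in> set c" by auto
    have "inj_on abs (set c)" using d by (simp add: distinct_map)
    then have "a = - a" using a by (intro inj_onD[of abs "set c" a "- a"]) auto
    then show False using a sub by (auto simp: signed_set_iff)
  qed
qed

lemma cycles_neg_zero: assumes "cycles w P Q" "c \<in> set Q" "a \<in> set c" "x \<in> Fix w" shows "x a = 0"
proof -
  have c: "c \<noteq> []" "cpath w c (- hd c)" using assms by (auto simp: cycles_def)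
  have "x (hd c) = x (- hd c)" by (rule cpath_Fix[OF assms(4) c(2) hd_in_set[OF c(1)]])
  moreover have neg: "x (- hd c) = - x (hd c)" using assms(4) by (simp add: Fix_def Vec_def)
  ultimately have "x (hd c) = - x (hd c)" by (simp only:)
  then have "x (hd c) + x (hd c) = - x (hd c) + x (hd c)" by (rule arg_cong)
  then have "x (hd c) = 0" using trit_double_eq_0 by (simp only: left_minus)
  moreover have "x a = x (- hd c)" by (rule cpath_Fix[OF assms(4) c(2) assms(3)])
  ultimately show ?thesis using neg by (simp only: neg_0_equal_iff_equal minus_zero)
qed

text \<open>A reflection shortens \<open>w\<close> if it respects the fixed vectors of \<open>w\<close> and the product has a new one.\<close>
lemma loweringI:
  assumes w: "w \<in> G" and n: "n \<in> S" and j: "j \<in> S" "j \<noteq> n"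
    and fix_eq: "\<And>x. x \<in> Fix w \<Longrightarrow> x n = x j"
    and y: "y \<in> Fix (w \<circ> refl_B n j)" "y \<notin> Fix w"
  shows "j \<in> lowering n w"
proof -
  let ?v = "w \<circ> refl_B n j"
  have v: "?v \<in> G" using w n j by simp
  have sub: "Fix w \<subseteq> Fix ?v"
  proof
    fix x assume x: "x \<in> Fix w"
    have "x \<in> Fix (refl_B n j)"
      using fix_eq[OF x] Fix_subset[of w] x by (auto simp: Fix_swap[OF n j(1)])
    then show "x \<in> Fix ?v" using x by (auto simp: Fix_def simp flip: comp_assoc)
  qed
  have "len w = len ?v + 1"
  proof (rule len_Suc_I[OF w v])
    have "?v = refl_B (w n) (w j) \<circ> w" using n j by (intro swap_conj[OF w] S_nonzero)
    then show "w = refl_B (w n) (w j) \<circ> ?v"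
      using swap_comp_self[of "w n" "w j"] w n j by (simp flip: comp_assoc)
    show "3 * card (Fix w) \<le> card (Fix ?v)" by (rule card_Fix_step[OF sub y])
  qed (use w n j in auto)
  then show ?thesis using j by (simp add: lowering_def)
qed

lemma lowering_Fix:
  assumes w: "w \<in> G" and n: "n \<in> S" and j: "j \<in> lowering n w" and x: "x \<in> Fix w"
  shows "x n = x j"
proof -
  have jS: "j \<in> S" and jn: "j \<noteq> n" and l: "len (w \<circ> refl_B n j) + 1 = len w" using j by (auto simp: lowering_def)
  have "j \<in> lowering0 n w" using jS l len_swap[OF n jS] jn by (simp add: lowering0_def)
  then have "le (w \<circ> refl_B n j) w" by (rule le_comp_swap[OF w n])
  then have "x \<in> Fix (w \<circ> refl_B n j)" using le_Fix[of "w \<circ> refl_B n j" w] w n jS x by auto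
  then have "(x \<circ> w) \<circ> refl_B n j = x" by (simp add: Fix_def comp_assoc)
  moreover have "x \<circ> w = x" using x by (simp add: Fix_def)
  ultimately have "x \<circ> refl_B n j = x" by (simp only:)
  then have "x (refl_B n j n) = x n" by (metis comp_apply)
  then show ?thesis by (simp add: swap_apply)
qed

lemma comp_swap_apply:
  "w \<in> G \<Longrightarrow> n \<noteq> 0 \<Longrightarrow> (w \<circ> refl_B n j) n = w j"
  "w \<in> G \<Longrightarrow> n \<noteq> 0 \<Longrightarrow> (w \<circ> refl_B n j) j = w n"
  "w \<in> G \<Longrightarrow> \<bar>a\<bar> \<noteq> \<bar>n\<bar> \<Longrightarrow> \<bar>a\<bar> \<noteq> \<bar>j\<bar> \<Longrightarrow> (w \<circ> refl_B n j) a = w a"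
  by (auto simp: refl_B_def)

lemma cpath_split: "cpath w (n # pre @ j # post) y \<longleftrightarrow>
   w n = hd (pre @ [j]) \<and> cpath w pre j \<and> w j = hd (post @ [y]) \<and> cpath w post y"
  using cpath_append[of w "n # pre" "j # post" y]
  by (simp only: append_Cons cpath.simps list.sel(1) conj_assoc)

declare cpath.simps [simp del]

lemma abs_image_uminus: "abs ` set (map uminus xs) = abs ` set xs" for xs :: "int list"
  by (simp add: image_image)

lemma cpath_comp_swap:
  assumes "w \<in> G" "\<bar>n\<bar> \<notin> abs ` set c" "\<bar>j\<bar> \<notin> abs ` set c"
  shows "cpath (w \<circ> refl_B n j) c y = cpath w c y"
proof (rule cpath_cong)
  fix a assume "a \<in> set c"
  then have "\<bar>a\<bar> \<in> abs ` set c" by (rule imageI)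
  then have "\<bar>a\<bar> \<noteq> \<bar>n\<bar>" "\<bar>a\<bar> \<noteq> \<bar>j\<bar>" using assms(2,3) by metis+
  then show "(w \<circ> refl_B n j) a = w a" by (rule comp_swap_apply(3)[OF assms(1)])
qed

lemma cycles_distinct: "cycles w P Q \<Longrightarrow> distinct (map abs (concat P @ concat Q))"
  by (simp add: cycles_def)

lemma cycles_distinct_head:
  "cycles w (b # P) Q \<Longrightarrow> distinct (map abs b)"
  "cycles w P (b # Q) \<Longrightarrow> distinct (map abs b)"
  "cycles w P (b # d # Q) \<Longrightarrow> distinct (map abs (b @ d))"
proof (goal_cases)
  case 1
  then show ?case using cycles_distinct[OF 1(1)] by (simp only: concat.simps map_append distinct_append)
next
  case 2
  then show ?case using cycles_distinct[OF 2(1)] by (simp only: concat.simps map_append distinct_append)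
next
  case 3
  have "distinct (map abs (concat P) @ (map abs (b @ d)) @ map abs (concat Q))" using cycles_distinct[OF 3(1)] by simp
  then show ?case unfolding distinct_append by blast
qed

lemma cycles_nonzero: assumes "cycles w P Q" "a \<in> set (concat P @ concat Q)" shows "a \<noteq> 0" "a \<in> S"
proof -
  show "a \<in> S" using assms unfolding cycles_def by blast
  then show "a \<noteq> 0" by (rule S_nonzero)
qed

lemma signed_subset_abs: assumes "abs ` A = abs ` B" "B \<subseteq> S" shows "A \<subseteq> S"
proof
  fix a assume "a \<in> A"
  then have "\<bar>a\<bar> \<in> abs ` B" using assms(1) by blast
  then obtain b where "b \<in> B" "\<bar>a\<bar> = \<bar>b\<bar>" by auto
  then show "a \<in> S" using assms(2) by (force simp: signed_set_iff)
qed

lemma abs_notin_others: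
  fixes a :: int
  assumes "distinct (map abs (xs @ concat Z))" "a \<in> set xs" "c \<in> set Z"
  shows "\<bar>a\<bar> \<notin> abs ` set c"
proof
  assume "\<bar>a\<bar> \<in> abs ` set c"
  then have "\<bar>a\<bar> \<in> abs ` set (concat Z)" using assms(3) by auto
  moreover have "\<bar>a\<bar> \<in> abs ` set xs" using assms(2) by (rule imageI)
  moreover have "abs ` set xs \<inter> abs ` set (concat Z) = {}"
    using assms(1) unfolding map_append distinct_append set_map by blast
  ultimately show False by blast
qed

text \<open>Multiplication by a reflection only changes the cycles through the two labels exchanged. The lists
\<open>P0\<close> and \<open>Q0\<close> are the cycles that are replaced, \<open>P1\<close> and \<open>Q1\<close> their replacements.\<close>
lemma cycles_swapI:
  assumes w: "cycles w (P0 @ P) (Q0 @ Q)"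
    and n: "n \<in> set (concat P0 @ concat Q0)" "\<bar>j\<bar> \<in> abs ` set (concat P0 @ concat Q0)"
    and m: "mset (map abs (concat P1 @ concat Q1)) = mset (map abs (concat P0 @ concat Q0))"
    and P1: "\<And>c. c \<in> set P1 \<Longrightarrow> c \<noteq> [] \<and> cpath (w \<circ> refl_B n j) c (hd c)"
    and Q1: "\<And>c. c \<in> set Q1 \<Longrightarrow> c \<noteq> [] \<and> cpath (w \<circ> refl_B n j) c (- hd c)"
  shows "cycles (w \<circ> refl_B n j) (P1 @ P) (Q1 @ Q)"
proof -
  let ?v = "w \<circ> refl_B n j"
  let ?L = "concat (P0 @ P) @ concat (Q0 @ Q)" and ?L' = "concat (P1 @ P) @ concat (Q1 @ Q)"
  let ?H = "concat P0 @ concat Q0"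
  have wG: "w \<in> G" using w by (rule cycles_hyper)
  have m': "mset (map abs ?L') = mset (map abs ?L)"
    using m by simp
  have mH: "mset (map abs ?L) = mset (map abs (?H @ concat (P @ Q)))" by simp
  have dist: "distinct (map abs (?H @ concat (P @ Q)))"
    using cycles_distinct[OF w] unfolding mset_eq_imp_distinct_iff[OF mH] .
  have sub: "set ?L \<subseteq> S" using w unfolding cycles_def by blast
  have nL: "n \<in> set ?L" using n(1) by auto
  have jL: "\<bar>j\<bar> \<in> abs ` set ?L" using n(2) by (rule rev_subsetD) (rule image_mono, auto)
  have nS: "n \<in> S" using nL sub by blast
  obtain k where k: "k \<in> set ?H" "\<bar>j\<bar> = \<bar>k\<bar>" using n(2) by (rule imageE)
  then have "k \<in> S" using sub by auto
  then have jS: "j \<in> S" using k(2) by (force simp: signed_set_iff)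
  have eqset: "abs ` set ?L' = abs ` set ?L"
    using mset_eq_setD[OF m'] by (simp only: set_map)
  have cong: "cpath ?v c y = cpath w c y" if "c \<in> set P \<or> c \<in> set Q" for c y
  proof (rule cpath_comp_swap[OF wG])
    have c: "c \<in> set (P @ Q)" using that by simp
    show "\<bar>n\<bar> \<notin> abs ` set c" by (rule abs_notin_others[OF dist n(1) c])
    show "\<bar>j\<bar> \<notin> abs ` set c" unfolding k(2) by (rule abs_notin_others[OF dist k(1) c])
  qed
  show ?thesis unfolding cycles_def
  proof (intro conjI)
    show "?v \<in> G" using wG nS jS by simp
    show "\<forall>c\<in>set (P1 @ P). c \<noteq> [] \<and> cpath ?v c (hd c)"
    proof
      fix c assume "c \<in> set (P1 @ P)"
      then have "c \<in> set P1 \<or> c \<in> set P" by simp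
      then show "c \<noteq> [] \<and> cpath ?v c (hd c)"
      proof
        assume c: "c \<in> set P"
        then have c': "c \<in> set (P0 @ P)" by simp
        then have "c \<noteq> []" by (intro cycles_nonempty[OF w] disjI1)
        then show ?thesis using cycles_posD[OF w c'] cong[OF disjI1[OF c]] by simp
      qed (rule P1)
    qed
    show "\<forall>c\<in>set (Q1 @ Q). c \<noteq> [] \<and> cpath ?v c (- hd c)"
    proof
      fix c assume "c \<in> set (Q1 @ Q)"
      then have "c \<in> set Q1 \<or> c \<in> set Q" by simp
      then show "c \<noteq> [] \<and> cpath ?v c (- hd c)"
      proof
        assume c: "c \<in> set Q"
        then have c': "c \<in> set (Q0 @ Q)" by simp
        then have "c \<noteq> []" by (intro cycles_nonempty[OF w] disjI2)
        then show ?thesis using cycles_negD[OF w c'] cong[OF disjI2[OF c]] by simp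
      qed (rule Q1)
    qed
    show "distinct (map abs ?L')"
      using cycles_distinct[OF w] unfolding mset_eq_imp_distinct_iff[OF m'] .
    show "set ?L' \<subseteq> S" by (rule signed_subset_abs[OF eqset sub])
    show "\<forall>i\<in>S. \<bar>i\<bar> \<notin> abs ` set ?L' \<longrightarrow> ?v i = i" unfolding eqset
    proof (intro ballI impI)
      fix i assume i: "i \<in> S" "\<bar>i\<bar> \<notin> abs ` set ?L"
      have "\<bar>n\<bar> \<in> abs ` set ?L" using nL by (rule imageI)
      then have "\<bar>i\<bar> \<noteq> \<bar>n\<bar>" "\<bar>i\<bar> \<noteq> \<bar>j\<bar>" using i(2) jL by metis+
      then have "?v i = w i" by (rule comp_swap_apply(3)[OF wG])
      also have "w i = i" using w i unfolding cycles_def by blast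
      finally show "?v i = i" .
    qed
  qed
qed

text \<open>What the reflections that move \<open>n\<close> do to the cycle through \<open>n\<close>: within a positive cycle
they split off a positive cycle.\<close>
lemma cycles_split_pos:
  assumes "cycles w ((n # pre @ j # post) # P) Q"
  shows "cycles (w \<circ> refl_B n j) ((n # post) # (pre @ [j]) # P) Q"
proof -
  have w: "w \<in> G" by (rule cycles_hyper[OF assms])
  have path: "w n = hd (pre @ [j])" "cpath w pre j" "w j = hd (post @ [n])" "cpath w post n"
    using cycles_posD[OF assms list.set_intros(1)] unfolding list.sel cpath_split by blast+
  have n0: "n \<noteq> 0" using cycles_nonzero(1)[OF assms, of n] by simp
  have d: "\<bar>n\<bar> \<notin> abs ` set pre" "\<bar>n\<bar> \<notin> abs ` set post" "\<bar>j\<bar> \<notin> abs ` set pre" "\<bar>j\<bar> \<notin> abs ` set post"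
    using cycles_distinct_head(1)[OF assms] by simp_all
  let ?v = "w \<circ> refl_B n j"
  have v: "?v n = w j" "?v j = w n" by (rule comp_swap_apply(1)[OF w n0], rule comp_swap_apply(2)[OF w n0])
  have 1: "cpath ?v (n # post) n" using path v cpath_comp_swap[OF w d(2,4)] by (simp add: cpath.simps)
  have 2: "cpath ?v (pre @ [j]) (hd (pre @ [j]))"
    using path v cpath_comp_swap[OF w d(1,3)] by (simp add: cpath_append cpath.simps)
  have "cycles ?v ([n # post, pre @ [j]] @ P) ([] @ Q)"
    by (rule cycles_swapI[of w "[n # pre @ j # post]" P "[]" Q]) (use assms 1 2 in auto)
  then show ?thesis by (simp only: append_Cons append_Nil)
qed

text \<open>A negative cycle splits into a positive and a negative one. The sign of the label exchanged with
\<open>n\<close> decides which of the two contains \<open>n\<close>.\<close>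
lemma cycles_split_neg:
  assumes "cycles w P ((n # pre @ j # post) # Q)"
  shows "cycles (w \<circ> refl_B n j) ((pre @ [j]) # P) ((n # post) # Q)"
    and "cycles (w \<circ> refl_B n (- j)) ((n # map uminus post) # P) ((pre @ [j]) # Q)"
proof -
  have w: "w \<in> G" by (rule cycles_hyper[OF assms])
  have path: "w n = hd (pre @ [j])" "cpath w pre j" "w j = hd (post @ [- n])" "cpath w post (- n)"
    using cycles_negD[OF assms list.set_intros(1)] unfolding list.sel cpath_split by blast+
  have n0: "n \<noteq> 0" "n \<in> S" "j \<in> S"
    using cycles_nonzero[OF assms, of n] cycles_nonzero[OF assms, of j] by auto
  have d: "\<bar>n\<bar> \<notin> abs ` set pre" "\<bar>n\<bar> \<notin> abs ` set post" "\<bar>j\<bar> \<notin> abs ` set pre" "\<bar>j\<bar> \<notin> abs ` set post"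
    using cycles_distinct_head(2)[OF assms] by simp_all
  {
    let ?v = "w \<circ> refl_B n j"
    have v: "?v n = w j" "?v j = w n" by (rule comp_swap_apply(1)[OF w n0(1)], rule comp_swap_apply(2)[OF w n0(1)])
    have 1: "cpath ?v (n # post) (- n)" using path v cpath_comp_swap[OF w d(2,4)] by (simp add: cpath.simps)
    have 2: "cpath ?v (pre @ [j]) (hd (pre @ [j]))"
      using path v cpath_comp_swap[OF w d(1,3)] by (simp add: cpath_append cpath.simps)
    have "cycles ?v ([pre @ [j]] @ P) ([n # post] @ Q)"
      by (rule cycles_swapI[of w "[]" P "[n # pre @ j # post]" Q]) (use assms 1 2 in auto)
    then show "cycles ?v ((pre @ [j]) # P) ((n # post) # Q)" by (simp only: append_Cons append_Nil)
  }
  let ?v = "w \<circ> refl_B n (- j)"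
  have vG: "?v \<in> G" using w n0 by simp
  have d': "\<bar>- j\<bar> \<notin> abs ` set pre" "\<bar>- j\<bar> \<notin> abs ` set post" using d by auto
  have v: "?v n = - w j" "?v (- j) = w n"
    using comp_swap_apply(1,2)[OF w n0(1), of "- j"] hyper_odd[OF w, of j] by simp_all
  have vj: "?v j = - w n" using v(2) hyper_odd[OF vG, of j] by simp
  have hd: "- hd (post @ [- n]) = hd (map uminus post @ [n])" by (cases post) auto
  have p: "cpath w (map uminus post) n" using cpath_uminus[OF w, of post "- n"] path(4) by simp
  have 1: "cpath ?v (n # map uminus post) n"
    using path v p hd cpath_comp_swap[OF w, of n "map uminus post" "- j"] d d' abs_image_uminus[of post] by (simp add: cpath.simps)
  have 2: "cpath ?v (pre @ [j]) (- hd (pre @ [j]))"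
    using path vj cpath_comp_swap[OF w d(1) d'(1)] by (simp add: cpath_append cpath.simps)
  have "cycles ?v ([n # map uminus post] @ P) ([pre @ [j]] @ Q)"
    by (rule cycles_swapI[of w "[]" P "[n # pre @ j # post]" Q]) (use assms 1 2 in \<open>auto simp: o_def\<close>)
  then show "cycles ?v ((n # map uminus post) # P) ((pre @ [j]) # Q)" by (simp only: append_Cons append_Nil)
qed

text \<open>The sign change of \<open>n\<close> makes its cycle positive.\<close>
lemma cycles_flip:
  assumes "cycles w P ((n # c) # Q)"
  shows "cycles (w \<circ> refl_B n (- n)) ((n # map uminus c) # P) Q"
proof -
  have w: "w \<in> G" by (rule cycles_hyper[OF assms])
  have path: "w n = hd (c @ [- n])" "cpath w c (- n)"
    using cycles_negD[OF assms list.set_intros(1)] unfolding list.sel cpath.simps by blast+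
  have n0: "n \<noteq> 0" "n \<in> S" using cycles_nonzero[OF assms, of n] by auto
  have d: "\<bar>n\<bar> \<notin> abs ` set c" using cycles_distinct_head(2)[OF assms] by simp
  let ?v = "w \<circ> refl_B n (- n)"
  have v: "?v n = - w n" using comp_swap_apply(1)[OF w n0(1), of "- n"] hyper_odd[OF w] by simp
  have hd: "- hd (c @ [- n]) = hd (map uminus c @ [n])" by (cases c) auto
  have p: "cpath w (map uminus c) n" using cpath_uminus[OF w, of c "- n"] path(2) by simp
  have 1: "cpath ?v (n # map uminus c) n"
    using path v p hd cpath_comp_swap[OF w, of n "map uminus c" "- n"] d abs_image_uminus[of c] by (simp add: cpath.simps)
  have "cycles ?v ([n # map uminus c] @ P) ([] @ Q)"
    by (rule cycles_swapI[of w "[]" P "[n # c]" Q]) (use assms 1 in \<open>auto simp: o_def\<close>)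
  then show ?thesis by (simp only: append_Cons append_Nil)
qed

text \<open>Two negative cycles join to a positive one. This reduces the length although it joins cycles, and it is
the source of the connected factorizations.\<close>
lemma cycles_merge:
  assumes "cycles w P ((n # c) # (pre @ j # post) # Q)"
  shows "cycles (w \<circ> refl_B n j) ((n # post @ map uminus (pre @ [j]) @ map uminus c) # P) Q"
proof -
  have w: "w \<in> G" by (rule cycles_hyper[OF assms])
  define h where "h = hd (pre @ [j])"
  have "cpath w (pre @ j # post) (- hd (pre @ j # post))" by (rule cycles_negD[OF assms]) simp
  moreover have "hd (pre @ j # post) = h" by (cases pre) (auto simp: h_def)
  ultimately have path: "cpath w pre j" "w j = hd (post @ [- h])" "cpath w post (- h)"
    by (simp_all add: cpath_append cpath.simps)
  have pathc: "w n = hd (c @ [- n])" "cpath w c (- n)"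
    using cycles_negD[OF assms list.set_intros(1)] unfolding list.sel cpath.simps by blast+
  have n0: "n \<noteq> 0" "n \<in> S" "j \<in> S"
    using cycles_nonzero[OF assms, of n] cycles_nonzero[OF assms, of j] by auto
  have d: "\<bar>n\<bar> \<notin> abs ` set pre" "\<bar>n\<bar> \<notin> abs ` set post" "\<bar>j\<bar> \<notin> abs ` set pre" "\<bar>j\<bar> \<notin> abs ` set post"
    "\<bar>n\<bar> \<notin> abs ` set c" "\<bar>j\<bar> \<notin> abs ` set c"
    using cycles_distinct_head(3)[OF assms] by simp_all
  let ?v = "w \<circ> refl_B n j"
  have vG: "?v \<in> G" using w n0 by simp
  have v: "?v n = w j" "?v j = w n" by (rule comp_swap_apply(1)[OF w n0(1)], rule comp_swap_apply(2)[OF w n0(1)])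
  have vj: "?v (- j) = - w n" using v(2) hyper_odd[OF vG, of j] by simp
  have hdc: "- hd (c @ [- n]) = hd (map uminus c @ [n])" by (cases c) auto
  have hdp: "hd (map uminus (pre @ [j]) @ xs) = - h" for xs by (cases pre) (auto simp: h_def)
  have 1: "hd (post @ map uminus (pre @ [j]) @ map uminus c @ [n]) = hd (post @ [- h])"
    using hdp by (cases post) auto
  have 2: "cpath ?v post (- h)" using cpath_comp_swap[OF w d(2,4)] path(3) by simp
  have "cpath w (map uminus pre) (- j)" using cpath_uminus[OF w] path(1) by simp
  then have 3: "cpath ?v (map uminus pre) (- j)"
    using cpath_comp_swap[OF w, of n "map uminus pre" j] d abs_image_uminus[of pre] by simp
  have "cpath w (map uminus c) n" using cpath_uminus[OF w, of c "- n"] pathc(2) by simp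
  then have 4: "cpath ?v (map uminus c) n"
    using cpath_comp_swap[OF w, of n "map uminus c" j] d abs_image_uminus[of c] by simp
  have 5: "cpath ?v (map uminus (pre @ [j]) @ map uminus c) n"
    using 3 4 vj pathc(1) hdc by (simp add: cpath_append cpath.simps)
  have "cpath ?v (post @ map uminus (pre @ [j]) @ map uminus c) n"
    unfolding cpath_append[of _ post] using 2 5 hdp[of "map uminus c @ [n]"] by simp
  then have 6: "cpath ?v (n # post @ map uminus (pre @ [j]) @ map uminus c) n"
    using v(1) path(2) 1 by (simp add: cpath.simps)
  have "cycles ?v ([n # post @ map uminus (pre @ [j]) @ map uminus c] @ P) ([] @ Q)"
    by (rule cycles_swapI[of w "[]" P "[n # c, pre @ j # post]" Q]) (use assms 6 in \<open>auto simp: o_def\<close>)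
  then show ?thesis by (simp only: append_Cons append_Nil)
qed

lemma cycles_uminus_second:
  assumes "cycles w P (a # d # Q)" shows "cycles w P (a # map uminus d # Q)"
proof -
  have w: "w \<in> G" by (rule cycles_hyper[OF assms])
  have d: "d \<noteq> []" using assms by (simp add: cycles_def)
  have p: "cpath w d (- hd d)" by (rule cycles_negD[OF assms]) simp
  have p': "cpath w (map uminus d) (- hd (map uminus d))"
    using cpath_uminus[OF w, of d "- hd d"] p by (simp only: hd_map[OF d])
  have m: "map abs (concat P @ concat (a # map uminus d # Q)) = map abs (concat P @ concat (a # d # Q))"
    by simp
  have e: "abs ` set (concat P @ concat (a # map uminus d # Q)) = abs ` set (concat P @ concat (a # d # Q))"
    using arg_cong[OF m, of set] by (simp only: set_map)
  show ?thesis unfolding cycles_def m e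
  proof (intro conjI)
    show "set (concat P @ concat (a # map uminus d # Q)) \<subseteq> S"
      using e by (rule signed_subset_abs) (use assms in \<open>unfold cycles_def, blast\<close>)
    have Q: "\<forall>c\<in>set (a # d # Q). c \<noteq> [] \<and> cpath w c (- hd c)" using assms unfolding cycles_def by blast
    show "\<forall>c\<in>set (a # map uminus d # Q). c \<noteq> [] \<and> cpath w c (- hd c)"
    proof
      fix c assume "c \<in> set (a # map uminus d # Q)"
      then have "c = map uminus d \<or> c \<in> set (a # d # Q)" by auto
      then show "c \<noteq> [] \<and> cpath w c (- hd c)"
      proof
        assume c: "c = map uminus d"
        show ?thesis unfolding c using p' d by (simp only: map_is_Nil_conv simp_thms)
      next
        assume "c \<in> set (a # d # Q)" then show ?thesis by (rule bspec[OF Q])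
      qed
    qed
  qed (use assms in \<open>unfold cycles_def, blast+\<close>)
qed

lemma cycles_remove_fixed:
  assumes "cycles w ([n] # P) Q" shows "cycles w P Q"
proof -
  have wn: "w n = n" using cycles_posD[OF assms list.set_intros(1)] by (simp add: cpath.simps)
  have fixed: "w i = i" if "\<bar>i\<bar> = \<bar>n\<bar>" for i
  proof -
    have "i = n \<or> i = - n" using that by linarith
    then show ?thesis using wn hyper_odd[OF cycles_hyper[OF assms], of n] by fastforce
  qed
  have old: "w i = i" if "i \<in> S" "\<bar>i\<bar> \<notin> abs ` set (concat ([n] # P) @ concat Q)" for i
    using assms that unfolding cycles_def by blast
  show ?thesis unfolding cycles_def
  proof (intro conjI)
    show "w \<in> G" by (rule cycles_hyper[OF assms])
    show "\<forall>c\<in>set P. c \<noteq> [] \<and> cpath w c (hd c)" "\<forall>c\<in>set Q. c \<noteq> [] \<and> cpath w c (- hd c)"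
      using assms unfolding cycles_def by auto
    show "distinct (map abs (concat P @ concat Q))" using cycles_distinct[OF assms] by simp
    show "set (concat P @ concat Q) \<subseteq> S" using assms unfolding cycles_def by simp
    show "\<forall>i\<in>S. \<bar>i\<bar> \<notin> abs ` set (concat P @ concat Q) \<longrightarrow> w i = i"
    proof (intro ballI impI)
      fix i assume i: "i \<in> S" "\<bar>i\<bar> \<notin> abs ` set (concat P @ concat Q)"
      show "w i = i"
      proof (cases "\<bar>i\<bar> = \<bar>n\<bar>")
        case True then show ?thesis by (rule fixed)
      next
        case False
        then have "\<bar>i\<bar> \<notin> abs ` set (concat ([n] # P) @ concat Q)" using i(2) by simp
        then show ?thesis by (rule old[OF i(1)])
      qed
    qed
  qed
qed

lemma cycles_empty: assumes "cycles w [] []" shows "w = id"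
proof
  fix i
  have "i \<in> S \<Longrightarrow> w i = i" using assms by (simp add: cycles_def)
  then show "w i = id i" using hyper_outside[OF cycles_hyper[OF assms], of i] by (cases "i \<in> S") simp_all
qed

end

section \<open>Counting minimal factorizations by cycle type\<close>

lemma sum_list_map_split:
  assumes "\<And>pre j post. c = pre @ j # post \<Longrightarrow> F j = h (length pre)"
  shows "sum_list (map F c) = (\<Sum>i<length c. h i)"
proof -
  have "sum_list (map F c) = (\<Sum>i<length c. F (c ! i))"
    by (simp add: sum_list_sum_nth atLeast0LessThan)
  also have "\<dots> = (\<Sum>i<length c. h i)"
  proof (rule sum.cong[OF refl])
    fix i assume "i \<in> {..<length c}"
    then have i: "i < length c" by simp
    have "F (c ! i) = h (length (take i c))" by (rule assms) (rule id_take_nth_drop[OF i])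
    then show "F (c ! i) = h i" using i by simp
  qed
  finally show ?thesis .
qed

lemma fps_mult_nth_Suc:
  fixes a b :: "rat fps"
  assumes "a $ 0 = 0" shows "(a * b) $ l = (\<Sum>i<l. a $ Suc i * b $ (l - Suc i))"
proof -
  have "(a * b) $ l = (\<Sum>i\<in>{0..l}. a $ i * b $ (l - i))" by (rule fps_mult_nth)
  also have "\<dots> = (\<Sum>i\<in>{..<Suc l}. a $ i * b $ (l - i))" by (rule sum.cong) auto
  also have "\<dots> = (\<Sum>i<l. a $ Suc i * b $ (l - Suc i))"
    unfolding sum.lessThan_Suc_shift by (simp add: assms)
  finally show ?thesis .
qed

context hyperoctahedral_group
begin

lemma evec_in: "a \<in> B \<Longrightarrow> evec B a = 1"
  by (simp add: evec_def)

lemma evec_eq_1: "evec B a = 1 \<Longrightarrow> a \<in> B"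
  using trit_one by (auto simp: evec_def split: if_splits)

lemma Fix_uminus: "x \<in> Fix w \<Longrightarrow> x (- a) = - x a"
  by (simp add: Fix_def Vec_def)

text \<open>Fixed vectors separate the positive cycle of \<open>n\<close> from all other labels, and a reflection that shortens
\<open>w\<close> has to respect them.\<close>
lemma lowering_pos:
  assumes cyc: "cycles w ((n # c) # P) Q"
  shows "lowering n w = set c"
proof
  have w: "w \<in> G" by (rule cycles_hyper[OF cyc])
  have nS: "n \<in> S" by (rule cycles_nonzero(2)[OF cyc]) simp
  have dist: "distinct (map abs (n # c))" by (rule cycles_distinct_head(1)[OF cyc])
  show "lowering n w \<subseteq> set c"
  proof
    fix j assume j: "j \<in> lowering n w"
    have "evec (set (n # c)) \<in> Fix w" by (rule cycles_pos_evec[OF cyc]) simp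
    from lowering_Fix[OF w nS j this] have "evec (set (n # c)) j = evec (set (n # c)) n" by (rule sym)
    also have "\<dots> = 1" by (rule evec_in) simp
    finally have "j \<in> set (n # c)" by (rule evec_eq_1)
    then show "j \<in> set c" using j by (simp add: lowering_def)
  qed
  show "set c \<subseteq> lowering n w"
  proof
    fix j assume j: "j \<in> set c"
    then obtain pre post where c: "c = pre @ j # post" by (auto simp: in_set_conv_decomp)
    have path: "cpath w (n # c) n" using cycles_posD[OF cyc list.set_intros(1)] by simp
    show "j \<in> lowering n w"
    proof (rule loweringI[OF w nS])
      show "j \<in> S" by (rule cycles_nonzero(2)[OF cyc]) (simp add: j)
      show "j \<noteq> n" using dist j by auto
      show "x n = x j" if "x \<in> Fix w" for x
        using cpath_Fix[OF that path, of j] j by simp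
      show "evec (set (pre @ [j])) \<in> Fix (w \<circ> refl_B n j)"
        by (rule cycles_pos_evec[OF cycles_split_pos[OF cyc[unfolded c]]]) simp
      show "evec (set (pre @ [j])) \<notin> Fix w"
      proof
        assume e: "evec (set (pre @ [j])) \<in> Fix w"
        have "evec (set (pre @ [j])) n = evec (set (pre @ [j])) j"
          using cpath_Fix[OF e path, of j] j by simp
        also have "\<dots> = 1" by (rule evec_in) simp
        finally have "n \<in> set (pre @ [j])" by (rule evec_eq_1)
        then show False using dist unfolding c by auto
      qed
    qed
  qed
qed

lemma cycles_neg_Fix: "cycles w P Q \<Longrightarrow> a \<in> set (concat Q) \<Longrightarrow> x \<in> Fix w \<Longrightarrow> x a = 0"
  using cycles_neg_zero by auto

text \<open>Fixed vectors vanish on the negative cycles and see every other label. So a label outside the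
negative cycles cannot be exchanged with \<open>n\<close>, and each of the remaining reflections produces a new
positive cycle, whose signed indicator is a new fixed vector.\<close>
lemma lowering_neg:
  assumes cyc: "cycles w P ((n # c) # Q)" and Q: "length Q \<le> 1"
  shows "lowering n w = set (c @ concat Q) \<union> uminus ` set (n # c @ concat Q)"
proof
  let ?Q = "(n # c) # Q"
  have w: "w \<in> G" by (rule cycles_hyper[OF cyc])
  have nS: "n \<in> S" by (rule cycles_nonzero(2)[OF cyc]) simp
  have con: "concat ?Q = n # c @ concat Q" by simp
  have zero: "x a = 0" "x (- a) = 0" if "x \<in> Fix w" "a \<in> set (n # c @ concat Q)" for x a
    using cycles_neg_Fix[OF cyc, unfolded con, OF that(2,1)] Fix_uminus[OF that(1), of a] by simp_all
  show "lowering n w \<subseteq> set (c @ concat Q) \<union> uminus ` set (n # c @ concat Q)"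
  proof
    fix j assume j: "j \<in> lowering n w"
    have jS: "j \<in> S" and jn: "j \<noteq> n" using j by (auto simp: lowering_def)
    have xj: "x j = 0" if "x \<in> Fix w" for x
      using lowering_Fix[OF w nS j that] zero(1)[OF that, of n] by simp
    have "\<bar>j\<bar> \<in> abs ` set (concat P @ concat ?Q)"
    proof (rule ccontr)
      assume "\<bar>j\<bar> \<notin> abs ` set (concat P @ concat ?Q)"
      then have "w j = j" using cyc jS unfolding cycles_def by blast
      then have "evec {j} \<in> Fix w"
        by (intro evec_Fix[OF w]) (use jS in \<open>auto simp: signed_set_iff\<close>)
      then have "evec {j} j = 0" by (rule xj)
      then show False using trit_one by (simp add: evec_def)
    qed
    then obtain b where b: "b \<in> set (concat P @ concat ?Q)" "\<bar>j\<bar> = \<bar>b\<bar>" by auto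
    have jb: "j = b \<or> j = - b" using b(2) by linarith
    have "b \<notin> set (concat P)"
    proof
      assume "b \<in> set (concat P)"
      then obtain d where d: "d \<in> set P" "b \<in> set d" by auto
      have e: "evec (set d) \<in> Fix w" by (rule cycles_pos_evec[OF cyc d(1)])
      have "evec (set d) j = 0" by (rule xj[OF e])
      then have "evec (set d) b = 0" using jb Fix_uminus[OF e, of b] by auto
      then show False using evec_in[OF d(2)] trit_one by simp
    qed
    then have "b \<in> set (n # c @ concat Q)" using b(1) by auto
    then show "j \<in> set (c @ concat Q) \<union> uminus ` set (n # c @ concat Q)" using jb jn by auto
  qed
  show "set (c @ concat Q) \<union> uminus ` set (n # c @ concat Q) \<subseteq> lowering n w"
  proof -
    have dist: "distinct (map abs (n # c @ concat Q))"
      using cycles_distinct[OF cyc] unfolding con by (simp only: map_append distinct_append)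
    have dn: "\<bar>a\<bar> \<noteq> \<bar>n\<bar>" if "a \<in> set (c @ concat Q)" for a
    proof
      assume "\<bar>a\<bar> = \<bar>n\<bar>"
      moreover have "\<bar>a\<bar> \<in> set (map abs (c @ concat Q))"
        unfolding set_map using that by (rule imageI)
      moreover have "\<bar>n\<bar> \<notin> set (map abs (c @ concat Q))" using dist by simp
      ultimately show False by (simp only:)
    qed
    have S: "a \<in> S" if "a \<in> set (n # c @ concat Q)" for a
      using cycles_nonzero(2)[OF cyc, of a] that by auto
    have key: "j \<in> lowering n w"
      if cyc': "cycles (w \<circ> refl_B n j) (d # P') Q'" and b: "b \<in> set d" "b \<in> set (n # c @ concat Q)"
        and j: "j \<noteq> n" "j \<in> set (n # c @ concat Q) \<or> - j \<in> set (n # c @ concat Q)" for j d P' Q' b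
    proof (rule loweringI[OF w nS])
      show "j \<in> S" using j(2)
      proof
        assume "- j \<in> set (n # c @ concat Q)"
        then have "- j \<in> S" by (rule S)
        then show ?thesis by simp
      qed (rule S)
      show "j \<noteq> n" by (rule j)
      show "x n = x j" if "x \<in> Fix w" for x
        using j(2) zero(1)[OF that, of n] zero[OF that] by fastforce
      show "evec (set d) \<in> Fix (w \<circ> refl_B n j)" by (rule cycles_pos_evec[OF cyc']) simp
      show "evec (set d) \<notin> Fix w"
        using zero(1)[of "evec (set d)" b] b evec_in[OF b(1)] trit_one by auto
    qed
    have n0: "n \<noteq> 0" by (rule S_nonzero[OF nS])
    have minus_n: "- n \<in> lowering n w"
      by (rule key[OF cycles_flip[OF cyc], of n]) (use n0 in auto)
    have c1: "a \<in> lowering n w \<and> - a \<in> lowering n w" if a: "a \<in> set c" for a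
    proof -
      obtain pre post where c: "c = pre @ a # post" using a by (auto simp: in_set_conv_decomp)
      have "a \<in> lowering n w"
        by (rule key[OF cycles_split_neg(1)[OF cyc[unfolded c]], of a]) (use a dn[of a] in auto)
      moreover have "- a \<in> lowering n w"
        by (rule key[OF cycles_split_neg(2)[OF cyc[unfolded c]], of n]) (use a dn[of a] in auto)
      ultimately show ?thesis ..
    qed
    have c2: "a \<in> lowering n w \<and> - a \<in> lowering n w" if a: "a \<in> set (concat Q)" for a
    proof -
      obtain d where d: "Q = [d]" "a \<in> set d" using a Q by (cases Q) auto
      obtain pre post where c: "d = pre @ a # post" using d(2) by (auto simp: in_set_conv_decomp)
      have 1: "cycles w P ((n # c) # (pre @ a # post) # [])" using cyc unfolding d c .
      have 2: "cycles w P ((n # c) # (map uminus pre @ (- a) # map uminus post) # [])"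
        using cycles_uminus_second[OF 1] by (simp only: map_append list.map)
      have "a \<in> lowering n w"
        by (rule key[OF cycles_merge[OF 1], of n]) (use a dn[of a] in auto)
      moreover have "- a \<in> lowering n w"
        by (rule key[OF cycles_merge[OF 2], of n]) (use a dn[of a] in auto)
      ultimately show ?thesis ..
    qed
    show ?thesis using minus_n c1 c2 by auto
  qed
qed

definition pos_wt :: "nat \<Rightarrow> int list list \<Rightarrow> rat" where
  "pos_wt m P = prod_list (map (\<lambda>c. tree_fps m $ length c) P)"

text \<open>The contribution of the negative cycles, given by their lengths; an interval below the two-cycle
element never leads to more than two of them.\<close>
fun neg_wt :: "nat \<Rightarrow> nat list \<Rightarrow> rat" where
  "neg_wt m [] = 1"
| "neg_wt m [a] = disc_fps m $ a"
| "neg_wt m [a, b] = annular_fps m b $ a"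
| "neg_wt m _ = 0"

lemma pos_wt_Cons [simp]: "pos_wt m (c # P) = tree_fps m $ length c * pos_wt m P"
  by (simp add: pos_wt_def)

definition strip_count :: "nat \<Rightarrow> int \<Rightarrow> nat \<Rightarrow> (int \<Rightarrow> int) \<Rightarrow> rat" where
  "strip_count m n k w = of_nat ((strip n ^^ k) (fixing_count n m) w)"

lemma strip_count_Suc:
  "strip_count m n (Suc k) w = strip_count m n k w + (\<Sum>j\<in>lowering n w. strip_count m n k (w \<circ> refl_B n j))"
  by (simp add: strip_count_def strip_def)

lemma cycles_hd_not_fixed_pos:
  assumes "cycles w ((n # c) # P) Q" "c \<noteq> []" shows "w n \<noteq> n"
proof -
  have "w n = hd (c @ [n])"
    using cycles_posD[OF assms(1) list.set_intros(1)] by (simp add: cpath.simps)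
  also have "\<dots> = hd c" using assms(2) by simp
  finally have "w n \<in> set c" using assms(2) by simp
  moreover have "n \<notin> set c" using cycles_distinct_head(1)[OF assms(1)] by auto
  ultimately show ?thesis by auto
qed

lemma cycles_hd_not_fixed_neg:
  assumes "cycles w P ((n # c) # Q)" shows "w n \<noteq> n"
proof
  assume wn: "w n = n"
  have nS: "n \<in> S" by (rule cycles_nonzero(2)[OF assms]) simp
  have "evec {n} \<in> Fix w"
    by (rule evec_Fix[OF cycles_hyper[OF assms]]) (use nS wn in \<open>auto simp: signed_set_iff\<close>)
  then have "evec {n} n = 0" by (rule cycles_neg_Fix[OF assms, rotated]) simp
  then show False using trit_one by (simp add: evec_def)
qed

text \<open>The induction hypothesis of \<open>factor_count_cycles\<close>, for decompositions with fewer than \<open>M\<close> labels.\<close>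
definition counted_below :: "nat \<Rightarrow> nat \<Rightarrow> bool" where
  "counted_below m M \<longleftrightarrow> (\<forall>w P Q. cycles w P Q \<longrightarrow> length Q \<le> 2 \<longrightarrow> length (concat P @ concat Q) < M
      \<longrightarrow> of_nat (factor_count m w) = pos_wt m P * neg_wt m (map length Q))"

lemma counted_belowD: "counted_below m M \<Longrightarrow> cycles w P Q \<Longrightarrow> length Q \<le> 2
    \<Longrightarrow> length (concat P @ concat Q) < M \<Longrightarrow> of_nat (factor_count m w) = pos_wt m P * neg_wt m (map length Q)"
  unfolding counted_below_def by blast

text \<open>One step either does nothing or splits off a positive cycle; this is the recursion of the powers of
\<open>1 + tree_fps m\<close>. At the end \<open>n\<close> has to be a fixed point, and it is discarded.\<close>
lemma strip_count_pos:
  assumes IH: "counted_below m M"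
  shows "cycles w ((n # c) # P) Q \<Longrightarrow> length Q \<le> 2 \<Longrightarrow> length (concat ((n # c) # P) @ concat Q) \<le> M
    \<Longrightarrow> strip_count m n k w = ((1 + tree_fps m) ^ k) $ length c * (pos_wt m P * neg_wt m (map length Q))"
proof (induction k arbitrary: w c P)
  case 0
  show ?case
  proof (cases "c = []")
    case True
    have cyc: "cycles w ([n] # P) Q" using "0.prems"(1) True by simp
    have "w n = n" using cycles_posD[OF cyc list.set_intros(1)] by (simp add: cpath.simps)
    then have "strip_count m n 0 w = of_nat (factor_count m w)" by (simp add: strip_count_def fixing_count_def)
    also have "\<dots> = pos_wt m P * neg_wt m (map length Q)"
      by (rule counted_belowD[OF IH cycles_remove_fixed[OF cyc] "0.prems"(2)]) (use "0.prems"(3) in simp)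
    finally show ?thesis using True by simp
  next
    case False
    then have "w n \<noteq> n" by (rule cycles_hd_not_fixed_pos[OF "0.prems"(1)])
    then show ?thesis using False by (simp add: strip_count_def fixing_count_def)
  qed
next
  case (Suc k)
  let ?Y = "1 + tree_fps m"
  let ?W = "pos_wt m P * neg_wt m (map length Q)"
  have dc: "distinct c" using cycles_distinct_head(1)[OF Suc.prems(1)] by (simp add: distinct_map)
  have "(\<Sum>j\<in>lowering n w. strip_count m n k (w \<circ> refl_B n j))
     = sum_list (map (\<lambda>j. strip_count m n k (w \<circ> refl_B n j)) c)"
    unfolding lowering_pos[OF Suc.prems(1)] by (rule sum.distinct_set_conv_list[OF dc])
  also have "\<dots> = (\<Sum>i<length c. (?Y ^ k) $ (length c - Suc i) * (tree_fps m $ Suc i * ?W))"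
  proof (rule sum_list_map_split)
    fix pre j post assume c: "c = pre @ j # post"
    have "strip_count m n k (w \<circ> refl_B n j)
       = (?Y ^ k) $ length post * (pos_wt m ((pre @ [j]) # P) * neg_wt m (map length Q))"
      by (rule Suc.IH[OF cycles_split_pos[OF Suc.prems(1)[unfolded c]] Suc.prems(2)])
        (use Suc.prems(3) in \<open>simp add: c\<close>)
    then show "strip_count m n k (w \<circ> refl_B n j)
       = (?Y ^ k) $ (length c - Suc (length pre)) * (tree_fps m $ Suc (length pre) * ?W)"
      by (simp add: c)
  qed
  also have "\<dots> = (\<Sum>i<length c. tree_fps m $ Suc i * (?Y ^ k) $ (length c - Suc i)) * ?W"
    unfolding sum_distrib_right by (rule sum.cong) simp_all
  also have "\<dots> = (tree_fps m * ?Y ^ k) $ length c * ?W"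
    by (subst fps_mult_nth_Suc) simp_all
  finally have "strip_count m n (Suc k) w = (?Y ^ k) $ length c * ?W + (tree_fps m * ?Y ^ k) $ length c * ?W"
    unfolding strip_count_Suc by (simp only: Suc.IH[OF Suc.prems])
  also have "\<dots> = (?Y ^ k + tree_fps m * ?Y ^ k) $ length c * ?W"
    by (simp only: fps_add_nth distrib_right)
  also have "?Y ^ k + tree_fps m * ?Y ^ k = ?Y ^ Suc k" by (simp add: algebra_simps)
  finally show ?case .
qed

text \<open>A step may put \<open>n\<close> into a positive cycle and leave a negative cycle of length \<open>r\<close> behind; \<open>r = 0\<close>
means that the negative cycle has disappeared by a sign change of \<open>n\<close>.\<close>
definition leftover_series :: "nat \<Rightarrow> int list list \<Rightarrow> rat fps" where
  "leftover_series m Q = Abs_fps (\<lambda>r. if r = 0 then neg_wt m (map length Q) else neg_wt m (r # map length Q))"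

fun merge_series :: "nat \<Rightarrow> int list list \<Rightarrow> nat \<Rightarrow> rat fps" where
  "merge_series m [d] k = of_nat (2 * length d) * (fps_X * fps_shift (length d) ((1 + tree_fps m) ^ k))"
| "merge_series m _ k = 0"

text \<open>The weighted number of ways to strip \<open>n\<close> from a negative cycle in at most \<open>k\<close> steps, by the
length of that cycle. The three summands of the
recursion say what happens in the first step: nothing or the loss of a positive cycle; \<open>n\<close> becomes
part of a positive cycle; or the cycle is joined to the other negative one. In the last two cases
\<open>k\<close> steps for a positive cycle remain.\<close>
primrec neg_fps :: "nat \<Rightarrow> int list list \<Rightarrow> nat \<Rightarrow> rat fps" where
  "neg_fps m Q 0 = 0"
| "neg_fps m Q (Suc k) = (1 + tree_fps m) * neg_fps m Q k
     + fps_X * (leftover_series m Q * (1 + tree_fps m) ^ k) + merge_series m Q k"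

lemma neg_fps_0 [simp]: "neg_fps m Q k $ 0 = 0"
  by (induction k; cases "(m, Q, 0::nat)" rule: merge_series.cases) (simp_all add: mult.assoc[symmetric] flip: fps_of_nat)

text \<open>By \<open>lowering_neg\<close> the sum over the first step runs over the labels of the own cycle and of the other
negative cycle, with both signs, and the sign change of \<open>n\<close> itself. The facts 1, 2 and 3
evaluate these groups, in the order of the three summands of \<open>neg_fps\<close>.\<close>
lemma strip_count_neg:
  assumes IH: "counted_below m M"
    and Q: "length Q \<le> 1"
  shows "cycles w P ((n # c) # Q) \<Longrightarrow> length (concat P @ concat ((n # c) # Q)) \<le> M
    \<Longrightarrow> strip_count m n k w = neg_fps m Q k $ Suc (length c) * pos_wt m P"
proof (induction k arbitrary: w c P)
  case 0
  have "w n \<noteq> n" by (rule cycles_hd_not_fixed_neg[OF "0.prems"(1)])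
  then show ?case by (simp add: strip_count_def fixing_count_def)
next
  case (Suc k)
  let ?Y = "1 + tree_fps m"
  let ?l = "length c"
  define F where "F j = strip_count m n k (w \<circ> refl_B n j)" for j
  note cyc = Suc.prems(1)
  note pos = strip_count_pos[OF IH]
  have dist: "distinct (map abs (n # c @ concat Q))"
    using cycles_distinct[OF cyc] unfolding concat.simps append_Cons[symmetric] map_append distinct_append by blast
  have nz: "a \<noteq> 0" if "a \<in> set (n # c @ concat Q)" for a
    using cycles_nonzero(1)[OF cyc, of a] that by auto
  \<comment> \<open>The signed labels are distinct up to sign, so the two groups of reflections do not overlap.\<close>
  have disj: "set (c @ concat Q) \<inter> uminus ` set (n # c @ concat Q) = {}"
  proof (rule ccontr)
    assume "set (c @ concat Q) \<inter> uminus ` set (n # c @ concat Q) \<noteq> {}"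
    then obtain b where b: "b \<in> set (n # c @ concat Q)" "- b \<in> set (n # c @ concat Q)" by auto
    have "inj_on abs (set (n # c @ concat Q))" using dist unfolding distinct_map by blast
    then have "b = - b" by (rule inj_onD) (use b in simp_all)
    then show False using nz[OF b(1)] by simp
  qed
  have d1: "distinct (c @ concat Q)" "distinct (n # c @ concat Q)" using dist unfolding distinct_map by simp_all
  have "(\<Sum>j\<in>lowering n w. F j) = (\<Sum>j\<in>set (c @ concat Q). F j) + (\<Sum>j\<in>uminus ` set (n # c @ concat Q). F j)"
    unfolding lowering_neg[OF cyc Q] by (rule sum.union_disjoint[OF _ _ disj]) simp_all
  also have "(\<Sum>j\<in>set (c @ concat Q). F j) = sum_list (map F (c @ concat Q))"
    by (rule sum.distinct_set_conv_list[OF d1(1)])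
  also have "(\<Sum>j\<in>uminus ` set (n # c @ concat Q). F j) = (\<Sum>j\<in>set (n # c @ concat Q). F (- j))"
    by (subst sum.reindex) (simp_all add: inj_on_def)
  also have "\<dots> = sum_list (map (\<lambda>j. F (- j)) (n # c @ concat Q))"
    by (rule sum.distinct_set_conv_list[OF d1(2)])
  finally have sum: "(\<Sum>j\<in>lowering n w. F j) = sum_list (map F c) + (F (- n) + sum_list (map (\<lambda>j. F (- j)) c))
     + (sum_list (map F (concat Q)) + sum_list (map (\<lambda>j. F (- j)) (concat Q)))" by simp
  have 1: "sum_list (map F c) = (tree_fps m * neg_fps m Q k) $ Suc ?l * pos_wt m P"
  proof -
    have "sum_list (map F c) = (\<Sum>i<?l. neg_fps m Q k $ Suc (?l - Suc i) * (tree_fps m $ Suc i * pos_wt m P))"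
    proof (rule sum_list_map_split)
      fix pre j post assume c: "c = pre @ j # post"
      have "F j = neg_fps m Q k $ Suc (length post) * pos_wt m ((pre @ [j]) # P)"
        unfolding F_def by (rule Suc.IH[OF cycles_split_neg(1)[OF cyc[unfolded c]]]) (use Suc.prems(2) in \<open>simp add: c\<close>)
      then show "F j = neg_fps m Q k $ Suc (?l - Suc (length pre)) * (tree_fps m $ Suc (length pre) * pos_wt m P)"
        by (simp add: c)
    qed
    also have "\<dots> = (\<Sum>i<Suc ?l. tree_fps m $ Suc i * neg_fps m Q k $ (Suc ?l - Suc i)) * pos_wt m P"
      by (simp add: sum_distrib_left sum_distrib_right Suc_diff_Suc mult_ac)
    also have "\<dots> = (tree_fps m * neg_fps m Q k) $ Suc ?l * pos_wt m P"
      by (subst fps_mult_nth_Suc) simp_all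
    finally show ?thesis .
  qed
  have 2: "F (- n) + sum_list (map (\<lambda>j. F (- j)) c) = (leftover_series m Q * ?Y ^ k) $ ?l * pos_wt m P"
  proof -
    have "F (- n) = (?Y ^ k) $ length (map uminus c) * (pos_wt m P * neg_wt m (map length Q))"
      unfolding F_def by (rule pos[OF cycles_flip[OF cyc]]) (use Q Suc.prems(2) in simp_all)
    then have a: "F (- n) = leftover_series m Q $ 0 * (?Y ^ k) $ ?l * pos_wt m P" by (simp add: leftover_series_def)
    have "sum_list (map (\<lambda>j. F (- j)) c) = (\<Sum>i<?l. (?Y ^ k) $ (?l - Suc i) * (pos_wt m P * leftover_series m Q $ Suc i))"
    proof (rule sum_list_map_split)
      fix pre j post assume c: "c = pre @ j # post"
      have "F (- j) = (?Y ^ k) $ length (map uminus post) * (pos_wt m P * neg_wt m (map length ((pre @ [j]) # Q)))"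
        unfolding F_def by (rule pos[OF cycles_split_neg(2)[OF cyc[unfolded c]]]) (use Q Suc.prems(2) in \<open>simp_all add: c\<close>)
      then show "F (- j) = (?Y ^ k) $ (?l - Suc (length pre)) * (pos_wt m P * leftover_series m Q $ Suc (length pre))"
        by (simp add: c leftover_series_def)
    qed
    also have "\<dots> = (\<Sum>i<?l. leftover_series m Q $ Suc i * (?Y ^ k) $ (?l - Suc i)) * pos_wt m P"
      unfolding sum_distrib_right by (rule sum.cong) simp_all
    finally have b: "sum_list (map (\<lambda>j. F (- j)) c)
       = (\<Sum>i<?l. leftover_series m Q $ Suc i * (?Y ^ k) $ (?l - Suc i)) * pos_wt m P" .
    have "(leftover_series m Q * ?Y ^ k) $ ?l = (\<Sum>i\<in>{0..?l}. leftover_series m Q $ i * (?Y ^ k) $ (?l - i))"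
      by (rule fps_mult_nth)
    also have "\<dots> = (\<Sum>i\<in>{..<Suc ?l}. leftover_series m Q $ i * (?Y ^ k) $ (?l - i))" by (rule sum.cong) auto
    also have "\<dots> = leftover_series m Q $ 0 * (?Y ^ k) $ ?l + (\<Sum>i<?l. leftover_series m Q $ Suc i * (?Y ^ k) $ (?l - Suc i))"
      unfolding sum.lessThan_Suc_shift by simp
    finally show ?thesis unfolding a b by (simp only: distrib_right)
  qed
  have 3: "sum_list (map F (concat Q)) + sum_list (map (\<lambda>j. F (- j)) (concat Q)) = merge_series m Q k $ Suc ?l * pos_wt m P"
  proof (cases "Q = []")
    case True then show ?thesis by simp
  next
    case False
    then obtain d where d: "Q = [d]" using Q by (cases Q) auto
    have s: "F (s * j) = (?Y ^ k) $ (?l + length d) * pos_wt m P" if c: "d = pre @ j # post" and s: "s = 1 \<or> s = - 1" for pre j post s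
    proof -
      have c1: "cycles w P ((n # c) # (pre @ j # post) # [])" using cyc unfolding d c .
      have c2: "cycles w P ((n # c) # (map uminus pre @ (- j) # map uminus post) # [])"
        using cycles_uminus_second[OF c1] by (simp only: map_append list.map)
      obtain pre' post' where c': "cycles w P ((n # c) # (pre' @ (s * j) # post') # [])"
        and l: "Suc (length pre' + length post') = length d"
      proof (cases "s = 1")
        case True
        show thesis by (rule that[of pre post]) (use c1 True in \<open>simp_all add: c\<close>)
      next
        case False
        then have "s = - 1" using s by simp
        then show thesis by (intro that[of "map uminus pre" "map uminus post"]) (use c2 in \<open>simp_all add: c\<close>)
      qed
      have "F (s * j) = (?Y ^ k) $ length (post' @ map uminus (pre' @ [s * j]) @ map uminus c) * (pos_wt m P * neg_wt m (map length ([] :: int list list)))"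
        unfolding F_def by (rule pos[OF cycles_merge[OF c']]) (use Suc.prems(2) l in \<open>simp_all add: d\<close>)
      moreover have "length (post' @ map uminus (pre' @ [s * j]) @ map uminus c) = ?l + length d" using l by simp
      ultimately show ?thesis by (simp only: list.map neg_wt.simps mult_1_right)
    qed
    have "sum_list (map F d) = (\<Sum>i<length d. (?Y ^ k) $ (?l + length d) * pos_wt m P)"
      by (rule sum_list_map_split) (use s[of _ _ _ 1] in simp)
    moreover have "sum_list (map (\<lambda>j. F (- j)) d) = (\<Sum>i<length d. (?Y ^ k) $ (?l + length d) * pos_wt m P)"
      by (rule sum_list_map_split) (use s[of _ _ _ "- 1"] in simp)
    moreover have "merge_series m Q k $ Suc ?l = of_nat (2 * length d) * (?Y ^ k) $ (?l + length d)"
      by (simp add: d flip: fps_of_nat)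
    ultimately show ?thesis by (simp add: d)
  qed
  have "strip_count m n (Suc k) w = neg_fps m Q k $ Suc ?l * pos_wt m P
     + ((tree_fps m * neg_fps m Q k) $ Suc ?l * pos_wt m P + (leftover_series m Q * ?Y ^ k) $ ?l * pos_wt m P + merge_series m Q k $ Suc ?l * pos_wt m P)"
    unfolding strip_count_Suc F_def[symmetric] sum 1 2 3 by (simp only: Suc.IH[OF Suc.prems])
  also have "\<dots> = neg_fps m Q (Suc k) $ Suc ?l * pos_wt m P"
    by (simp add: algebra_simps)
  finally show ?case .
qed

lemma neg_fps_disc: "neg_fps m [] k = of_nat k * fps_X * ((1 + disc_fps m) * (1 + tree_fps m) ^ (k - 1))"
proof (induction k)
  case (Suc k)
  have "leftover_series m [] = 1 + disc_fps m"
  proof (rule fps_ext)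
    have "disc_fps m $ 0 = 0" by (simp add: disc_fps_def)
    then show "leftover_series m [] $ r = (1 + disc_fps m) $ r" for r by (cases r) (simp_all add: leftover_series_def)
  qed
  then show ?case using Suc by (cases k) (simp_all add: algebra_simps)
qed simp

lemma neg_fps_annular: "neg_fps m [d] k = of_nat k * fps_X * ((annular_fps m (length d) + fps_const (disc_fps m $ length d)) * (1 + tree_fps m) ^ (k - 1))
   + of_nat (2 * length d) * (\<Sum>i<k. (1 + tree_fps m) ^ (k - 1 - i) * (fps_X * fps_shift (length d) ((1 + tree_fps m) ^ i)))"
proof (induction k)
  case (Suc k)
  have "annular_fps m (length d) $ 0 = 0"
    by (simp add: annular_fps_def merge_fps_def fps_sum_nth flip: fps_of_nat)
  then have l: "leftover_series m [d] = annular_fps m (length d) + fps_const (disc_fps m $ length d)"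
    by (intro fps_ext) (auto simp: leftover_series_def gr0_conv_Suc)
  let ?Y = "1 + tree_fps m"
  let ?t = "\<lambda>i. fps_X * fps_shift (length d) (?Y ^ i)"
  have "(\<Sum>i<Suc k. ?Y ^ (Suc k - 1 - i) * ?t i) = (\<Sum>i<k. ?Y ^ (k - i) * ?t i) + ?t k" by simp
  also have "(\<Sum>i<k. ?Y ^ (k - i) * ?t i) = ?Y * (\<Sum>i<k. ?Y ^ (k - 1 - i) * ?t i)"
    unfolding sum_distrib_left
  proof (rule sum.cong[OF refl])
    fix i assume "i \<in> {..<k}"
    then have "k - i = Suc (k - 1 - i)" by auto
    then show "?Y ^ (k - i) * ?t i = ?Y * (?Y ^ (k - 1 - i) * ?t i)" by (simp only: power_Suc mult.assoc)
  qed
  finally have s: "(\<Sum>i<Suc k. ?Y ^ (Suc k - 1 - i) * ?t i) = ?Y * (\<Sum>i<k. ?Y ^ (k - 1 - i) * ?t i) + ?t k" .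
  define T where "T = (\<Sum>i<k. ?Y ^ (k - 1 - i) * ?t i)"
  define T' where "T' = ?t k"
  define U where "U = annular_fps m (length d) + fps_const (disc_fps m $ length d)"
  define D where "D = (of_nat (2 * length d) :: rat fps)"
  have e: "?Y * (of_nat k * fps_X * (U * ?Y ^ (k - 1))) = of_nat k * fps_X * (U * ?Y ^ k)"
  proof (cases k)
    case (Suc i)
    then show ?thesis unfolding Suc diff_Suc_1 power_Suc by (simp only: mult_ac)
  qed simp
  have "neg_fps m [d] (Suc k) = ?Y * (of_nat k * fps_X * (U * ?Y ^ (k - 1)) + D * T) + fps_X * (U * ?Y ^ k) + D * T'"
    using Suc by (simp add: l T_def T'_def U_def D_def)
  also have "\<dots> = of_nat (Suc k) * fps_X * (U * ?Y ^ k) + D * (?Y * T + T')"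
    unfolding distrib_left e by (simp add: algebra_simps)
  finally show ?case unfolding s by (simp add: T_def T'_def U_def D_def)
qed simp

lemma neg_fps_eq: assumes "length Q \<le> 1" "r > 0" shows "neg_fps m Q m $ r = neg_wt m (r # map length Q)"
proof (cases Q)
  case Nil
  have "neg_fps m [] m = disc_fps m" 
    unfolding neg_fps_disc by (subst (2) disc_fps_eq) (simp add: slope_fps_def mult_ac)
  then show ?thesis using Nil by simp
next
  case (Cons d Q')
  then have Q: "Q = [d]" using assms by simp
  have "neg_fps m [d] m = annular_fps m (length d)"
    unfolding neg_fps_annular merge_fps_def[symmetric]
    by (subst (2) annular_fps_eq) (simp add: slope_fps_def mult_ac)
  then show ?thesis using Q by simp
qed

text \<open>The label to be stripped is the first one of the first negative cycle, as long as there is one, so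
that the variable of \<open>annular_fps\<close> always marks the length of the cycle that is being stripped.\<close>
theorem factor_count_cycles:
  "cycles w P Q \<Longrightarrow> length Q \<le> 2 \<Longrightarrow> of_nat (factor_count m w) = pos_wt m P * neg_wt m (map length Q)"
proof (induction "length (concat P @ concat Q)" arbitrary: w P Q rule: less_induct)
  case less
  have IH: "counted_below m (length (concat P @ concat Q))"
    unfolding counted_below_def using less.hyps by blast
  have w: "w \<in> G" by (rule cycles_hyper[OF less.prems(1)])
  have strip: "of_nat (factor_count m w) = strip_count m n m w" if "n \<in> S" for n
    unfolding strip_count_def factor_count_eq_strip[OF w that] ..
  show ?case
  proof (cases Q)
    case Cons
    then obtain n c Q' where Q: "Q = (n # c) # Q'"
      using cycles_nonempty[OF less.prems(1)] by (metis list.set_intros(1) list.exhaust)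
    have l: "length Q' \<le> 1" using less.prems(2) Q by simp
    have cyc: "cycles w P ((n # c) # Q')" using less.prems(1) unfolding Q .
    have nS: "n \<in> S" by (rule cycles_nonzero(2)[OF cyc]) simp
    have "strip_count m n m w = neg_fps m Q' m $ Suc (length c) * pos_wt m P"
      by (rule strip_count_neg[OF IH l cyc]) (auto simp: Q)
    then show ?thesis using strip[OF nS] neg_fps_eq[OF l, of "Suc (length c)" m] by (simp add: Q)
  next
    case Nil
    show ?thesis
    proof (cases P)
      case Cons
      then obtain n c P' where P: "P = (n # c) # P'"
        using cycles_nonempty[OF less.prems(1)] by (metis list.set_intros(1) list.exhaust)
      have cyc: "cycles w ((n # c) # P') Q" using less.prems(1) unfolding P .
      have nS: "n \<in> S" by (rule cycles_nonzero(2)[OF cyc]) simp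
      have "strip_count m n m w = ((1 + tree_fps m) ^ m) $ length c * (pos_wt m P' * neg_wt m (map length Q))"
        by (rule strip_count_pos[OF IH cyc less.prems(2)]) (auto simp: P)
      moreover have "tree_fps m $ Suc (length c) = ((1 + tree_fps m) ^ m) $ length c"
        by (subst tree_fps_eq) simp
      ultimately show ?thesis using strip[OF nS] by (simp add: P)
    next
      case PNil: Nil
      have id: "w = id" by (rule cycles_empty) (use less.prems(1) Nil PNil in simp)
      have "factor_count k id = 1" for k
      proof (induction k)
        case (Suc k)
        have "u = id" if "u \<in> G" "le u id" for u
          using le_antisym[OF that(1) hyper_id that(2)] by simp
        then have eq: "{u \<in> G. le u id} = {id}" by auto
        have "factor_count (Suc k) id = (\<Sum>u\<in>{id}. factor_count k u)"
          unfolding factor_count.simps eq ..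
        also have "\<dots> = factor_count k id" by simp
        finally show ?case using Suc by (simp only:)
      qed (simp only: factor_count.simps simp_thms if_True)
      then show ?thesis by (simp add: id Nil PNil pos_wt_def)
    qed
  qed
qed

end

section \<open>Multichains and full chains below an element\<close>

lemma cpath_iff_map: "cpath w xs y \<longleftrightarrow> map w xs = tl (xs @ [y])"
proof (induction xs)
  case (Cons a xs)
  have "xs @ [y] = hd (xs @ [y]) # tl (xs @ [y])" by (cases xs) auto
  then have "map w (a # xs) = tl ((a # xs) @ [y]) \<longleftrightarrow> w a = hd (xs @ [y]) \<and> map w xs = tl (xs @ [y])"
    by (metis append_Cons list.inject list.map(2) list.sel(3))
  then show ?case using Cons by (simp add: cpath.simps)
qed (simp add: cpath.simps)

lemma cpath_cycle_of_list:
  assumes "distinct cs" "cs \<noteq> []" shows "cpath (cycle_of_list cs) cs (hd cs)"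
proof -
  have "map (cycle_of_list cs ^^ 1) cs = rotate 1 cs" by (rule cyclic_rotation[OF assms(1)])
  then show ?thesis using assms(2) by (simp add: cpath_iff_map rotate1_hd_tl)
qed

lemma signed_cycle:
  fixes A :: "int list"
  assumes pos: "\<And>a. a \<in> set A \<Longrightarrow> a > 0" and A: "distinct A" "A \<noteq> []"
  defines "f \<equiv> cycle_of_list (A @ map uminus A)"
  shows "cpath f A (- hd A)" and "\<And>a. a \<in> set A \<Longrightarrow> f (- a) = - f a"
    and "f permutes (set A \<union> uminus ` set A)"
proof -
  have d: "distinct (A @ map uminus A)"
  proof -
    have "set A \<inter> set (map uminus A) = {}"
    proof (rule ccontr)
      assume "set A \<inter> set (map uminus A) \<noteq> {}"
      then obtain a where "a \<in> set A" "- a \<in> set A" by auto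
      then show False using pos[of a] pos[of "- a"] by simp
    qed
    then show ?thesis using A unfolding distinct_append distinct_map by (simp add: inj_on_def)
  qed
  have "cpath f (A @ map uminus A) (hd (A @ map uminus A))"
    unfolding f_def by (rule cpath_cycle_of_list[OF d]) (simp add: A)
  moreover have "hd (A @ map uminus A) = hd A" using A by simp
  moreover have "hd (map uminus A @ [hd A]) = - hd A" using A by (cases A) auto
  ultimately have 1: "cpath f A (- hd A)" "cpath f (map uminus A) (hd A)" by (simp_all add: cpath_append)
  show "cpath f A (- hd A)" by (rule 1)
  have "map (\<lambda>a. f (- a)) A = map f (map uminus A)" by simp
  also have "\<dots> = tl (map uminus A @ [hd A])" using 1(2) by (simp only: cpath_iff_map)
  also have "\<dots> = map uminus (tl (A @ [- hd A]))" by (simp add: map_tl)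
  also have "\<dots> = map uminus (map f A)" using 1(1) by (simp only: cpath_iff_map)
  finally have "map (\<lambda>a. f (- a)) A = map (\<lambda>a. - f a) A" by simp
  then show "f (- a) = - f a" if "a \<in> set A" for a using that by simp
  show "f permutes (set A \<union> uminus ` set A)"
    using cycle_permutes[of "A @ map uminus A"] by (simp add: f_def)
qed

lemma gamma_B_cycles:
  assumes "p > 0" "q > 0"
  shows "hyperoctahedral_group.cycles (p + q) (gamma_B p q) [] [[1..int p], [int p + 1..int (p + q)]]"
proof -
  interpret hyperoctahedral_group "p + q" .
  let ?A = "[1..int p]" and ?B = "[int p + 1..int (p + q)]"
  define f where "f = cycle_of_list (?A @ map uminus ?A)"
  define g where "g = cycle_of_list (?B @ map uminus ?B)"
  have \<gamma>: "gamma_B p q = f \<circ> g" by (simp add: gamma_B_def f_def g_def)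
  have neA: "?A \<noteq> []" and neB: "?B \<noteq> []" using assms by auto
  have f: "cpath f ?A (- hd ?A)" "\<And>a. a \<in> set ?A \<Longrightarrow> f (- a) = - f a" "f permutes (set ?A \<union> uminus ` set ?A)"
    unfolding f_def by (rule signed_cycle[OF _ _ neA]; simp)+
  have g: "cpath g ?B (- hd ?B)" "\<And>a. a \<in> set ?B \<Longrightarrow> g (- a) = - g a" "g permutes (set ?B \<union> uminus ` set ?B)"
    unfolding g_def by (rule signed_cycle[OF _ _ neB]; simp)+
  have disj: "(set ?A \<union> uminus ` set ?A) \<inter> (set ?B \<union> uminus ` set ?B) = {}" by auto
  have ga: "g a = a" if "a \<in> set ?A \<union> uminus ` set ?A" for a
    using that disj by (intro permutes_not_in[OF g(3)]) blast
  have fb: "f b = b" if "b \<in> set ?B \<union> uminus ` set ?B" for b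
    using that disj by (intro permutes_not_in[OF f(3)]) blast
  have \<gamma>a: "gamma_B p q a = f a" if "a \<in> set ?A \<union> uminus ` set ?A" for a
    using ga[OF that] by (simp add: \<gamma>)
  have \<gamma>b: "gamma_B p q b = g b" if b: "b \<in> set ?B \<union> uminus ` set ?B" for b
  proof -
    have "g b \<in> set ?B \<union> uminus ` set ?B" using permutes_in_image[OF g(3)] b by (rule iffD2)
    then show ?thesis using fb by (simp add: \<gamma>)
  qed
  have subA: "set ?A \<union> uminus ` set ?A \<subseteq> S" and subB: "set ?B \<union> uminus ` set ?B \<subseteq> S"
    by (auto simp: signed_set_iff)
  have perm: "gamma_B p q permutes S"
    unfolding \<gamma> using permutes_subset[OF g(3) subB] permutes_subset[OF f(3) subA] by (rule permutes_compose)
  have G: "gamma_B p q \<in> G" unfolding hyperoctahedral_def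
  proof (safe intro!: perm)
    fix i assume "i \<in> {1..int (p + q)}"
    then have "i \<in> set ?A \<or> i \<in> set ?B" by auto
    then show "gamma_B p q (- i) = - gamma_B p q i"
    proof
      assume i: "i \<in> set ?A"
      have "gamma_B p q (- i) = f (- i)" by (rule \<gamma>a) (use i in blast)
      moreover have "gamma_B p q i = f i" by (rule \<gamma>a) (use i in blast)
      ultimately show ?thesis using f(2)[OF i] by simp
    next
      assume i: "i \<in> set ?B"
      have "gamma_B p q (- i) = g (- i)" by (rule \<gamma>b) (use i in blast)
      moreover have "gamma_B p q i = g i" by (rule \<gamma>b) (use i in blast)
      ultimately show ?thesis using g(2)[OF i] by simp
    qed
  qed
  have cA: "cpath (gamma_B p q) ?A (- hd ?A)"
    using f(1) cpath_cong[of ?A "gamma_B p q" f "- hd ?A"] \<gamma>a by blast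
  have cB: "cpath (gamma_B p q) ?B (- hd ?B)"
    using g(1) cpath_cong[of ?B "gamma_B p q" g "- hd ?B"] \<gamma>b by blast
  have con: "concat [] @ concat [?A, ?B] = [1..int (p + q)]"
  proof -
    have "[1..int (p + q)] = ?A @ ?B" by (rule upto_split2) (use assms in auto)
    then show ?thesis by simp
  qed
  have absid: "map abs [1..int (p + q)] = [1..int (p + q)]" by (rule map_idI) auto
  have absset: "abs ` set [1..int (p + q)] = set [1..int (p + q)]"
    using arg_cong[OF absid, of set] by (simp only: set_map)
  show ?thesis unfolding cycles_def con absid absset
  proof (intro conjI)
    show "gamma_B p q \<in> G" by (rule G)
    show "\<forall>c\<in>set [?A, ?B]. c \<noteq> [] \<and> cpath (gamma_B p q) c (- hd c)"
      using neA neB cA cB by (simp only: list.set ball_simps simp_thms)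
    show "\<forall>i\<in>S. \<bar>i\<bar> \<notin> set [1..int (p + q)] \<longrightarrow> gamma_B p q i = i"
      by (auto simp: signed_set_iff)
  qed (auto simp: signed_set_iff)
qed

context hyperoctahedral_group
begin

lemma card_Vec: "card Vec = 3 ^ N"
proof -
  have "bij_betw (\<lambda>x. restrict x {1..int N}) Vec (PiE {1..int N} (\<lambda>_. UNIV))"
  proof (rule bij_betw_imageI)
    show "inj_on (\<lambda>x. restrict x {1..int N}) Vec"
    proof (rule inj_onI)
      fix x y assume x: "x \<in> Vec" and y: "y \<in> Vec" and eq: "restrict x {1..int N} = restrict y {1..int N}"
      have e: "x i = y i" if "i \<in> {1..int N}" for i
        using fun_cong[OF eq, of i] that by simp
      show "x = y"
      proof
        fix k
        show "x k = y k" unfolding Vec_decomp[OF x, of k] Vec_decomp[OF y, of k]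
          by (rule sum.cong) (simp_all add: e)
      qed
    qed
    show "(\<lambda>x. restrict x {1..int N}) ` Vec = PiE {1..int N} (\<lambda>_. UNIV)"
    proof (intro equalityI subsetI)
      fix f :: "int \<Rightarrow> 3" assume f: "f \<in> PiE {1..int N} (\<lambda>_. UNIV)"
      define x where "x k = (if k \<in> {1..int N} then f k else if - k \<in> {1..int N} then - f (- k) else 0)" for k
      have "x \<in> Vec" by (auto simp: Vec_def x_def signed_set_iff)
      moreover have "f = restrict x {1..int N}" using f by (auto simp: x_def fun_eq_iff PiE_def extensional_def)
      ultimately show "f \<in> (\<lambda>x. restrict x {1..int N}) ` Vec" by (intro image_eqI[where x = x])
    qed auto
  qed
  then have "card Vec = card (PiE {1..int N} (\<lambda>_. UNIV :: 3 set))" by (rule bij_betw_same_card)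
  then show ?thesis by (simp add: card_PiE)
qed

lemma interval_finite [simp]: "finite {u \<in> G. le u w}" by simp

lemma multichains_Suc:
  assumes w: "w \<in> G"
  shows "multichains {u \<in> G. le u w} le (Suc k)
    = (\<Union>u\<in>{u \<in> G. le u w}. (\<lambda>xs. xs @ [u]) ` multichains {v \<in> G. le v u} le k)" (is "?L = ?R")
proof
  show "?L \<subseteq> ?R"
  proof
    fix xs assume "xs \<in> ?L"
    then have xs: "set xs \<subseteq> {u \<in> G. le u w}" "length xs = Suc k" "sorted_wrt le xs" by (auto simp: multichains_def)
    obtain ys u where ys: "xs = ys @ [u]" using xs(2) by (cases xs rule: rev_cases) auto
    have "ys \<in> multichains {v \<in> G. le v u} le k"
      using xs unfolding ys by (auto simp: multichains_def sorted_wrt_append)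
    then show "xs \<in> ?R" using xs(1) unfolding ys by auto
  qed
  show "?R \<subseteq> ?L"
  proof
    fix xs assume "xs \<in> ?R"
    then obtain u ys where u: "u \<in> G" "le u w" and ys: "xs = ys @ [u]" "set ys \<subseteq> {v \<in> G. le v u}" "length ys = k" "sorted_wrt le ys"
      by (auto simp: multichains_def)
    have "le v w" if "v \<in> set ys" for v
    proof -
      have "v \<in> G" "le v u" using ys(2) that by auto
      then show ?thesis using le_trans u w by blast
    qed
    then show "xs \<in> ?L" using u ys by (auto simp: multichains_def sorted_wrt_append)
  qed
qed

lemma finite_multichains: "finite P \<Longrightarrow> finite (multichains P r k)"
  by (rule finite_subset[OF _ finite_lists_length_eq[of P k]]) (auto simp: multichains_def)

lemma card_multichains: "w \<in> G \<Longrightarrow> card (multichains {u \<in> G. le u w} le k) = factor_count (Suc k) w"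
proof (induction k arbitrary: w)
  case 0
  have "multichains {u \<in> G. le u w} le 0 = {[]}" by (auto simp: multichains_def)
  moreover have "factor_count (Suc 0) w = (\<Sum>u\<in>{u \<in> G. le u w}. if u = id then 1 else 0)"
    by (simp only: factor_count.simps)
  moreover have "\<dots> = 1" using 0 by (simp add: sum.delta)
  ultimately show ?case by simp
next
  case (Suc k)
  have "card (multichains {u \<in> G. le u w} le (Suc k))
     = (\<Sum>u\<in>{u \<in> G. le u w}. card ((\<lambda>xs. xs @ [u]) ` multichains {v \<in> G. le v u} le k))"
    unfolding multichains_Suc[OF Suc.prems]
    by (rule card_UN_disjoint) (auto intro!: finite_multichains)
  also have "\<dots> = (\<Sum>u\<in>{u \<in> G. le u w}. factor_count (Suc k) u)"
  proof (rule sum.cong[OF refl])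
    fix u assume u: "u \<in> {u \<in> G. le u w}"
    have "card ((\<lambda>xs. xs @ [u]) ` multichains {v \<in> G. le v u} le k) = card (multichains {v \<in> G. le v u} le k)"
      by (rule card_image) (simp add: inj_on_def)
    also have "\<dots> = factor_count (Suc k) u" using u Suc.IH by blast
    finally show "card ((\<lambda>xs. xs @ [u]) ` multichains {v \<in> G. le v u} le k) = factor_count (Suc k) u" .
  qed
  finally show ?case by (simp only: factor_count.simps)
qed

text \<open>The number of factorizations into \<open>k\<close> non-trivial factors with additive lengths.\<close>
primrec strict_count :: "nat \<Rightarrow> (int \<Rightarrow> int) \<Rightarrow> nat" where
  "strict_count 0 w = (if w = id then 1 else 0)"
| "strict_count (Suc k) w = (\<Sum>u\<in>{u \<in> G. le u w \<and> u \<noteq> w}. strict_count k u)"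

lemma le_neq_len: assumes "u \<in> G" "w \<in> G" "le u w" "u \<noteq> w" shows "len u < len w"
proof (rule ccontr)
  assume "\<not> len u < len w"
  then have "u = w" by (intro le_antisym assms) simp
  then show False using assms by simp
qed

lemma strict_count_zero: "w \<in> G \<Longrightarrow> k > len w \<Longrightarrow> strict_count k w = 0"
proof (induction k arbitrary: w)
  case (Suc k)
  have "strict_count k u = 0" if "u \<in> G" "le u w" "u \<noteq> w" for u
    using Suc.IH[OF that(1)] le_neq_len[OF that(1) Suc.prems(1) that(2,3)] Suc.prems(2) by simp
  then show ?case by simp
qed simp

text \<open>Omitting trivial factors: \<open>m choose k\<close> is the number of positions for the non-trivial ones. So
\<open>factor_count\<close> is a polynomial in \<open>m\<close>, and the number of factorizations into reflections is read off from
its leading coefficient.\<close>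
lemma factor_count_strict: "w \<in> G \<Longrightarrow> factor_count m w = (\<Sum>k\<le>m. (m choose k) * strict_count k w)"
proof (induction m arbitrary: w)
  case 0 then show ?case by simp
next
  case (Suc m)
  have split: "(\<Sum>u\<in>{u \<in> G. le u w}. strict_count k u) = strict_count k w + strict_count (Suc k) w" for k
  proof -
    have "{u \<in> G. le u w} = insert w {u \<in> G. le u w \<and> u \<noteq> w}" using Suc.prems by auto
    then show ?thesis by simp
  qed
  have "factor_count (Suc m) w = (\<Sum>u\<in>{u \<in> G. le u w}. \<Sum>k\<le>m. (m choose k) * strict_count k u)"
    unfolding factor_count.simps by (rule sum.cong) (simp_all add: Suc.IH)
  also have "\<dots> = (\<Sum>k\<le>m. (m choose k) * (\<Sum>u\<in>{u \<in> G. le u w}. strict_count k u))"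
    by (subst sum.swap) (simp add: sum_distrib_left)
  also have "\<dots> = (\<Sum>k\<le>m. (m choose k) * strict_count k w) + (\<Sum>k\<le>m. (m choose k) * strict_count (Suc k) w)"
    unfolding split by (simp only: distrib_left sum.distrib)
  also have "(\<Sum>k\<le>m. (m choose k) * strict_count k w) = (\<Sum>k\<le>Suc m. (m choose k) * strict_count k w)"
    by simp
  also have "\<dots> = strict_count 0 w + (\<Sum>k\<le>m. (m choose Suc k) * strict_count (Suc k) w)"
    by (subst sum.atMost_Suc_shift) simp
  also have "\<dots> + (\<Sum>k\<le>m. (m choose k) * strict_count (Suc k) w)
     = strict_count 0 w + (\<Sum>k\<le>m. (Suc m choose Suc k) * strict_count (Suc k) w)"
    by (simp add: sum.distrib[symmetric] distrib_right add_ac)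
  also have "\<dots> = (\<Sum>k\<le>Suc m. (Suc m choose k) * strict_count k w)"
    unfolding sum.atMost_Suc_shift[of _ m] by simp
  finally show ?case .
qed

lemma factor_count_strict_len:
  assumes "w \<in> G" shows "factor_count m w = (\<Sum>k\<le>len w. (m choose k) * strict_count k w)"
proof -
  have "(\<Sum>k\<le>m. (m choose k) * strict_count k w) = (\<Sum>k\<le>max m (len w). (m choose k) * strict_count k w)"
    by (rule sum.mono_neutral_left) auto
  also have "\<dots> = (\<Sum>k\<le>len w. (m choose k) * strict_count k w)"
    by (rule sum.mono_neutral_right) (auto simp: strict_count_zero[OF assms])
  finally show ?thesis by (simp only: factor_count_strict[OF assms])
qed

definition is_chain :: "(int \<Rightarrow> int) set \<Rightarrow> bool" where
  "is_chain C \<longleftrightarrow> (\<forall>x\<in>C. \<forall>y\<in>C. le x y \<or> le y x)"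

text \<open>Chains that meet every rank of the interval below \<open>w\<close>.\<close>
definition full_chains :: "(int \<Rightarrow> int) \<Rightarrow> (int \<Rightarrow> int) set set" where
  "full_chains w = {C. C \<subseteq> {u \<in> G. le u w} \<and> is_chain C \<and> len ` C = {0..len w}}"

lemma chain_le: assumes "is_chain C" "x \<in> C" "y \<in> C" "x \<in> G" "y \<in> G" "len x \<le> len y" shows "le x y"
proof -
  have "le x y \<or> le y x" using assms by (simp add: is_chain_def)
  then show ?thesis
  proof
    assume "le y x"
    then have "y = x" using assms by (intro le_antisym)
    then show ?thesis using assms by simp
  qed
qed

lemma chain_len_eq: assumes "is_chain C" "x \<in> C" "y \<in> C" "x \<in> G" "y \<in> G" "len x = len y" shows "x = y"
  using le_antisym[OF assms(4,5) chain_le[OF assms(1-5)]] assms(6) by simp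

lemma finite_full_chains: "finite (full_chains w)"
  by (rule finite_subset[of _ "Pow {u \<in> G. le u w}"]) (auto simp: full_chains_def)

lemma full_chains_top: assumes "w \<in> G" "C \<in> full_chains w" shows "w \<in> C"
proof -
  have "len w \<in> len ` C" using assms(2) by (simp add: full_chains_def)
  then obtain x where x: "x \<in> C" "len x = len w" by auto
  then have "x \<in> G" "le x w" using assms(2) by (auto simp: full_chains_def)
  then have "x = w" using le_antisym[OF _ assms(1)] x(2) by simp
  then show ?thesis using x by simp
qed

text \<open>Removing the top element from a full chain leaves a full chain below an element of corank one.\<close>
lemma full_chains_Suc:
  assumes w: "w \<in> G" and L: "len w = Suc L"
  shows "full_chains w = (\<Union>u\<in>{u \<in> G. le u w \<and> len u = L}. insert w ` full_chains u)" (is "?L = ?R")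
proof
  show "?L \<subseteq> ?R"
  proof
    fix C assume C: "C \<in> ?L"
    have sub: "\<And>x. x \<in> C \<Longrightarrow> x \<in> G \<and> le x w" and ch: "is_chain C" and im: "len ` C = {0..Suc L}"
      using C L by (auto simp: full_chains_def)
    have wC: "w \<in> C" by (rule full_chains_top[OF w C])
    have "L \<in> len ` C" unfolding im by simp
    then obtain u where u: "u \<in> C" "len u = L" by auto
    have less: "len x \<le> L" if "x \<in> C - {w}" for x
      using le_neq_len[of x w] sub[of x] that w L by auto
    have "C - {w} \<in> full_chains u"
    proof -
      have "le x u" if "x \<in> C - {w}" for x
        using chain_le[OF ch _ u(1), of x] less[OF that] sub u that by auto
      moreover have "is_chain (C - {w})" using ch by (auto simp: is_chain_def)
      moreover have "len ` (C - {w}) = {0..len u}"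
      proof
        show "len ` (C - {w}) \<subseteq> {0..len u}"
        proof (rule image_subsetI)
          fix x assume "x \<in> C - {w}"
          then show "len x \<in> {0..len u}" using less[of x] u by simp
        qed
        show "{0..len u} \<subseteq> len ` (C - {w})"
        proof
          fix k assume k: "k \<in> {0..len u}"
          then have "k \<in> len ` C" unfolding im using u by simp
          then obtain x where "x \<in> C" "k = len x" by auto
          moreover have "x \<noteq> w" using k u L \<open>k = len x\<close> by auto
          ultimately show "k \<in> len ` (C - {w})" by blast
        qed
      qed
      ultimately show ?thesis using sub by (auto simp: full_chains_def)
    qed
    moreover have "insert w (C - {w}) = C" using wC by blast
    ultimately have "C \<in> insert w ` full_chains u" by (metis image_eqI)
    then show "C \<in> ?R" using u sub by blast
  qed
  show "?R \<subseteq> ?L"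
  proof
    fix C assume "C \<in> ?R"
    then obtain u D where u: "u \<in> G" "le u w" "len u = L" and D: "D \<in> full_chains u" "C = insert w D" by blast
    have D': "\<And>x. x \<in> D \<Longrightarrow> x \<in> G \<and> le x u" "is_chain D" "len ` D = {0..L}"
      using D(1) u(3) by (auto simp: full_chains_def)
    have le: "le x w" if "x \<in> D" for x using le_trans[of x u w] D'(1)[OF that] u w by blast
    have "is_chain C" using D'(2) le w by (auto simp: is_chain_def D(2))
    moreover have "len ` C = {0..len w}" unfolding D(2) using D'(3) L by auto
    ultimately show "C \<in> ?L" using le D'(1) w by (auto simp: full_chains_def D(2))
  qed
qed

lemma card_full_chains: "w \<in> G \<Longrightarrow> card (full_chains w) = strict_count (len w) w"
proof (induction "len w" arbitrary: w)
  case 0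
  then have w: "w = id" using len_0_iff[of w] by simp
  have "full_chains w = {{id}}"
  proof
    show "full_chains w \<subseteq> {{id}}"
    proof
      fix C assume C: "C \<in> full_chains w"
      have "id \<in> C" using full_chains_top[OF "0.prems" C] w by simp
      moreover have "x = id" if "x \<in> C" for x
        using C that le_antisym[of x id] unfolding w full_chains_def by auto
      ultimately show "C \<in> {{id}}" by blast
    qed
    show "{{id}} \<subseteq> full_chains w" by (simp add: w full_chains_def is_chain_def)
  qed
  moreover have "strict_count (len w) w = 1"
    unfolding 0(1)[symmetric] strict_count.simps using w by (simp only: simp_thms if_True)
  moreover have "card {{id :: int \<Rightarrow> int}} = 1" by (rule is_singleton_altdef[THEN iffD1, OF is_singletonI])
  ultimately show ?case by (simp only:)
next
  case (Suc L)
  have "card (full_chains w) = (\<Sum>u\<in>{u \<in> G. le u w \<and> len u = L}. card (insert w ` full_chains u))"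
    unfolding full_chains_Suc[OF Suc.prems Suc(2)[symmetric]]
  proof (rule card_UN_disjoint)
    show "\<forall>i\<in>{u \<in> G. le u w \<and> len u = L}. \<forall>j\<in>{u \<in> G. le u w \<and> len u = L}. i \<noteq> j \<longrightarrow>
      insert w ` full_chains i \<inter> insert w ` full_chains j = {}"
    proof (intro ballI impI, rule ccontr)
      fix i j assume i: "i \<in> {u \<in> G. le u w \<and> len u = L}" and j: "j \<in> {u \<in> G. le u w \<and> len u = L}"
        and ij: "i \<noteq> j" and "insert w ` full_chains i \<inter> insert w ` full_chains j \<noteq> {}"
      then obtain C D where C: "C \<in> full_chains i" "D \<in> full_chains j" "insert w C = insert w D" by auto
      have iC: "i \<in> C" using full_chains_top[OF _ C(1)] i by simp
      moreover have "i \<noteq> w" using i Suc(2) by auto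
      ultimately have iD: "i \<in> D" using C(3) by blast
      have jD: "j \<in> D" using full_chains_top[OF _ C(2)] j by simp
      have "is_chain D" using C(2) by (simp add: full_chains_def)
      then have "i = j" using iD jD i j by (intro chain_len_eq[of D]) auto
      then show False using ij by simp
    qed
  qed (auto simp: finite_full_chains)
  also have "\<dots> = (\<Sum>u\<in>{u \<in> G. le u w \<and> len u = L}. strict_count L u)"
  proof (rule sum.cong[OF refl])
    fix u assume u: "u \<in> {u \<in> G. le u w \<and> len u = L}"
    have notin: "w \<notin> C" if "C \<in> full_chains u" for C
    proof
      assume "w \<in> C"
      then have "le w u" using that by (auto simp: full_chains_def)
      then have "len w \<le> len u" by (rule le_len)
      then show False using u Suc(2) by simp
    qed
    have "card (insert w ` full_chains u) = card (full_chains u)"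
      by (rule card_image) (use notin in \<open>meson inj_onI insert_ident\<close>)
    also have "\<dots> = strict_count L u" using Suc(1)[of u] u by simp
    finally show "card (insert w ` full_chains u) = strict_count L u" .
  qed
  also have "\<dots> = (\<Sum>u\<in>{u \<in> G. le u w \<and> u \<noteq> w}. strict_count L u)"
  proof (rule sum.mono_neutral_left)
    show "{u \<in> G. le u w \<and> len u = L} \<subseteq> {u \<in> G. le u w \<and> u \<noteq> w}" using Suc(2) by auto
    show "\<forall>u\<in>{u \<in> G. le u w \<and> u \<noteq> w} - {u \<in> G. le u w \<and> len u = L}. strict_count L u = 0"
    proof
      fix u assume u: "u \<in> {u \<in> G. le u w \<and> u \<noteq> w} - {u \<in> G. le u w \<and> len u = L}"
      then have "len u < len w" using le_neq_len[of u w] Suc.prems by auto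
      moreover have "len u \<noteq> L" using u by auto
      ultimately show "strict_count L u = 0" using u Suc(2) by (intro strict_count_zero) auto
    qed
  qed simp
  finally show ?case by (simp add: Suc(2)[symmetric])
qed

end

section \<open>Maximal chains and the zeta polynomial\<close>

lemma maxchain_image:
  assumes inj: "inj_on \<phi> I" and ord: "\<And>x y. x \<in> I \<Longrightarrow> y \<in> I \<Longrightarrow> r' (\<phi> x) (\<phi> y) \<longleftrightarrow> r x y"
  shows "{C. pred_on.maxchain (\<phi> ` I) r' C} = (`) \<phi> ` {C. pred_on.maxchain I r C}"
proof -
  have chain: "pred_on.chain (\<phi> ` I) r' (\<phi> ` C) \<longleftrightarrow> pred_on.chain I r C" if "C \<subseteq> I" for C
  proof -
    define R' R where "R' = r'\<^sup>=\<^sup>=" and "R = r\<^sup>=\<^sup>="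
    have "R' (\<phi> x) (\<phi> y) \<longleftrightarrow> R x y" if "x \<in> I" "y \<in> I" for x y
      using that ord inj unfolding R'_def R_def by (auto dest: inj_onD)
    then have "(\<forall>x\<in>\<phi> ` C. \<forall>y\<in>\<phi> ` C. R' x y \<or> R' y x) \<longleftrightarrow> (\<forall>x\<in>C. \<forall>y\<in>C. R x y \<or> R y x)"
      using that by (simp add: subset_iff)
    then show ?thesis using that unfolding pred_on.chain_def R'_def R_def by (simp only: image_mono simp_thms)
  qed
  have max: "pred_on.maxchain (\<phi> ` I) r' (\<phi> ` C) \<longleftrightarrow> pred_on.maxchain I r C" if C: "C \<subseteq> I" for C
  proof -
    have "(\<exists>D. pred_on.chain (\<phi> ` I) r' D \<and> \<phi> ` C \<subset> D) \<longleftrightarrow> (\<exists>D. pred_on.chain I r D \<and> C \<subset> D)"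
    proof
      assume "\<exists>D. pred_on.chain (\<phi> ` I) r' D \<and> \<phi> ` C \<subset> D"
      then obtain D' where D': "pred_on.chain (\<phi> ` I) r' D'" "\<phi> ` C \<subset> D'" by blast
      then have "D' \<subseteq> \<phi> ` I" by (simp add: pred_on.chain_def)
      then obtain D where D: "D \<subseteq> I" "D' = \<phi> ` D" by (metis subset_imageE)
      have "C \<subseteq> D"
      proof
        fix c assume c: "c \<in> C"
        then have "\<phi> c \<in> \<phi> ` D" using D'(2) D(2) by blast
        then obtain d where d: "d \<in> D" "\<phi> c = \<phi> d" by blast
        have "c = d" using inj d(2) by (rule inj_onD) (use c C D(1) d(1) in auto)
        then show "c \<in> D" using d(1) by simp
      qed
      then have "C \<subset> D" using D'(2) D(2) by blast
      then show "\<exists>D. pred_on.chain I r D \<and> C \<subset> D" using chain[OF D(1)] D'(1) D(2) by blast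
    next
      assume "\<exists>D. pred_on.chain I r D \<and> C \<subset> D"
      then obtain D where D: "pred_on.chain I r D" "C \<subset> D" by blast
      then have DI: "D \<subseteq> I" by (simp add: pred_on.chain_def)
      have "\<phi> ` C \<subset> \<phi> ` D" 
        using D(2) inj_on_image_eq_iff[OF inj C DI] by blast
      then show "\<exists>D. pred_on.chain (\<phi> ` I) r' D \<and> \<phi> ` C \<subset> D" using chain[OF DI] D(1) by blast
    qed
    then show ?thesis unfolding pred_on.maxchain_def using chain[OF C] by simp
  qed
  show ?thesis
  proof (intro equalityI subsetI)
    fix C' assume "C' \<in> {C. pred_on.maxchain (\<phi> ` I) r' C}"
    then have C': "pred_on.maxchain (\<phi> ` I) r' C'" by simp
    then have "C' \<subseteq> \<phi> ` I" by (simp add: pred_on.maxchain_def pred_on.chain_def)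
    then obtain C where C: "C \<subseteq> I" "C' = \<phi> ` C" by (metis subset_imageE)
    have "pred_on.maxchain I r C" using max[OF C(1)] C' C(2) by simp
    then show "C' \<in> (`) \<phi> ` {C. pred_on.maxchain I r C}" using C(2) by blast
  next
    fix C' assume "C' \<in> (`) \<phi> ` {C. pred_on.maxchain I r C}"
    then obtain C where C: "C' = \<phi> ` C" "pred_on.maxchain I r C" by blast
    then have "C \<subseteq> I" by (simp add: pred_on.maxchain_def pred_on.chain_def)
    then show "C' \<in> {C. pred_on.maxchain (\<phi> ` I) r' C}" using max C by simp
  qed
qed

lemma card_maxchains_image:
  assumes inj: "inj_on \<phi> I" and ord: "\<And>x y. x \<in> I \<Longrightarrow> y \<in> I \<Longrightarrow> r' (\<phi> x) (\<phi> y) \<longleftrightarrow> r x y"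
  shows "card {C. pred_on.maxchain (\<phi> ` I) r' C} = card {C. pred_on.maxchain I r C}"
proof -
  have "{C. pred_on.maxchain I r C} \<subseteq> Pow I" by (auto simp: pred_on.maxchain_def pred_on.chain_def)
  then have "inj_on ((`) \<phi>) {C. pred_on.maxchain I r C}"
    using inj_on_image_Pow[OF inj] by (rule inj_on_subset[rotated])
  moreover have "{C. pred_on.maxchain (\<phi> ` I) r' C} = (`) \<phi> ` {C. pred_on.maxchain I r C}"
    by (rule maxchain_image[OF inj]) (rule ord; assumption)
  ultimately show ?thesis by (simp only: card_image)
qed

lemma card_multichains_image:
  assumes inj: "inj_on \<phi> I" and ord: "\<And>x y. x \<in> I \<Longrightarrow> y \<in> I \<Longrightarrow> r' (\<phi> x) (\<phi> y) \<longleftrightarrow> r x y"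
  shows "card (multichains (\<phi> ` I) r' k) = card (multichains I r k)"
proof -
  have sorted: "sorted_wrt r' (map \<phi> xs) \<longleftrightarrow> sorted_wrt r xs" if "set xs \<subseteq> I" for xs
    using that by (induction xs) (auto simp: ord subset_iff)
  have "multichains (\<phi> ` I) r' k = map \<phi> ` multichains I r k"
  proof (intro equalityI subsetI)
    fix ys assume ys: "ys \<in> multichains (\<phi> ` I) r' k"
    then have "ys \<in> lists (\<phi> ` I)" by (auto simp: multichains_def)
    then obtain xs where xs: "xs \<in> lists I" "ys = map \<phi> xs" by (auto simp: lists_image)
    then have "xs \<in> multichains I r k" using ys sorted[of xs] by (auto simp: multichains_def)
    then show "ys \<in> map \<phi> ` multichains I r k" using xs by blast
  next
    fix ys assume "ys \<in> map \<phi> ` multichains I r k"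
    then obtain xs where xs: "ys = map \<phi> xs" "set xs \<subseteq> I" "length xs = k" "sorted_wrt r xs"
      by (auto simp: multichains_def)
    then show "ys \<in> multichains (\<phi> ` I) r' k"
      using sorted[OF xs(2)] image_mono[OF xs(2), of \<phi>] by (simp add: multichains_def)
  qed
  moreover have "inj_on (map \<phi>) (multichains I r k)"
  proof (rule inj_onI)
    fix xs ys assume "xs \<in> multichains I r k" "ys \<in> multichains I r k" "map \<phi> xs = map \<phi> ys"
    then show "xs = ys" using inj by (auto simp: multichains_def intro: map_inj_on inj_on_subset)
  qed
  ultimately show ?thesis by (simp add: card_image)
qed

context hyperoctahedral_group
begin

text \<open>The interval is graded: the step of Carter's lemma for \<open>inv u \<circ> v\<close> provides a cover of \<open>u\<close> below \<open>v\<close>.\<close>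
lemma le_intermediate:
  assumes u: "u \<in> G" and v: "v \<in> G" and le: "le u v" and neq: "u \<noteq> v"
  obtains x where "x \<in> G" "le u x" "le x v" "len x = len u + 1"
proof -
  define z where "z = inv u \<circ> v"
  have z: "z \<in> G" using u v by (simp add: z_def)
  have lv: "len v = len u + len z" using le by (simp add: le_B_def z_def)
  have "len u \<noteq> len v" using le_neq_len[OF u v le neq] by simp
  then have "z \<noteq> id" using lv by auto
  then obtain i where i: "i \<in> S" "z i \<noteq> i" using hyper_neq_id[OF z] by blast
  let ?t = "refl_B i (z i)"
  have zi: "z i \<in> S" using z i by simp
  have t: "?t \<in> G" using i zi by simp
  have lt: "len ?t = 1" using len_swap[OF i(1) zi] i(2) by simp
  define x where "x = u \<circ> ?t"
  have x: "x \<in> G" using u t by (simp add: x_def)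
  have xv: "inv x \<circ> v = ?t \<circ> z"
    using u t i zi by (simp add: x_def z_def inv_comp_distrib swap_inv comp_assoc)
  have ux: "inv u \<circ> x = ?t" using u by (simp add: x_def)
  have lz: "len z = len (?t \<circ> z) + 1" by (rule len_carter[OF z i])
  have "len x \<le> len u + 1" using len_comp_le[OF u t] lt by (simp add: x_def)
  moreover have "len v \<le> len x + len (?t \<circ> z)"
  proof -
    have "v = x \<circ> (inv x \<circ> v)" using x by simp
    then show ?thesis using len_comp_le[OF x, of "inv x \<circ> v"] x v unfolding xv by (metis hyper_comp t z)
  qed
  ultimately have l: "len x = len u + 1" "len v = len x + len (?t \<circ> z)" using lv lz by linarith+
  show thesis
  proof (rule that[OF x])
    show "le u x" unfolding le_B_def ux using l(1) lt by simp
    show "le x v" unfolding le_B_def xv using l(2) by simp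
    show "len x = len u + 1" by (rule l)
  qed
qed

lemma chain_iff: "pred_on.chain {u \<in> G. le u w} le C \<longleftrightarrow> C \<subseteq> {u \<in> G. le u w} \<and> is_chain C"
proof -
  have "le\<^sup>=\<^sup>= x y \<longleftrightarrow> le x y" if "x \<in> G" for x y using that by auto
  then show ?thesis unfolding pred_on.chain_def is_chain_def by blast
qed

lemma is_chain_insert:
  assumes "is_chain C" "x \<in> G" "\<And>y. y \<in> C \<Longrightarrow> le x y \<or> le y x" shows "is_chain (insert x C)"
  using assms by (auto simp: is_chain_def)

lemma full_chain_maximal:
  assumes w: "w \<in> G" and C: "C \<in> full_chains w" and D: "D \<subseteq> {u \<in> G. le u w}" "is_chain D" "C \<subseteq> D"
  shows "D \<subseteq> C"
proof
  fix d assume d: "d \<in> D"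
  then have dG: "d \<in> G" "le d w" using D(1) by auto
  have "len d \<in> len ` C" using C le_len[OF dG(2)] by (simp add: full_chains_def)
  then obtain c where c: "c \<in> C" "len d = len c" by auto
  have "d = c" using chain_len_eq[OF D(2) d _ dG(1) _ c(2)] c(1) D(1,3) by auto
  then show "d \<in> C" using c by simp
qed

text \<open>If a maximal chain omitted the rank \<open>k\<close>, an element could be inserted just above its last member of smaller
rank.\<close>
lemma maxchain_full:
  assumes w: "w \<in> G" and C: "C \<subseteq> {u \<in> G. le u w}" "is_chain C"
    and max: "\<And>x. x \<in> G \<Longrightarrow> le x w \<Longrightarrow> (\<And>y. y \<in> C \<Longrightarrow> le x y \<or> le y x) \<Longrightarrow> x \<in> C"
  shows "C \<in> full_chains w"
proof -
  have CG: "c \<in> G" "le c w" if "c \<in> C" for c using that C(1) by auto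
  have idC: "id \<in> C" by (rule max) (use w CG in auto)
  have wC: "w \<in> C" by (rule max) (use w CG in auto)
  have "finite {u \<in> G. le u w}" by simp
  then have fin: "finite C" using C(1) by (rule finite_subset[rotated])
  have "{0..len w} \<subseteq> len ` C"
  proof (rule ccontr)
    assume "\<not> {0..len w} \<subseteq> len ` C"
    then obtain k where "k \<in> {0..len w}" and k2: "k \<notin> len ` C" by blast
    then have k: "k \<le> len w" "k \<notin> len ` C" by simp_all
    have k0: "k > 0" using k(2) imageI[OF idC, of len] by (cases k) auto
    have kw: "k < len w" using k imageI[OF wC, of len] by (cases "k = len w") auto
    define A where "A = {c \<in> C. len c < k}"
    define B where "B = {c \<in> C. len c > k}"
    have "finite (len ` A)" "len ` A \<noteq> {}" using fin idC k0 by (auto simp: A_def)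
    then have "Max (len ` A) \<in> len ` A" by (rule Max_in)
    then obtain u where u: "u \<in> A" "len u = Max (len ` A)" by auto
    have umax: "len c \<le> len u" if "c \<in> A" for c unfolding u(2) using fin that by (intro Max_ge) (auto simp: A_def)
    have "finite (len ` B)" "len ` B \<noteq> {}" using fin wC kw by (auto simp: B_def)
    then have "Min (len ` B) \<in> len ` B" by (rule Min_in)
    then obtain v where v: "v \<in> B" "len v = Min (len ` B)" by auto
    have vmin: "len v \<le> len c" if "c \<in> B" for c unfolding v(2) using fin that by (intro Min_le) (auto simp: B_def)
    have uC: "u \<in> C" "len u < k" and vC: "v \<in> C" "len v > k" using u v by (auto simp: A_def B_def)
    note uG = CG[OF uC(1)] and vG = CG[OF vC(1)]
    have uv: "le u v" using chain_le[OF C(2) uC(1) vC(1) uG(1) vG(1)] uC(2) vC(2) by simp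
    have "u \<noteq> v" using uC(2) vC(2) by auto
    then obtain x where x: "x \<in> G" "le u x" "le x v" "len x = len u + 1"
      using le_intermediate[OF uG(1) vG(1) uv] by blast
    have "x \<in> C"
    proof (rule max[OF x(1)])
      show "le x w" by (rule le_trans[OF x(1) vG(1) w x(3) vG(2)])
      fix c assume c: "c \<in> C"
      note cG = CG(1)[OF c]
      have "len c \<noteq> k" using k(2) c by auto
      then consider "c \<in> A" | "c \<in> B" using c unfolding A_def B_def by force
      then show "le x c \<or> le c x"
      proof cases
        case 1
        have "le c u" by (rule chain_le[OF C(2) c uC(1) cG uG(1) umax[OF 1]])
        then have "le c x" by (rule le_trans[OF cG uG(1) x(1) _ x(2)])
        then show ?thesis ..
      next
        case 2
        have "le v c" by (rule chain_le[OF C(2) vC(1) c vG(1) cG vmin[OF 2]])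
        then have "le x c" by (rule le_trans[OF x(1) vG(1) cG x(3)])
        then show ?thesis ..
      qed
    qed
    moreover have "len x \<le> k" using x(4) uC(2) by simp
    moreover have "len x \<noteq> k" using k(2) \<open>x \<in> C\<close> by auto
    ultimately have "x \<in> A" by (simp add: A_def)
    then show False using umax[of x] x(4) by simp
  qed
  moreover have "len ` C \<subseteq> {0..len w}" using CG le_len by auto
  ultimately show ?thesis using C by (auto simp: full_chains_def)
qed

lemma maxchain_iff_full_chains:
  assumes w: "w \<in> G" shows "pred_on.maxchain {u \<in> G. le u w} le C \<longleftrightarrow> C \<in> full_chains w"
proof
  assume C: "C \<in> full_chains w"
  then have "pred_on.chain {u \<in> G. le u w} le C" by (simp add: chain_iff full_chains_def)
  moreover have "\<not> C \<subset> D" if "pred_on.chain {u \<in> G. le u w} le D" for D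
    using full_chain_maximal[OF w C, of D] that unfolding chain_iff by blast
  ultimately show "pred_on.maxchain {u \<in> G. le u w} le C" unfolding pred_on.maxchain_def by blast
next
  assume m: "pred_on.maxchain {u \<in> G. le u w} le C"
  then have C: "C \<subseteq> {u \<in> G. le u w}" "is_chain C" by (simp_all add: pred_on.maxchain_def chain_iff)
  show "C \<in> full_chains w"
  proof (rule maxchain_full[OF w C])
    fix x assume x: "x \<in> G" "le x w" "\<And>y. y \<in> C \<Longrightarrow> le x y \<or> le y x"
    have "pred_on.chain {u \<in> G. le u w} le (insert x C)"
      unfolding chain_iff using is_chain_insert[OF C(2) x(1,3)] C(1) x(1,2) by simp
    then have "\<not> C \<subset> insert x C" using m unfolding pred_on.maxchain_def by blast
    then show "x \<in> C" by blast
  qed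
qed

end

text \<open>The polynomial \<open>(p * X) gchoose k\<close>.\<close>
primrec binom_poly :: "nat \<Rightarrow> nat \<Rightarrow> rat poly" where
  "binom_poly p 0 = 1"
| "binom_poly p (Suc k) = smult (1 / of_nat (Suc k)) (binom_poly p k * [:- of_nat k, of_nat p:])"

lemma poly_binom_poly: "poly (binom_poly p k) x = (x * of_nat p) gchoose k"
proof (induction k)
  case (Suc k)
  have "(x * of_nat p) gchoose Suc k = ((x * of_nat p) gchoose k) * (x * of_nat p - of_nat k) / of_nat (Suc k)"
    by (simp add: gbinomial_prod_rev field_simps)
  moreover have "poly [:- of_nat k, of_nat p:] x = x * of_nat p - of_nat k" by simp
  ultimately show ?case by (simp only: binom_poly.simps poly_smult poly_mult Suc) simp
qed simp

lemma degree_binom_poly: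
  assumes "p > 0" shows "degree (binom_poly p k) = k" and "coeff (binom_poly p k) k = of_nat p ^ k / fact k"
proof -
  have "binom_poly p k \<noteq> 0 \<and> degree (binom_poly p k) = k \<and> coeff (binom_poly p k) k = of_nat p ^ k / fact k"
  proof (induction k)
    case (Suc k)
    let ?l = "[:- of_nat k, of_nat p:] :: rat poly"
    have l: "?l \<noteq> 0" "degree ?l = 1" "coeff ?l 1 = of_nat p" using assms by auto
    have "degree (binom_poly p k * ?l) = degree (binom_poly p k) + degree ?l"
      by (rule degree_mult_eq) (use Suc l in auto)
    then have d: "degree (binom_poly p k * ?l) = Suc k" using Suc unfolding l(2) by linarith
    have "coeff (binom_poly p k * ?l) (degree (binom_poly p k) + degree ?l)
      = coeff (binom_poly p k) (degree (binom_poly p k)) * coeff ?l (degree ?l)" by (rule coeff_mult_degree_sum)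
    then have c: "coeff (binom_poly p k * ?l) (Suc k) = of_nat p ^ k / fact k * of_nat p"
      using Suc unfolding l(2) by (simp only: add_Suc_right add_0_right One_nat_def l(3)[unfolded One_nat_def])
    have "degree (binom_poly p (Suc k)) = Suc k" using d by (simp only: binom_poly.simps degree_smult_eq) simp
    moreover have "coeff (binom_poly p (Suc k)) (Suc k) = of_nat p ^ Suc k / fact (Suc k)"
      unfolding binom_poly.simps coeff_smult c by (simp add: field_simps)
    moreover from calculation have "binom_poly p (Suc k) \<noteq> 0" by (metis degree_0 nat.distinct(1))
    ultimately show ?case by blast
  qed simp
  then show "degree (binom_poly p k) = k" "coeff (binom_poly p k) k = of_nat p ^ k / fact k" by auto
qed

lemma coeff_binom_poly_mult:
  assumes "p > 0" "q > 0" "a + b = n"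
  shows "coeff (binom_poly p a * binom_poly q b) n = of_nat p ^ a * of_nat q ^ b / (fact a * fact b)"
  using coeff_mult_degree_sum[of "binom_poly p a" "binom_poly q b"] degree_binom_poly[OF assms(1), of a]
    degree_binom_poly[OF assms(2), of b] assms(3) by simp

theorem theorem5p3:
  fixes p q :: nat
  assumes "p > 0" and "q > 0"
  shows "(\<forall>m::rat. poly (zeta_polynomial (NC_B p q) (le_NC_B p q)) m =
            ((m * of_nat p) gchoose p) * ((m * of_nat q) gchoose q) +
            (\<Sum>c = 1..p. 2 * of_nat c * ((m * of_nat p) gchoose (p - c)) *
                                       ((m * of_nat q) gchoose (q + c))))
       \<and> card {C. pred_on.maxchain (NC_B p q) (le_NC_B p q) C} =
            ((p + q) choose p) * p ^ p * q ^ q +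
            (\<Sum>c = 1..p. 2 * c * ((p + q) choose (p - c)) * p ^ (p - c) * q ^ (q + c))"
proof -
  interpret hyperoctahedral_group "p + q" .
  define \<gamma> where "\<gamma> = gamma_B p q"
  define I where "I = {u \<in> G. le u \<gamma>}"
  have cyc: "cycles \<gamma> [] [[1..int p], [int p + 1..int (p + q)]]"
    unfolding \<gamma>_def by (rule gamma_B_cycles[OF assms])
  have \<gamma>: "\<gamma> \<in> G" by (rule cycles_hyper[OF cyc])
  \<comment> \<open>All labels lie on negative cycles, where fixed vectors vanish.\<close>
  have fix0: "Fix \<gamma> = {0}"
  proof (intro equalityI subsetI)
    fix x assume x: "x \<in> Fix \<gamma>"
    have z: "x i = 0" if "i \<in> {1..int (p + q)}" for i
      by (rule cycles_neg_Fix[OF cyc _ x]) (use that in auto)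
    have V: "x \<in> Vec" using x Fix_subset by blast
    have "x k = 0" for k
      unfolding Vec_decomp[OF V, of k] by (rule sum.neutral) (simp add: z)
    then show "x \<in> {0}" by (simp add: fun_eq_iff)
  qed (simp add: Fix_0)
  have len\<gamma>: "len \<gamma> = p + q"
  proof -
    have "(1::nat) * 3 ^ len \<gamma> = 1 * 3 ^ (p + q)" using card_Fix[OF \<gamma>] by (simp add: fix0 card_Vec)
    then show ?thesis by (rule pow3_cancel_eq[rotated]) simp
  qed
  have IG: "I \<subseteq> G" by (auto simp: I_def)
  have NC: "NC_B p q = Omega_tilde (p + q) ` I"
    by (simp add: NC_B_def S_nc_B_def I_def \<gamma>_def)
  have ord: "le_NC_B p q (Omega_tilde (p + q) u) (Omega_tilde (p + q) v) \<longleftrightarrow> le u v" if "u \<in> I" "v \<in> I" for u v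
    unfolding le_NC_B_def using that by (intro refines_Omega_tilde_iff_le[OF _ _ \<gamma> fix0]) (auto simp: I_def)
  have inj: "inj_on (Omega_tilde (p + q)) I"
  proof (rule inj_onI)
    fix u v assume uv: "u \<in> I" "v \<in> I" "Omega_tilde (p + q) u = Omega_tilde (p + q) v"
    have uG: "u \<in> G" "v \<in> G" using uv IG by auto
    have "le u v \<longleftrightarrow> le u u" "le v u \<longleftrightarrow> le u u" using ord[of u v] ord[of u u] ord[of v u] uv by simp_all
    then have "le u v" "le v u" using uG by simp_all
    then show "u = v" using le_antisym[OF uG] le_len by blast
  qed
  have mult: "card (multichains (NC_B p q) (le_NC_B p q) k) = factor_count (Suc k) \<gamma>" for k
  proof -
    have "card (multichains (NC_B p q) (le_NC_B p q) k) = card (multichains I le k)"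
      unfolding NC by (rule card_multichains_image[OF inj]) (rule ord; assumption)
    also have "\<dots> = factor_count (Suc k) \<gamma>" unfolding I_def by (rule card_multichains[OF \<gamma>])
    finally show ?thesis .
  qed
  have count: "of_nat (factor_count m \<gamma>) = annular_fps m q $ p" for m
    using factor_count_cycles[OF cyc, of m] assms by (simp add: pos_wt_def)
  define Z where "Z = binom_poly p p * binom_poly q q + (\<Sum>c=1..p. smult (2 * of_nat c) (binom_poly p (p - c) * binom_poly q (q + c)))"
  \<comment> \<open>A second expression for the zeta polynomial, whose leading coefficient contains the number of full chains.\<close>
  define Z' where "Z' = (\<Sum>k\<le>p + q. smult (of_nat (strict_count k \<gamma>)) (binom_poly 1 k))"
  have zZ: "is_zeta_polynomial (NC_B p q) (le_NC_B p q) Z" unfolding is_zeta_polynomial_def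
  proof (intro allI impI)
    fix m :: nat assume m: "m \<ge> 2"
    have "of_nat (card (multichains (NC_B p q) (le_NC_B p q) (m - 1))) = annular_fps m q $ p"
      using m by (simp add: mult count del: factor_count.simps)
    also have "\<dots> = poly Z (of_nat m)"
      unfolding annular_fps_nth[OF assms]
      by (simp add: Z_def poly_sum poly_binom_poly binomial_gbinomial mult.assoc)
    finally show "poly Z (of_nat m) = of_nat (card (multichains (NC_B p q) (le_NC_B p q) (m - 1)))" by simp
  qed
  have zZ': "is_zeta_polynomial (NC_B p q) (le_NC_B p q) Z'" unfolding is_zeta_polynomial_def
  proof (intro allI impI)
    fix m :: nat assume m: "m \<ge> 2"
    have "card (multichains (NC_B p q) (le_NC_B p q) (m - 1)) = factor_count m \<gamma>"
      using m by (simp add: mult del: factor_count.simps)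
    also have "\<dots> = (\<Sum>k\<le>p + q. (m choose k) * strict_count k \<gamma>)"
      unfolding factor_count_strict_len[OF \<gamma>] len\<gamma> ..
    finally show "poly Z' (of_nat m) = of_nat (card (multichains (NC_B p q) (le_NC_B p q) (m - 1)))"
      by (simp add: Z'_def poly_sum poly_binom_poly binomial_gbinomial mult.commute)
  qed
  have ZZ': "Z = Z'" by (rule is_zeta_polynomial_unique[OF zZ zZ'])
  have "coeff Z' (p + q) = (\<Sum>k\<le>p + q. if k = p + q then of_nat (strict_count (p + q) \<gamma>) / fact (p + q) else 0)"
    unfolding Z'_def coeff_sum
  proof (rule sum.cong[OF refl])
    fix k assume "k \<in> {..p + q}"
    then show "coeff (smult (of_nat (strict_count k \<gamma>)) (binom_poly 1 k)) (p + q) =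
      (if k = p + q then of_nat (strict_count (p + q) \<gamma>) / fact (p + q) else 0)"
      using degree_binom_poly[of 1 k] by (auto intro: coeff_eq_0)
  qed
  then have c1: "coeff Z' (p + q) = of_nat (strict_count (p + q) \<gamma>) / fact (p + q)" by simp
  have bin: "(fact (p + q) :: rat) / (fact a * fact b) = of_nat ((p + q) choose a)" if "a + b = p + q" for a b
  proof -
    have b: "b = p + q - a" and a: "a \<le> p + q" using that by simp_all
    show ?thesis unfolding b binomial_fact[OF a] ..
  qed
  have c2: "coeff Z (p + q) = of_nat p ^ p * of_nat q ^ q / (fact p * fact q)
     + (\<Sum>c=1..p. 2 * of_nat c * (of_nat p ^ (p - c) * of_nat q ^ (q + c) / (fact (p - c) * fact (q + c))))"
  proof -
    have e1: "coeff (binom_poly p p * binom_poly q q) (p + q) = of_nat p ^ p * of_nat q ^ q / (fact p * fact q)"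
      by (rule coeff_binom_poly_mult[OF assms]) simp
    have e2: "coeff (binom_poly p (p - c) * binom_poly q (q + c)) (p + q)
        = of_nat p ^ (p - c) * of_nat q ^ (q + c) / (fact (p - c) * fact (q + c))"
      if "c \<in> {1..p}" for c by (rule coeff_binom_poly_mult[OF assms]) (use that in simp)
    show ?thesis unfolding Z_def coeff_add coeff_sum coeff_smult e1
      by (intro arg_cong2[where f = "(+)"] sum.cong refl) (simp only: e2)
  qed
  have "of_nat (strict_count (p + q) \<gamma>) = fact (p + q) * coeff Z (p + q)"
    unfolding ZZ' c1 by simp
  also have "\<dots> = fact (p + q) / (fact p * fact q) * (of_nat p ^ p * of_nat q ^ q)
     + (\<Sum>c=1..p. 2 * of_nat c * (fact (p + q) / (fact (p - c) * fact (q + c))) * (of_nat p ^ (p - c) * of_nat q ^ (q + c)))"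
    unfolding c2 by (simp add: distrib_left sum_distrib_left mult_ac)
  also have "\<dots> = of_nat ((p + q) choose p) * (of_nat p ^ p * of_nat q ^ q)
     + (\<Sum>c=1..p. 2 * of_nat c * of_nat ((p + q) choose (p - c)) * (of_nat p ^ (p - c) * of_nat q ^ (q + c)))"
  proof -
    have b1: "(fact (p + q) :: rat) / (fact p * fact q) = of_nat ((p + q) choose p)" by (rule bin) simp
    have b2: "(fact (p + q) :: rat) / (fact (p - c) * fact (q + c)) = of_nat ((p + q) choose (p - c))"
      if "c \<in> {1..p}" for c by (rule bin) (use that in simp)
    show ?thesis unfolding b1 by (intro arg_cong2[where f = "(+)"] sum.cong refl) (simp only: b2)
  qed
  also have "\<dots> = of_nat (((p + q) choose p) * p ^ p * q ^ q +
            (\<Sum>c = 1..p. 2 * c * ((p + q) choose (p - c)) * p ^ (p - c) * q ^ (q + c)))"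
    by (simp add: mult.assoc)
  finally have sc: "strict_count (p + q) \<gamma> = ((p + q) choose p) * p ^ p * q ^ q +
            (\<Sum>c = 1..p. 2 * c * ((p + q) choose (p - c)) * p ^ (p - c) * q ^ (q + c))"
    unfolding of_nat_eq_iff .
  have "card {C. pred_on.maxchain (NC_B p q) (le_NC_B p q) C} = card {C. pred_on.maxchain I le C}"
    unfolding NC by (rule card_maxchains_image[OF inj]) (rule ord; assumption)
  also have "{C. pred_on.maxchain I le C} = full_chains \<gamma>"
    unfolding I_def maxchain_iff_full_chains[OF \<gamma>] by simp
  also have "card (full_chains \<gamma>) = strict_count (p + q) \<gamma>"
    using card_full_chains[OF \<gamma>] by (simp only: len\<gamma>)
  finally have part2: "card {C. pred_on.maxchain (NC_B p q) (le_NC_B p q) C} = strict_count (p + q) \<gamma>" .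
  have part1: "poly (zeta_polynomial (NC_B p q) (le_NC_B p q)) m =
            ((m * of_nat p) gchoose p) * ((m * of_nat q) gchoose q) +
            (\<Sum>c = 1..p. 2 * of_nat c * ((m * of_nat p) gchoose (p - c)) *
                                       ((m * of_nat q) gchoose (q + c)))" for m :: rat
    unfolding zeta_polynomial_eqI[OF zZ] by (simp add: Z_def poly_sum poly_binom_poly mult.assoc)
  show ?thesis using part1 part2 sc by simp
qed

end
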